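(* Let $G$ be a compact abelian group. If all $G_\delta$-dense subgroups of $G$ determine $G$, then $G$ is metrizable.
   Context: All spaces and topological groups are assumed to be Hausdorff; the result is in ZFC. A subgroup $D$ of a topological group $G$ is $G_\delta$-dense in $G$ if $D\cap B\neq\emptyset$ for every non-empty $G_\delta$-subset $B$ of $G$. For an abelian topological group $A$, $\widehat{A}$ denotes the dual group of all continuous characters (continuous homomorphisms $A\to\mathbb{T}$, where $\mathbb{T}$ is the circle group) endowed with the compact-open topology. A dense subgroup $D$ of an abelian topological group $G$ determines $G$ if the restriction homomorphism $\widehat{G}\to\widehat{D}$, $\chi\mapsto\chi\restriction_D$, is a topological isomorphism. *)

theory Defs
  imports "HOL-Analysis.Analysis" "HOL-Algebra.Group"
begin

text \<open>Every topological group is Hausdorff by convention.\<close>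

locale hausdorff_topological_group = group G for G (structure) +
  fixes T :: "'a topology"
  assumes topspace_eq_carrier: "topspace T = carrier G"
    and Hausdorff: "Hausdorff_space T"
    and continuous_mult: "continuous_map (prod_topology T T) T (\<lambda>(x, y). x \<otimes> y)"
    and continuous_inv: "continuous_map T T (\<lambda>x. inv x)"

definition gdelta_dense :: "'a topology \<Rightarrow> 'a set \<Rightarrow> bool" where
  "gdelta_dense T D \<longleftrightarrow> D \<subseteq> topspace T \<and> (\<forall>B. gdelta_in T B \<and> B \<noteq> {} \<longrightarrow> D \<inter> B \<noteq> {})"

definition circle_group :: "complex monoid" where
  "circle_group = \<lparr>carrier = sphere 0 1, mult = (*), one = 1\<rparr>"

definition circle_topology :: "complex topology" where
  "circle_topology = top_of_set (sphere 0 1)"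

text \<open>Functions on a carrier set are represented by \<^const>\<open>extensional\<close> functions, so that two
  continuous maps on \<open>X\<close> are equal as soon as they agree on \<open>topspace X\<close>.\<close>

definition continuous_maps :: "'a topology \<Rightarrow> 'b topology \<Rightarrow> ('a \<Rightarrow> 'b) set" where
  "continuous_maps X Y = {f \<in> extensional (topspace X). continuous_map X Y f}"

definition compact_open_topology :: "'a topology \<Rightarrow> 'b topology \<Rightarrow> ('a \<Rightarrow> 'b) topology" where
  "compact_open_topology X Y =
     topology_generated_by
       {{f \<in> continuous_maps X Y. f ` K \<subseteq> U} | K U. compactin X K \<and> openin Y U}"

lemma topspace_compact_open_topology [simp]:
  "topspace (compact_open_topology X Y) = continuous_maps X Y"
proof -
  have "continuous_maps X Y \<in>
      {{f \<in> continuous_maps X Y. f ` K \<subseteq> U} | K U. compactin X K \<and> openin Y U}"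
    by (rule CollectI, rule exI[of _ "{}"], rule exI[of _ "{}"]) auto
  then show ?thesis
    unfolding compact_open_topology_def topology_generated_by_topspace by auto
qed

definition characters :: "('a, 'm) monoid_scheme \<Rightarrow> 'a topology \<Rightarrow> ('a \<Rightarrow> complex) set" where
  "characters G T = hom G circle_group \<inter> continuous_maps T circle_topology"

definition dual_group :: "('a, 'm) monoid_scheme \<Rightarrow> 'a topology \<Rightarrow> ('a \<Rightarrow> complex) monoid" where
  "dual_group G T =
     \<lparr>carrier = characters G T,
      mult = (\<lambda>\<phi> \<psi>. \<lambda>x\<in>carrier G. \<phi> x \<otimes>\<^bsub>circle_group\<^esub> \<psi> x),
      one = (\<lambda>x\<in>carrier G. \<one>\<^bsub>circle_group\<^esub>)\<rparr>"

definition dual_topology ::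
    "('a, 'm) monoid_scheme \<Rightarrow> 'a topology \<Rightarrow> ('a \<Rightarrow> complex) topology" where
  "dual_topology G T =
     subtopology (compact_open_topology T circle_topology) (characters G T)"

lemma topspace_dual_topology [simp]:
  "topspace (dual_topology G T) = carrier (dual_group G T)"
  by (auto simp: dual_topology_def dual_group_def characters_def)

definition topological_group_isomorphism ::
    "('a, 'm) monoid_scheme \<Rightarrow> 'a topology \<Rightarrow> ('b, 'n) monoid_scheme \<Rightarrow> 'b topology
      \<Rightarrow> ('a \<Rightarrow> 'b) \<Rightarrow> bool" where
  "topological_group_isomorphism G T H S f \<longleftrightarrow> f \<in> iso G H \<and> homeomorphic_map T S f"

definition determines :: "'a set \<Rightarrow> ('a, 'm) monoid_scheme \<Rightarrow> 'a topology \<Rightarrow> bool" where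
  "determines D G T \<longleftrightarrow>
     subgroup D G \<and> T closure_of D = topspace T \<and>
     topological_group_isomorphism
       (dual_group G T) (dual_topology G T)
       (dual_group (G\<lparr>carrier := D\<rparr>) (subtopology T D))
       (dual_topology (G\<lparr>carrier := D\<rparr>) (subtopology T D))
       (\<lambda>\<phi>. restrict \<phi> D)"

end

theory Submission
  imports Defs
begin

text \<open>A compact abelian group \<open>G\<close> has enough continuous characters: among the positive definite functions \<open>\<psi>\<close>
  with \<open>\<psi>(1) = 1\<close>, which form a compact convex set for pointwise convergence, an extreme one is a
  (possibly discontinuous) character, and it is continuous if it maximizes the asymptotic correlation
  with a continuous positive definite function. So \<open>G\<close> is metrizable unless its dual is uncountable.

  An uncountable dual contains an uncountable family \<open>\<xi>\<^sub>i\<^sub>k\<close> that is independent over \<open>\<int>\<close> or over some \<open>\<int>/m\<close>. Let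
  \<open>D\<close> be a group of elements \<open>g\<close> for which \<open>\<xi>\<^sub>i\<^sub>k(g)\<close> does not depend on \<open>i\<close> outside a countable set, so that
  \<open>g\<close> has an eventual value \<open>r(g)\<close>, a sequence in the circle. There are only continuum many ways to prescribe countably many
  coordinates, so they can be paired with independent eventual values; this makes \<open>D\<close>
  \<open>G\<^sub>\<delta>\<close>-dense while \<open>r(g)\<close> still determines every \<open>\<xi>\<^sub>i\<^sub>k(g)\<close>. The injectivity of \<open>r\<close> forces every compact
  \<open>C \<subseteq> D\<close> to behave like a separable space, and then \<open>\<xi>\<^sub>i\<^sub>0 = \<xi>\<^sub>j\<^sub>0\<close> on \<open>C\<close> for some \<open>i \<noteq> j\<close>. Thus no compact
  subset of \<open>D\<close> isolates the trivial character, although the dual of \<open>G\<close> is discrete.\<close>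

section \<open>Averages and the invariant mean\<close>

text \<open>Means are limits of averages over finite lists of translates. The same averages make
  sense for discontinuous states, and the correlation that an extreme state maximizes is an infimum
  of quadratic averages over lists.

  The modulus \<open>m\<close> is the least positive exponent that kills uncountably many
  characters, or 0 if there is none. With this choice a power whose exponent is not divisible by
  \<open>m\<close> has countable fibres among the characters killed by \<open>m\<close>, so a
  maximal independent set cannot be countable.

  When \<open>m\<close> is positive, a single circle coordinate has only finitely many admissible
  values and cannot hold continuum many independent ones. This is why every index i owns a whole
  sequence of characters. The indices are real numbers whatever the size of the dual, so that a
  countable prescription is a countable list of reals and can be coded by a set of naturals.

  A prescription of values is solvable only if it respects all relations among the characters
  involved. Density of \<open>D\<close> is possible because countably many characters of
  \<open>G\<close> are related, modulo \<open>m\<close>, to only countably many members of the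
  family.\<close>

definition avg :: "'a list \<Rightarrow> ('a \<Rightarrow> real) \<Rightarrow> real" where
  "avg xs f = (\<Sum>x\<leftarrow>xs. f x) / real (length xs)"

lemma avg_const [simp]: "xs \<noteq> [] \<Longrightarrow> avg xs (\<lambda>_. c) = c"
  by (simp add: avg_def sum_list_triv)

lemma avg_add: "avg xs (\<lambda>x. f x + g x) = avg xs f + avg xs g"
  by (simp add: avg_def sum_list_addf add_divide_distrib)

lemma avg_diff: "avg xs (\<lambda>x. f x - g x) = avg xs f - avg xs g"
  by (simp add: avg_def sum_list_subtractf diff_divide_distrib)

lemma avg_cmult: "avg xs (\<lambda>x. c * f x) = c * avg xs f"
  by (simp add: avg_def sum_list_const_mult)

lemma avg_mono: "(\<And>x. x \<in> set xs \<Longrightarrow> f x \<le> g x) \<Longrightarrow> avg xs f \<le> avg xs g"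
  by (auto simp: avg_def intro!: divide_right_mono sum_list_mono)

lemma avg_cong: "(\<And>x. x \<in> set xs \<Longrightarrow> f x = g x) \<Longrightarrow> avg xs f = avg xs g"
  unfolding avg_def by (metis (mono_tags, lifting) map_cong)

lemma sum_list_swap:
  fixes f :: "'a \<Rightarrow> 'b \<Rightarrow> 'c::comm_monoid_add"
  shows "(\<Sum>x\<leftarrow>xs. \<Sum>y\<leftarrow>ys. f x y) = (\<Sum>y\<leftarrow>ys. \<Sum>x\<leftarrow>xs. f x y)"
  by (induction xs) (simp_all add: sum_list_addf)

lemma sum_list_divide:
  fixes f :: "'a \<Rightarrow> real"
  shows "(\<Sum>x\<leftarrow>xs. f x / c) = (\<Sum>x\<leftarrow>xs. f x) / c"
  by (induction xs) (simp_all add: add_divide_distrib)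

lemma avg_avg:
  "avg xs (\<lambda>x. avg ys (f x)) = (\<Sum>x\<leftarrow>xs. \<Sum>y\<leftarrow>ys. f x y) / (real (length xs) * real (length ys))"
  unfolding avg_def sum_list_divide by (simp add: mult.commute)

lemma avg_swap: "avg xs (\<lambda>x. avg ys (f x)) = avg ys (\<lambda>y. avg xs (\<lambda>x. f x y))"
  unfolding avg_avg using sum_list_swap[of f ys xs] by (simp add: mult.commute)

lemma avg_bounds:
  assumes "xs \<noteq> []" "\<And>x. x \<in> set xs \<Longrightarrow> \<bar>f x - c\<bar> \<le> \<epsilon>"
  shows "\<bar>avg xs f - c\<bar> \<le> \<epsilon>"
proof -
  have "avg xs f \<le> avg xs (\<lambda>_. c + \<epsilon>)" "avg xs (\<lambda>_. c - \<epsilon>) \<le> avg xs f"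
    using assms(2) by (auto intro!: avg_mono simp: abs_le_iff algebra_simps)
  then show ?thesis using assms(1) by simp
qed

text \<open>One entry is bounded by \<open>a\<close> and the others by \<open>u\<close>: this is the
  form in which averaging over translates lowers a maximum.\<close>

lemma avg_le_one_small:
  assumes "c \<in> set cs" "h c \<le> a" "\<And>x. x \<in> set cs \<Longrightarrow> h x \<le> u"
  shows "real (length cs) * avg cs h \<le> (real (length cs) - 1) * u + a"
proof -
  obtain ys zs where cs: "cs = ys @ c # zs" using split_list[OF assms(1)] by blast
  have *: "(\<Sum>x\<leftarrow>xs. h x) \<le> real (length xs) * u" if "set xs \<subseteq> set cs" for xs
  proof -
    have "(\<Sum>x\<leftarrow>xs. h x) \<le> (\<Sum>x\<leftarrow>xs. u)" using that assms(3) by (intro sum_list_mono) auto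
    then show ?thesis by (simp add: sum_list_triv)
  qed
  have "(\<Sum>x\<leftarrow>ys. h x) \<le> real (length ys) * u" "(\<Sum>x\<leftarrow>zs. h x) \<le> real (length zs) * u"
    by (rule *, force simp: cs)+
  moreover have "real (length cs) * avg cs h = (\<Sum>x\<leftarrow>ys. h x) + (h c + (\<Sum>x\<leftarrow>zs. h x))"
    unfolding avg_def by (simp add: cs)
  ultimately show ?thesis
    using assms(2) by (simp add: cs algebra_simps)
qed

locale compact_abelian_group = comm_group G + hausdorff_topological_group G T
  for G (structure) and T +
  assumes compact: "compact_space T"
begin

abbreviation "finlists \<equiv> {xs. xs \<noteq> [] \<and> set xs \<subseteq> carrier G}"

text \<open>Convolution of the uniform distributions on two lists. Repeated products are kept, so
  that averages iterate exactly.\<close>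

definition list_mult :: "'a list \<Rightarrow> 'a list \<Rightarrow> 'a list" where
  "list_mult xs ys = concat (map (\<lambda>x. map (\<lambda>y. x \<otimes> y) ys) xs)"

lemma list_mult_in: "xs \<in> finlists \<Longrightarrow> ys \<in> finlists \<Longrightarrow> list_mult xs ys \<in> finlists"
  by (cases xs; cases ys) (auto simp: list_mult_def)

lemma avg_list_mult: "avg (list_mult xs ys) f = avg xs (\<lambda>x. avg ys (\<lambda>y. f (x \<otimes> y)))"
proof -
  have "(\<Sum>z\<leftarrow>list_mult xs ys. f z) = (\<Sum>x\<leftarrow>xs. \<Sum>y\<leftarrow>ys. f (x \<otimes> y))"
    by (induction xs) (simp_all add: list_mult_def o_def)
  moreover have "length (list_mult xs ys) = length xs * length ys"
    by (induction xs) (simp_all add: list_mult_def)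
  ultimately show ?thesis unfolding avg_avg by (simp add: avg_def)
qed

lemma continuous_translate: "a \<in> carrier G \<Longrightarrow> continuous_map T T (\<lambda>x. x \<otimes> a)"
proof -
  assume a: "a \<in> carrier G"
  have "continuous_map T (prod_topology T T) (\<lambda>x. (x, a))"
    using a by (auto intro!: continuous_map_pairedI simp: topspace_eq_carrier)
  from continuous_map_compose[OF this continuous_mult] show ?thesis by (simp add: o_def)
qed

lemma cont_translate:
  "continuous_map T Y f \<Longrightarrow> a \<in> carrier G \<Longrightarrow> continuous_map T Y (\<lambda>x. f (x \<otimes> a))"
  using continuous_map_compose[OF continuous_translate, of a Y f] by (simp add: o_def)

text \<open>The tube lemma around \<open>carrier G\<close> times the unit gives one neighbourhood
  that works for all \<open>x\<close>.\<close>

lemma uniform_continuity: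
  fixes f :: "'a \<Rightarrow> real"
  assumes f: "continuous_map T euclideanreal f" and "\<epsilon> > 0"
  obtains V where "openin T V" "\<one> \<in> V" "\<And>x v. x \<in> carrier G \<Longrightarrow> v \<in> V \<Longrightarrow> \<bar>f (x \<otimes> v) - f x\<bar> < \<epsilon>"
proof -
  have 1: "continuous_map (prod_topology T T) euclideanreal (\<lambda>(x, y). f (x \<otimes> y))"
    using continuous_map_compose[OF continuous_mult f] by (simp add: o_def case_prod_unfold)
  have 2: "continuous_map (prod_topology T T) euclideanreal (\<lambda>z. f (fst z))"
    using continuous_map_compose[OF continuous_map_fst f] by (simp add: o_def)
  have "continuous_map (prod_topology T T) euclideanreal (\<lambda>z. \<bar>f (fst z \<otimes> snd z) - f (fst z)\<bar>)"
    using 1 2 by (intro continuous_map_real_abs continuous_map_diff) (auto simp: case_prod_unfold)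
  from openin_continuous_map_preimage[OF this, of "{..<\<epsilon>}"]
  have W: "openin (prod_topology T T) {z \<in> topspace (prod_topology T T). \<bar>f (fst z \<otimes> snd z) - f (fst z)\<bar> < \<epsilon>}"
    (is "openin _ ?W") by simp
  have "carrier G \<times> {\<one>} \<subseteq> ?W"
    using assms(2) by (auto simp: topspace_eq_carrier)
  moreover have "compactin T (carrier G)"
    using compact by (simp add: compact_space_def topspace_eq_carrier)
  ultimately obtain U V where "openin T U" "openin T V" "carrier G \<subseteq> U" "{\<one>} \<subseteq> V" "U \<times> V \<subseteq> ?W"
    using tube_lemma_left[OF W, of "carrier G" \<one>] by (auto simp: topspace_eq_carrier)
  moreover have "\<bar>f (x \<otimes> v) - f x\<bar> < \<epsilon>" if "x \<in> carrier G" "v \<in> V" for x v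
  proof -
    have "(x, v) \<in> ?W" using that calculation by blast
    then show ?thesis by simp
  qed
  ultimately show thesis by (intro that[of V]) auto
qed

text \<open>The translation by \<open>inv x \<otimes> x0\<close> moves \<open>x\<close> to
  \<open>x0\<close>, so the open sets of all \<open>x\<close> with
  \<open>x \<otimes> c \<in> V\<close> cover the group, and compactness leaves finitely many
  \<open>c\<close>.\<close>

lemma finite_translates:
  assumes "openin T V" "x0 \<in> V"
  obtains cs where "cs \<in> finlists" "\<And>x. x \<in> carrier G \<Longrightarrow> \<exists>c\<in>set cs. x \<otimes> c \<in> V"
proof -
  have x0: "x0 \<in> carrier G" using assms openin_subset topspace_eq_carrier by auto
  let ?N = "\<lambda>c. {x \<in> topspace T. x \<otimes> c \<in> V}"
  have "\<And>U. U \<in> ?N ` carrier G \<Longrightarrow> openin T U"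
    using openin_continuous_map_preimage[OF continuous_translate assms(1)] by auto
  moreover have "topspace T \<subseteq> \<Union> (?N ` carrier G)"
  proof
    fix x assume x: "x \<in> topspace T"
    then have "x \<otimes> (inv x \<otimes> x0) = x0" using x0 by (simp add: topspace_eq_carrier m_assoc[symmetric])
    then show "x \<in> \<Union> (?N ` carrier G)"
      using x x0 assms(2) by (auto simp: topspace_eq_carrier intro!: bexI[of _ "inv x \<otimes> x0"])
  qed
  ultimately obtain \<F> where F: "finite \<F>" "\<F> \<subseteq> ?N ` carrier G" "topspace T \<subseteq> \<Union> \<F>"
    using compact unfolding compact_space_alt by (metis (no_types, lifting))
  then obtain C where C: "finite C" "C \<subseteq> carrier G" "\<F> = ?N ` C"
    by (meson finite_subset_image)
  obtain cs where cs: "set cs = C" using C finite_list by auto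
  have *: "\<exists>c\<in>set cs. x \<otimes> c \<in> V" if "x \<in> carrier G" for x
    using F(3) C that cs by (auto simp: topspace_eq_carrier)
  from *[of \<one>] have "cs \<noteq> []" by auto
  with cs C * show thesis by (intro that[of cs]) auto
qed

text \<open>Von Neumann's approach to the Haar integral: a constant that finite averages of
  translates of \<open>f\<close> approximate uniformly in \<open>z\<close>.\<close>

definition is_mean :: "('a \<Rightarrow> real) \<Rightarrow> real \<Rightarrow> bool" where
  "is_mean f c \<longleftrightarrow> (\<forall>\<epsilon>>0. \<exists>xs\<in>finlists. \<forall>z\<in>carrier G. \<bar>avg xs (\<lambda>x. f (z \<otimes> x)) - c\<bar> \<le> \<epsilon>)"

text \<open>A further averaging preserves a uniform approximation, on either side by commutativity.
  Two approximations thus share the product list, which yields monotonicity, uniqueness and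
  additivity of means.\<close>

lemma approx_mean_list_mult:
  assumes "xs \<in> finlists" "ys \<in> finlists" "\<forall>z\<in>carrier G. \<bar>avg xs (\<lambda>x. f (z \<otimes> x)) - c\<bar> \<le> \<epsilon>"
    and "z \<in> carrier G"
  shows "\<bar>avg (list_mult ys xs) (\<lambda>x. f (z \<otimes> x)) - c\<bar> \<le> \<epsilon>"
    and "\<bar>avg (list_mult xs ys) (\<lambda>x. f (z \<otimes> x)) - c\<bar> \<le> \<epsilon>"
proof -
  have "avg (list_mult ys xs) (\<lambda>x. f (z \<otimes> x)) = avg ys (\<lambda>y. avg xs (\<lambda>x. f (z \<otimes> y \<otimes> x)))"
    using assms unfolding avg_list_mult by (intro avg_cong) (auto intro!: avg_cong simp: m_assoc subset_iff)
  also have "\<bar>\<dots> - c\<bar> \<le> \<epsilon>"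
    using assms by (intro avg_bounds[of ys]) auto
  finally show 1: "\<bar>avg (list_mult ys xs) (\<lambda>x. f (z \<otimes> x)) - c\<bar> \<le> \<epsilon>" .
  have "avg (list_mult xs ys) (\<lambda>x. f (z \<otimes> x)) = avg (list_mult ys xs) (\<lambda>x. f (z \<otimes> x))"
    using assms unfolding avg_list_mult
    by (subst avg_swap, intro avg_cong) (auto intro!: avg_cong simp: m_comm subset_iff)
  with 1 show "\<bar>avg (list_mult xs ys) (\<lambda>x. f (z \<otimes> x)) - c\<bar> \<le> \<epsilon>" by simp
qed

lemma is_mean_mono:
  assumes "is_mean f c" "is_mean g d" "\<And>x. x \<in> carrier G \<Longrightarrow> f x \<le> g x"
  shows "c \<le> d"
proof (rule field_le_epsilon)
  fix e :: real assume "e > 0"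
  then have e: "e/2 > 0" by simp
  obtain xs where xs: "xs \<in> finlists" "\<forall>z\<in>carrier G. \<bar>avg xs (\<lambda>x. f (z \<otimes> x)) - c\<bar> \<le> e/2"
    using assms(1) e unfolding is_mean_def by blast
  obtain ys where ys: "ys \<in> finlists" "\<forall>z\<in>carrier G. \<bar>avg ys (\<lambda>x. g (z \<otimes> x)) - d\<bar> \<le> e/2"
    using assms(2) e unfolding is_mean_def by blast
  let ?zs = "list_mult xs ys"
  have zs: "?zs \<in> finlists" using xs ys list_mult_in by blast
  have "\<bar>avg ?zs (\<lambda>x. f (\<one> \<otimes> x)) - c\<bar> \<le> e/2"
    by (rule approx_mean_list_mult(2)[OF xs(1) ys(1) xs(2)]) simp
  moreover have "\<bar>avg ?zs (\<lambda>x. g (\<one> \<otimes> x)) - d\<bar> \<le> e/2"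
    by (rule approx_mean_list_mult(1)[OF ys(1) xs(1) ys(2)]) simp
  moreover have "avg ?zs (\<lambda>x. f (\<one> \<otimes> x)) \<le> avg ?zs (\<lambda>x. g (\<one> \<otimes> x))"
    using zs assms(3) by (intro avg_mono) auto
  ultimately show "c \<le> d + e" by linarith
qed

lemma is_mean_unique: "is_mean f c \<Longrightarrow> is_mean f d \<Longrightarrow> c = d"
  using is_mean_mono[of f c f d] is_mean_mono[of f d f c] by force

lemma is_mean_const: "is_mean (\<lambda>_. c) c"
  unfolding is_mean_def by (auto intro!: exI[of _ "[\<one>]"])

lemma is_mean_add:
  assumes "is_mean f c" "is_mean g d"
  shows "is_mean (\<lambda>x. f x + g x) (c + d)"
  unfolding is_mean_def
proof (intro allI impI)
  fix e :: real assume "e > 0"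
  then have e: "e/2 > 0" by simp
  obtain xs where xs: "xs \<in> finlists" "\<forall>z\<in>carrier G. \<bar>avg xs (\<lambda>x. f (z \<otimes> x)) - c\<bar> \<le> e/2"
    using assms(1) e unfolding is_mean_def by blast
  obtain ys where ys: "ys \<in> finlists" "\<forall>z\<in>carrier G. \<bar>avg ys (\<lambda>x. g (z \<otimes> x)) - d\<bar> \<le> e/2"
    using assms(2) e unfolding is_mean_def by blast
  have "\<bar>avg (list_mult xs ys) (\<lambda>x. f (z \<otimes> x) + g (z \<otimes> x)) - (c + d)\<bar> \<le> e" if z: "z \<in> carrier G" for z
    using approx_mean_list_mult(2)[OF xs(1) ys(1) xs(2) z] approx_mean_list_mult(1)[OF ys(1) xs(1) ys(2) z]
    unfolding avg_add by linarith
  then show "\<exists>xs\<in>finlists. \<forall>z\<in>carrier G. \<bar>avg xs (\<lambda>x. f (z \<otimes> x) + g (z \<otimes> x)) - (c + d)\<bar> \<le> e"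
    using list_mult_in xs ys by blast
qed

lemma is_mean_cmult:
  assumes "is_mean f c"
  shows "is_mean (\<lambda>x. a * f x) (a * c)"
  unfolding is_mean_def
proof (intro allI impI)
  fix e :: real assume "e > 0"
  then have e: "e / (\<bar>a\<bar> + 1) > 0" by simp
  obtain xs where xs: "xs \<in> finlists" "\<forall>z\<in>carrier G. \<bar>avg xs (\<lambda>x. f (z \<otimes> x)) - c\<bar> \<le> e / (\<bar>a\<bar> + 1)"
    using assms(1) e unfolding is_mean_def by blast
  have "\<bar>avg xs (\<lambda>x. a * f (z \<otimes> x)) - a * c\<bar> \<le> e" if z: "z \<in> carrier G" for z
  proof -
    have "\<bar>avg xs (\<lambda>x. a * f (z \<otimes> x)) - a * c\<bar> = \<bar>a\<bar> * \<bar>avg xs (\<lambda>x. f (z \<otimes> x)) - c\<bar>"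
      by (simp add: avg_cmult abs_mult[symmetric] right_diff_distrib)
    also have "\<dots> \<le> \<bar>a\<bar> * (e / (\<bar>a\<bar> + 1))" using xs z by (intro mult_left_mono) auto
    also have "\<dots> \<le> e" using \<open>e > 0\<close> by (simp add: field_simps)
    finally show ?thesis .
  qed
  then show "\<exists>xs\<in>finlists. \<forall>z\<in>carrier G. \<bar>avg xs (\<lambda>x. a * f (z \<otimes> x)) - a * c\<bar> \<le> e"
    using xs by blast
qed

lemma is_mean_translate:
  assumes "is_mean f c" "a \<in> carrier G"
  shows "is_mean (\<lambda>x. f (x \<otimes> a)) c"
  unfolding is_mean_def
proof (intro allI impI)
  fix e :: real assume "e > 0"
  then obtain xs where xs: "xs \<in> finlists" "\<forall>z\<in>carrier G. \<bar>avg xs (\<lambda>x. f (z \<otimes> x)) - c\<bar> \<le> e"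
    using assms(1) unfolding is_mean_def by blast
  have "\<bar>avg xs (\<lambda>x. f (z \<otimes> x \<otimes> a)) - c\<bar> \<le> e" if z: "z \<in> carrier G" for z
  proof -
    have "avg xs (\<lambda>x. f (z \<otimes> x \<otimes> a)) = avg xs (\<lambda>x. f ((z \<otimes> a) \<otimes> x))"
      using assms(2) z xs(1) by (intro avg_cong) (auto simp: m_ac subset_iff)
    then show ?thesis using xs z assms(2) by simp
  qed
  then show "\<exists>xs\<in>finlists. \<forall>z\<in>carrier G. \<bar>avg xs (\<lambda>x. f (z \<otimes> x \<otimes> a)) - c\<bar> \<le> e"
    using xs by blast
qed

lemma continuous_bounded:
  assumes "continuous_map T euclideanreal f"
  obtains B where "B > 0" "\<And>x. x \<in> carrier G \<Longrightarrow> \<bar>f x\<bar> \<le> B"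
proof -
  have "compact (f ` carrier G)"
    using image_compactin[OF _ assms, of "carrier G"] compact
    by (simp add: compact_space_def topspace_eq_carrier)
  then have "bounded (f ` carrier G)" by (rule compact_imp_bounded)
  then show thesis using that unfolding bounded_pos by auto
qed

lemma avg_list_mult_translate:
  assumes "cs \<in> finlists" "xs \<in> finlists" "z \<in> carrier G"
  shows "avg (list_mult cs xs) (\<lambda>x. f (z \<otimes> x)) = avg cs (\<lambda>c. avg xs (\<lambda>x. f (z \<otimes> c \<otimes> x)))"
  unfolding avg_list_mult using assms by (intro avg_cong) (auto intro!: avg_cong simp: m_assoc subset_iff)

text \<open>The infimum of the maxima of the averages is the mean: if an average stayed below it by a fixed
  amount somewhere, averaging once more over finitely many translates would lower the maximum.\<close>

lemma continuous_has_mean: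
  assumes f: "continuous_map T euclideanreal f"
  shows "\<exists>c. is_mean f c"
proof -
  define F where "F = (\<lambda>xs z. avg xs (\<lambda>x. f (z \<otimes> x)))"
  define U where "U = {u. \<exists>xs\<in>finlists. \<forall>z\<in>carrier G. F xs z \<le> u}"
  obtain B where B: "B > 0" "\<And>x. x \<in> carrier G \<Longrightarrow> \<bar>f x\<bar> \<le> B"
    using continuous_bounded[OF f] by blast
  have FB: "\<bar>F xs z - 0\<bar> \<le> B" if "xs \<in> finlists" "z \<in> carrier G" for xs z
    unfolding F_def using that B(2) by (intro avg_bounds) auto
  have "F [\<one>] z \<le> B" if "z \<in> carrier G" for z
    using FB[of "[\<one>]" z] that by simp
  then have U: "U \<noteq> {}" unfolding U_def by (auto intro!: exI[of _ B] exI[of _ "[\<one>]"])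
  have "- B \<le> u" if "u \<in> U" for u
  proof -
    obtain xs where "xs \<in> finlists" "\<forall>z\<in>carrier G. F xs z \<le> u"
      using \<open>u \<in> U\<close> unfolding U_def by blast
    then show ?thesis using FB[of xs \<one>] by force
  qed
  then have bdd: "bdd_below U" by (rule bdd_belowI)
  define m where "m = Inf U"
  have "is_mean f m"
    unfolding is_mean_def
  proof (intro allI impI)
    fix e :: real assume e: "e > 0"
    then obtain V where V: "openin T V" "\<one> \<in> V"
      "\<And>x v. x \<in> carrier G \<Longrightarrow> v \<in> V \<Longrightarrow> \<bar>f (x \<otimes> v) - f x\<bar> < e/2"
      using uniform_continuity[OF f, of "e/2"] by auto
    have VG: "V \<subseteq> carrier G" using V(1) openin_subset topspace_eq_carrier by auto
    obtain cs where cs: "cs \<in> finlists" "\<And>x. x \<in> carrier G \<Longrightarrow> \<exists>c\<in>set cs. x \<otimes> c \<in> V"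
      using finite_translates[OF V(1,2)] by blast
    define K where "K = real (length cs)"
    have K: "K \<ge> 1" using cs(1) unfolding K_def by (cases cs) auto
    have "m < m + e/(2*K)" using e K by simp
    then obtain u where u: "u \<in> U" "u < m + e/(2*K)"
      unfolding m_def using cInf_lessD[OF U] by blast
    then obtain xs where xs: "xs \<in> finlists" "\<And>z. z \<in> carrier G \<Longrightarrow> F xs z \<le> u"
      unfolding U_def by blast
    have "m - e \<le> F xs z0" if z0: "z0 \<in> carrier G" for z0
    proof (rule ccontr)
      assume neg: "\<not> m - e \<le> F xs z0"
      have small: "F xs (z0 \<otimes> v) \<le> m - e/2" if v: "v \<in> V" for v
      proof -
        have "\<bar>avg xs (\<lambda>x. f (z0 \<otimes> v \<otimes> x) - f (z0 \<otimes> x)) - 0\<bar> \<le> e/2"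
        proof (intro avg_bounds)
          fix x assume "x \<in> set xs"
          then have x: "x \<in> carrier G" using xs(1) by auto
          have "z0 \<otimes> v \<otimes> x = z0 \<otimes> x \<otimes> v" using x v z0 VG by (auto simp: m_ac)
          then show "\<bar>f (z0 \<otimes> v \<otimes> x) - f (z0 \<otimes> x) - 0\<bar> \<le> e/2"
            using V(3)[of "z0 \<otimes> x" v] x z0 v by simp
        qed (use xs in auto)
        then show ?thesis using neg unfolding F_def avg_diff by linarith
      qed
      \<comment> \<open>One of the \<open>K\<close> entries is at most m - e/2 and the others are
        below m + e/(2K). The sum is then at most K m - e/(2K), and division by \<open>K\<close>
        gives this bound.\<close>
      let ?d = "m - e/(2*K*K)"
      have "F (list_mult cs xs) z \<le> ?d" if z: "z \<in> carrier G" for z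
      proof -
        have "z \<otimes> inv z0 \<in> carrier G" using z z0 by simp
        then obtain c where c: "c \<in> set cs" "z \<otimes> inv z0 \<otimes> c \<in> V" using cs(2) by blast
        then have cG: "c \<in> carrier G" using cs by auto
        have "z0 \<otimes> (z \<otimes> inv z0) = z" using m_lcomm[of z0 z "inv z0"] z z0 by simp
        then have "z0 \<otimes> (z \<otimes> inv z0 \<otimes> c) = z \<otimes> c"
          using m_assoc[of z0 "z \<otimes> inv z0" c] z z0 cG by simp
        with small[OF c(2)] have "F xs (z \<otimes> c) \<le> m - e/2" by simp
        then have "K * avg cs (\<lambda>c. F xs (z \<otimes> c)) \<le> (K - 1) * u + (m - e/2)"
          unfolding K_def using cs(1) z c(1) by (intro avg_le_one_small) (auto intro!: xs(2))
        also have "\<dots> \<le> (K - 1) * (m + e/(2*K)) + (m - e/2)"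
          using u K by (intro add_right_mono mult_left_mono) auto
        also have "\<dots> = K * ?d" using K by (simp add: field_simps)
        finally have "avg cs (\<lambda>c. F xs (z \<otimes> c)) \<le> ?d" using K by simp
        moreover have "F (list_mult cs xs) z = avg cs (\<lambda>c. F xs (z \<otimes> c))"
          unfolding F_def by (rule avg_list_mult_translate[OF cs(1) xs(1) z])
        ultimately show ?thesis by simp
      qed
      then have "?d \<in> U" unfolding U_def using list_mult_in[OF cs(1) xs(1)] by blast
      then have "m \<le> ?d" unfolding m_def using bdd by (rule cInf_lower)
      moreover have "0 < e/(2*K*K)" using e K by (intro divide_pos_pos mult_pos_pos) auto
      ultimately show False by simp
    qed
    moreover have "F xs z \<le> m + e" if "z \<in> carrier G" for z
    proof -
      have "e/(2*K) \<le> e" using e K by (simp add: field_simps)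
      then show ?thesis using xs(2)[OF that] u(2) by linarith
    qed
    ultimately have "\<bar>F xs z - m\<bar> \<le> e" if "z \<in> carrier G" for z
      unfolding abs_le_iff using that by (smt (verit))
    then show "\<exists>xs\<in>finlists. \<forall>z\<in>carrier G. \<bar>avg xs (\<lambda>x. f (z \<otimes> x)) - m\<bar> \<le> e"
      using xs(1) unfolding F_def by blast
  qed
  then show ?thesis by blast
qed

section \<open>The mean as an invariant, strictly positive functional\<close>

definition mean :: "('a \<Rightarrow> real) \<Rightarrow> real" where
  "mean f = (THE c. is_mean f c)"

abbreviation "cont \<equiv> continuous_map T euclideanreal"

lemma mean_eq: "is_mean f c \<Longrightarrow> mean f = c"
  unfolding mean_def by (rule the_equality) (auto intro: is_mean_unique)

lemma is_mean_mean: "cont f \<Longrightarrow> is_mean f (mean f)"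
  using continuous_has_mean mean_eq by blast

lemma mean_const [simp]: "mean (\<lambda>_. c) = c"
  by (rule mean_eq) (rule is_mean_const)

lemma mean_add: "cont f \<Longrightarrow> cont g \<Longrightarrow> mean (\<lambda>x. f x + g x) = mean f + mean g"
  by (intro mean_eq is_mean_add is_mean_mean)

lemma mean_cmult: "cont f \<Longrightarrow> mean (\<lambda>x. c * f x) = c * mean f"
  by (intro mean_eq is_mean_cmult is_mean_mean)

lemma mean_translate: "cont f \<Longrightarrow> a \<in> carrier G \<Longrightarrow> mean (\<lambda>x. f (x \<otimes> a)) = mean f"
  by (intro mean_eq is_mean_translate is_mean_mean)

lemma mean_mono: "cont f \<Longrightarrow> cont g \<Longrightarrow> (\<And>x. x \<in> carrier G \<Longrightarrow> f x \<le> g x) \<Longrightarrow> mean f \<le> mean g"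
  by (rule is_mean_mono[OF is_mean_mean is_mean_mean])

lemma mean_cong: "cont f \<Longrightarrow> cont g \<Longrightarrow> (\<And>x. x \<in> carrier G \<Longrightarrow> f x = g x) \<Longrightarrow> mean f = mean g"
  by (intro antisym mean_mono) auto

lemma mean_sum:
  "finite I \<Longrightarrow> (\<And>i. i \<in> I \<Longrightarrow> cont (f i)) \<Longrightarrow> mean (\<lambda>x. \<Sum>i\<in>I. f i x) = (\<Sum>i\<in>I. mean (f i))"
proof (induction I rule: finite_induct)
  case empty
  then show ?case using mean_const[of 0] by simp
next
  case (insert i I)
  then show ?case by (simp add: mean_add continuous_map_sum)
qed

lemma mean_sum_list:
  "(\<And>i. i \<in> set is \<Longrightarrow> cont (f i)) \<Longrightarrow> mean (\<lambda>x. \<Sum>i\<leftarrow>is. f i x) = (\<Sum>i\<leftarrow>is. mean (f i))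
    \<and> cont (\<lambda>x. \<Sum>i\<leftarrow>is. f i x)"
proof (induction "is")
  case Nil
  then show ?case using mean_const[of 0] by simp
next
  case (Cons i "is")
  then show ?case by (simp add: mean_add continuous_map_add)
qed

text \<open>Finitely many translates of the set where \<open>f\<close> exceeds half of
  \<open>f x0\<close> cover the group. Hence a finite sum of translates of \<open>f\<close>, whose
  mean is a multiple of \<open>mean f\<close>, is at least half of \<open>f x0\<close>
  everywhere.\<close>

lemma mean_pos:
  assumes f: "cont f" and "\<And>x. x \<in> carrier G \<Longrightarrow> 0 \<le> f x" and "x0 \<in> carrier G" "f x0 > 0"
  shows "mean f > 0"
proof -
  let ?V = "{x \<in> topspace T. f x \<in> {f x0 / 2<..}}"
  have "openin T ?V" by (rule openin_continuous_map_preimage[OF f]) simp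
  moreover have "x0 \<in> ?V" using assms by (simp add: topspace_eq_carrier)
  ultimately obtain cs where cs: "cs \<in> finlists" "\<And>x. x \<in> carrier G \<Longrightarrow> \<exists>c\<in>set cs. x \<otimes> c \<in> ?V"
    by (rule finite_translates) blast
  let ?g = "\<lambda>x. \<Sum>c\<leftarrow>cs. f (x \<otimes> c)"
  have cf: "cont (\<lambda>x. f (x \<otimes> c))" if "c \<in> set cs" for c
    using cont_translate[OF f] that cs(1) by auto
  have cg: "cont ?g" and "mean ?g = (\<Sum>c\<leftarrow>cs. mean (\<lambda>x. f (x \<otimes> c)))"
    using mean_sum_list[of cs "\<lambda>c x. f (x \<otimes> c)", OF cf] by auto
  note this(2)
  also have "(\<Sum>c\<leftarrow>cs. mean (\<lambda>x. f (x \<otimes> c))) = (\<Sum>c\<leftarrow>cs. mean f)"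
    using cs(1) mean_translate[OF f] by (intro arg_cong[where f = sum_list] map_cong) auto
  finally have 1: "mean ?g = real (length cs) * mean f" by (simp add: sum_list_triv)
  have "f x0 / 2 \<le> ?g x" if x: "x \<in> carrier G" for x
  proof -
    obtain c where c: "c \<in> set cs" "f (x \<otimes> c) > f x0 / 2" using cs(2)[OF x] by auto
    have "f (x \<otimes> c) \<le> ?g x"
      using c(1) cs(1) x assms(2) by (intro member_le_sum_list) auto
    then show ?thesis using c by linarith
  qed
  then have "mean (\<lambda>_. f x0 / 2) \<le> mean ?g" by (intro mean_mono cg) auto
  with 1 assms(4) have "0 < real (length cs) * mean f" by simp
  then show ?thesis by (simp add: zero_less_mult_iff)
qed

end

section \<open>Positive definite functions\<close>

lemma cnj_sum_list: "cnj (\<Sum>x\<leftarrow>xs. f x) = (\<Sum>x\<leftarrow>xs. cnj (f x))"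
  by (induction xs) auto

lemma Re_sum_list: "Re (\<Sum>x\<leftarrow>xs. f x) = (\<Sum>x\<leftarrow>xs. Re (f x))"
  by (induction xs) auto

context compact_abelian_group
begin

definition quad_form :: "('a \<Rightarrow> complex) \<Rightarrow> (complex \<times> 'a) list \<Rightarrow> complex" where
  "quad_form \<psi> l = (\<Sum>p\<leftarrow>l. \<Sum>q\<leftarrow>l. fst p * cnj (fst q) * \<psi> (snd p \<otimes> inv (snd q)))"

text \<open>Hermitian symmetry is a separate clause since only the real part of the form is
  tested.\<close>

definition positive_definite :: "('a \<Rightarrow> complex) \<Rightarrow> bool" where
  "positive_definite \<psi> \<longleftrightarrow> (\<forall>x\<in>carrier G. \<psi> (inv x) = cnj (\<psi> x)) \<and>
     (\<forall>l. snd ` set l \<subseteq> carrier G \<longrightarrow> 0 \<le> Re (quad_form \<psi> l))"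

lemma pd_inv: "positive_definite \<psi> \<Longrightarrow> x \<in> carrier G \<Longrightarrow> \<psi> (inv x) = cnj (\<psi> x)"
  by (simp add: positive_definite_def)

lemma pd_quad_form: "positive_definite \<psi> \<Longrightarrow> snd ` set l \<subseteq> carrier G \<Longrightarrow> 0 \<le> Re (quad_form \<psi> l)"
  by (simp add: positive_definite_def)

text \<open>Test the form on the unit and \<open>x\<close>, with a coefficient that rotates
  \<open>\<psi> x\<close> to minus its modulus.\<close>

lemma pd_norm_le:
  assumes \<psi>: "positive_definite \<psi>" and x: "x \<in> carrier G"
  shows "cmod (\<psi> x) \<le> Re (\<psi> \<one>)"
proof -
  have *: "0 \<le> Re (\<psi> \<one>) + Re (c * \<psi> x)" if c: "c * cnj c = 1" for c
  proof -
    have "0 \<le> Re (quad_form \<psi> [(1, \<one>), (c, x)])"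
      using x by (intro pd_quad_form[OF \<psi>]) auto
    also have "quad_form \<psi> [(1, \<one>), (c, x)] = \<psi> \<one> + cnj (c * \<psi> x) + (c * \<psi> x + (c * cnj c) * \<psi> \<one>)"
      using x by (simp add: quad_form_def pd_inv[OF \<psi>])
    finally show ?thesis using c by simp
  qed
  show ?thesis
  proof (cases "\<psi> x = 0")
    case True
    then show ?thesis using *[of 1] by simp
  next
    case False
    let ?c = "- cnj (\<psi> x) / cmod (\<psi> x)"
    have n: "\<psi> x * cnj (\<psi> x) = of_real (cmod (\<psi> x)) ^ 2" using complex_norm_square[of "\<psi> x"] by simp
    have "?c * cnj ?c = 1" using False n by (simp add: power2_eq_square mult.commute)
    moreover have "?c * \<psi> x = - of_real (cmod (\<psi> x))"
      using False n by (simp add: power2_eq_square mult.commute)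
    ultimately show ?thesis using *[of ?c] by simp
  qed
qed

text \<open>The form of the twisted function on \<open>l\<close> is the form of
  \<open>\<psi>\<close> on \<open>l\<close> joined with its translate by \<open>g\<close>, weighted
  by \<open>c\<close>.\<close>

lemma pd_twist:
  assumes \<psi>: "positive_definite \<psi>" and g: "g \<in> carrier G" and c: "c * cnj c = 1"
  shows "positive_definite (\<lambda>x. 2 * \<psi> x + c * \<psi> (g \<otimes> x) + cnj c * \<psi> (inv g \<otimes> x))"
  unfolding positive_definite_def
proof (intro conjI ballI allI impI)
  fix x assume x: "x \<in> carrier G"
  have "\<psi> (g \<otimes> inv x) = cnj (\<psi> (inv g \<otimes> x))"
    using pd_inv[OF \<psi>, of "inv g \<otimes> x"] x g by (simp add: inv_mult)
  moreover have "\<psi> (inv g \<otimes> inv x) = cnj (\<psi> (g \<otimes> x))"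
    using pd_inv[OF \<psi>, of "g \<otimes> x"] x g by (simp add: inv_mult)
  ultimately show "2 * \<psi> (inv x) + c * \<psi> (g \<otimes> inv x) + cnj c * \<psi> (inv g \<otimes> inv x) =
      cnj (2 * \<psi> x + c * \<psi> (g \<otimes> x) + cnj c * \<psi> (inv g \<otimes> x))"
    using pd_inv[OF \<psi> x] by simp
next
  fix l :: "(complex \<times> 'a) list" assume l: "snd ` set l \<subseteq> carrier G"
  let ?w = "\<lambda>x. 2 * \<psi> x + c * \<psi> (g \<otimes> x) + cnj c * \<psi> (inv g \<otimes> x)"
  let ?l = "l @ map (\<lambda>p. (c * fst p, g \<otimes> snd p)) l"
  let ?t = "\<lambda>p q. fst p * cnj (fst q) * \<psi> (snd p \<otimes> inv (snd q))
      + fst p * cnj (c * fst q) * \<psi> (snd p \<otimes> inv (g \<otimes> snd q))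
      + (c * fst p * cnj (fst q) * \<psi> ((g \<otimes> snd p) \<otimes> inv (snd q))
      + c * fst p * cnj (c * fst q) * \<psi> ((g \<otimes> snd p) \<otimes> inv (g \<otimes> snd q)))"
  have "snd ` set ?l \<subseteq> carrier G" using l g by auto
  then have "0 \<le> Re (quad_form \<psi> ?l)" by (rule pd_quad_form[OF \<psi>])
  also have "quad_form \<psi> ?l = (\<Sum>p\<leftarrow>l. \<Sum>q\<leftarrow>l. ?t p q)"
    by (simp add: quad_form_def sum_list_addf o_def)
  also have "(\<Sum>p\<leftarrow>l. \<Sum>q\<leftarrow>l. ?t p q) =
      (\<Sum>p\<leftarrow>l. \<Sum>q\<leftarrow>l. fst p * cnj (fst q) * ?w (snd p \<otimes> inv (snd q)))"
  proof (intro arg_cong[where f = sum_list] map_cong refl)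
    fix p q assume "p \<in> set l" "q \<in> set l"
    then have p: "snd p \<in> carrier G" "snd q \<in> carrier G" using l by auto
    have 1: "snd p \<otimes> inv (g \<otimes> snd q) = inv g \<otimes> (snd p \<otimes> inv (snd q))"
      using p g by (simp add: inv_mult m_ac)
    have 2: "g \<otimes> snd p \<otimes> inv (snd q) = g \<otimes> (snd p \<otimes> inv (snd q))"
      using p g by (simp add: m_assoc)
    have "g \<otimes> snd p \<otimes> inv (g \<otimes> snd q) = (g \<otimes> inv g) \<otimes> (snd p \<otimes> inv (snd q))"
      using p g by (simp only: inv_mult m_ac inv_closed m_closed)
    then have 3: "g \<otimes> snd p \<otimes> inv (g \<otimes> snd q) = snd p \<otimes> inv (snd q)"
      using p g by simp
    have "c * fst p * cnj (c * fst q) = (c * cnj c) * (fst p * cnj (fst q))" by simp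
    then have 4: "c * fst p * cnj (c * fst q) = fst p * cnj (fst q)" using c by simp
    show "?t p q = fst p * cnj (fst q) * ?w (snd p \<otimes> inv (snd q))"
      unfolding 1 2 3 4 by (simp add: algebra_simps)
  qed
  finally show "0 \<le> Re (quad_form ?w l)" by (simp add: quad_form_def)
qed

lemma pd_scale:
  assumes "positive_definite \<psi>" "0 \<le> r"
  shows "positive_definite (\<lambda>x. of_real r * \<psi> x)"
proof -
  have "quad_form (\<lambda>x. of_real r * \<psi> x) l = of_real r * quad_form \<psi> l" for l
    by (simp add: quad_form_def sum_list_const_mult[symmetric] mult_ac)
  then show ?thesis using assms by (auto simp: positive_definite_def)
qed

section \<open>Autocorrelations of continuous functions\<close>

definition corr :: "('a \<Rightarrow> real) \<Rightarrow> 'a \<Rightarrow> real" where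
  "corr F x = mean (\<lambda>y. F (y \<otimes> x) * F y)"

text \<open>Translating the integration variable by \<open>y\<close> exhibits \<open>corr F\<close>
  as the kernel of inner products of translates of \<open>F\<close>.\<close>

lemma corr_mult_inv:
  assumes F: "cont F" and "x \<in> carrier G" "y \<in> carrier G"
  shows "corr F (x \<otimes> inv y) = mean (\<lambda>z. F (z \<otimes> x) * F (z \<otimes> y))"
proof -
  have c: "cont (\<lambda>z. F (z \<otimes> a) * F (z \<otimes> b))" if "a \<in> carrier G" "b \<in> carrier G" for a b
    using that by (intro continuous_map_real_mult cont_translate[OF F] F)
  have c': "cont (\<lambda>z. F (z \<otimes> (x \<otimes> inv y)) * F z)"
    using assms by (intro continuous_map_real_mult cont_translate[OF F] F) auto
  have "mean (\<lambda>z. F (z \<otimes> y \<otimes> (x \<otimes> inv y)) * F (z \<otimes> y)) = corr F (x \<otimes> inv y)"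
    unfolding corr_def using mean_translate[OF c' assms(3)] by simp
  moreover have "mean (\<lambda>z. F (z \<otimes> y \<otimes> (x \<otimes> inv y)) * F (z \<otimes> y)) = mean (\<lambda>z. F (z \<otimes> x) * F (z \<otimes> y))"
  proof (rule mean_cong)
    show "cont (\<lambda>z. F (z \<otimes> y \<otimes> (x \<otimes> inv y)) * F (z \<otimes> y))"
      by (rule cont_translate[OF c' assms(3)])
    fix z assume z: "z \<in> carrier G"
    have "z \<otimes> y \<otimes> (x \<otimes> inv y) = (y \<otimes> inv y) \<otimes> (z \<otimes> x)"
      using z assms by (simp only: m_ac inv_closed m_closed)
    then show "F (z \<otimes> y \<otimes> (x \<otimes> inv y)) * F (z \<otimes> y) = F (z \<otimes> x) * F (z \<otimes> y)"
      using z assms by simp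
  qed (use c assms in auto)
  ultimately show ?thesis by simp
qed

lemma corr_one:
  assumes F: "cont F" shows "corr F \<one> = mean (\<lambda>z. F z * F z)"
  unfolding corr_def using F
  by (intro mean_cong continuous_map_real_mult cont_translate[OF F]) auto

lemma corr_inv:
  assumes F: "cont F" and "x \<in> carrier G"
  shows "corr F (inv x) = corr F x"
proof -
  have "corr F (inv x) = corr F (\<one> \<otimes> inv x)" using assms by simp
  also have "\<dots> = mean (\<lambda>z. F (z \<otimes> \<one>) * F (z \<otimes> x))" by (rule corr_mult_inv) (use assms in auto)
  also have "\<dots> = corr F x" unfolding corr_def
    using assms by (intro mean_cong continuous_map_real_mult cont_translate[OF F]) auto
  finally show ?thesis .
qed

lemma corr_near_one:
  assumes F: "cont F" and "\<epsilon> > 0"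
  obtains V where "openin T V" "\<one> \<in> V" "\<And>v. v \<in> V \<Longrightarrow> \<bar>corr F v - corr F \<one>\<bar> \<le> \<epsilon>"
proof -
  obtain B where B: "B > 0" "\<And>x. x \<in> carrier G \<Longrightarrow> \<bar>F x\<bar> \<le> B"
    using continuous_bounded[OF F] by blast
  then have "\<epsilon> / B > 0" using assms by simp
  then obtain V where V: "openin T V" "\<one> \<in> V" "\<And>x v. x \<in> carrier G \<Longrightarrow> v \<in> V \<Longrightarrow> \<bar>F (x \<otimes> v) - F x\<bar> < \<epsilon> / B"
    using uniform_continuity[OF F] by blast
  have "\<bar>corr F v - corr F \<one>\<bar> \<le> \<epsilon>" if v: "v \<in> V" for v
  proof -
    have vG: "v \<in> carrier G" using V(1) v openin_subset topspace_eq_carrier by auto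
    have *: "\<bar>F (y \<otimes> v) * F y - F y * F y\<bar> \<le> \<epsilon>" if y: "y \<in> carrier G" for y
    proof -
      have "\<bar>F (y \<otimes> v) * F y - F y * F y\<bar> = \<bar>F (y \<otimes> v) - F y\<bar> * \<bar>F y\<bar>"
        by (simp add: abs_mult[symmetric] left_diff_distrib)
      also have "\<dots> \<le> \<epsilon> / B * B" using V(3)[OF y v] B(2)[OF y] B(1) \<open>\<epsilon> / B > 0\<close> by (intro mult_mono) auto
      finally show ?thesis using B(1) by simp
    qed
    have c1: "cont (\<lambda>y. F (y \<otimes> v) * F y)" and c2: "cont (\<lambda>y. F y * F y)"
      using vG by (auto intro!: continuous_map_real_mult cont_translate[OF F] F)
    have "mean (\<lambda>y. F (y \<otimes> v) * F y) \<le> mean (\<lambda>y. F y * F y + \<epsilon>)"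
      using * by (intro mean_mono c1 continuous_map_add c2) (auto simp: abs_le_iff diff_le_eq add.commute)
    moreover have "mean (\<lambda>y. F y * F y) \<le> mean (\<lambda>y. F (y \<otimes> v) * F y + \<epsilon>)"
      using * by (intro mean_mono c2 continuous_map_add c1) (auto simp: abs_le_iff algebra_simps)
    moreover have "mean (\<lambda>y. F y * F y + \<epsilon>) = mean (\<lambda>y. F y * F y) + \<epsilon>"
      using mean_add[OF c2, of "\<lambda>_. \<epsilon>"] by simp
    moreover have "mean (\<lambda>y. F (y \<otimes> v) * F y + \<epsilon>) = mean (\<lambda>y. F (y \<otimes> v) * F y) + \<epsilon>"
      using mean_add[OF c1, of "\<lambda>_. \<epsilon>"] by simp
    ultimately show ?thesis unfolding corr_one[OF F] corr_def[of F v] by linarith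
  qed
  with V show thesis by (intro that[of V]) auto
qed

text \<open>A Schur product argument: the form of the product is the mean over \<open>z\<close> of
  forms of \<open>\<psi>\<close> whose coefficients are multiplied by the values of \<open>F\<close>
  at \<open>z \<otimes> snd p\<close>.\<close>

lemma pd_corr_mult:
  assumes F: "cont F" and \<psi>: "positive_definite \<psi>"
  shows "positive_definite (\<lambda>x. of_real (corr F x) * \<psi> x)"
  unfolding positive_definite_def
proof (intro conjI ballI allI impI)
  fix x assume "x \<in> carrier G"
  then show "of_real (corr F (inv x)) * \<psi> (inv x) = cnj (of_real (corr F x) * \<psi> x)"
    using F by (simp add: corr_inv pd_inv[OF \<psi>])
next
  fix l :: "(complex \<times> 'a) list" assume l: "snd ` set l \<subseteq> carrier G"
  let ?r = "\<lambda>p q. Re (fst p * cnj (fst q) * \<psi> (snd p \<otimes> inv (snd q)))"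
  let ?m = "\<lambda>p q z. ?r p q * (F (z \<otimes> snd p) * F (z \<otimes> snd q))"
  have c: "cont (?m p q)" if "p \<in> set l" "q \<in> set l" for p q
    using that l F by (intro continuous_map_real_mult cont_translate[OF F]) auto
  have c1: "cont (\<lambda>z. \<Sum>q\<leftarrow>l. ?m p q z)" if "p \<in> set l" for p
    by (rule conjunct2[OF mean_sum_list[of l "?m p", OF c[OF that]]])
  have m1: "mean (\<lambda>z. \<Sum>q\<leftarrow>l. ?m p q z) = (\<Sum>q\<leftarrow>l. mean (?m p q))" if "p \<in> set l" for p
    by (rule conjunct1[OF mean_sum_list[of l "?m p", OF c[OF that]]])
  note * = mean_sum_list[of l "\<lambda>p z. \<Sum>q\<leftarrow>l. ?m p q z", OF c1]
  have c2: "cont (\<lambda>z. \<Sum>p\<leftarrow>l. \<Sum>q\<leftarrow>l. ?m p q z)"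
    by (rule conjunct2[OF *])
  have m2: "mean (\<lambda>z. \<Sum>p\<leftarrow>l. \<Sum>q\<leftarrow>l. ?m p q z) = (\<Sum>p\<leftarrow>l. mean (\<lambda>z. \<Sum>q\<leftarrow>l. ?m p q z))"
    by (rule conjunct1[OF *])
  have "Re (quad_form (\<lambda>x. of_real (corr F x) * \<psi> x) l) = (\<Sum>p\<leftarrow>l. \<Sum>q\<leftarrow>l. mean (?m p q))"
    unfolding quad_form_def Re_sum_list
  proof (intro arg_cong[where f = sum_list] map_cong refl)
    fix p q assume pq: "p \<in> set l" "q \<in> set l"
    then have p: "snd p \<in> carrier G" "snd q \<in> carrier G" using l by auto
    have "Re (fst p * cnj (fst q) * (of_real (corr F (snd p \<otimes> inv (snd q))) * \<psi> (snd p \<otimes> inv (snd q)))) =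
        ?r p q * corr F (snd p \<otimes> inv (snd q))" by (simp add: algebra_simps)
    also have "\<dots> = mean (?m p q)"
      unfolding corr_mult_inv[OF F p]
      by (rule mean_cmult[symmetric]) (use p F in \<open>intro continuous_map_real_mult cont_translate[OF F]; simp\<close>)
    finally show "Re (fst p * cnj (fst q) * (of_real (corr F (snd p \<otimes> inv (snd q))) * \<psi> (snd p \<otimes> inv (snd q)))) =
        mean (?m p q)" .
  qed
  also have "\<dots> = (\<Sum>p\<leftarrow>l. mean (\<lambda>z. \<Sum>q\<leftarrow>l. ?m p q z))"
    by (intro arg_cong[where f = sum_list] map_cong refl m1[symmetric])
  also have "\<dots> = mean (\<lambda>z. \<Sum>p\<leftarrow>l. \<Sum>q\<leftarrow>l. ?m p q z)" by (rule m2[symmetric])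
  finally have eq: "Re (quad_form (\<lambda>x. of_real (corr F x) * \<psi> x) l) =
      mean (\<lambda>z. \<Sum>p\<leftarrow>l. \<Sum>q\<leftarrow>l. ?m p q z)" .
  have "mean (\<lambda>_. 0) \<le> mean (\<lambda>z. \<Sum>p\<leftarrow>l. \<Sum>q\<leftarrow>l. ?m p q z)"
  proof (intro mean_mono c2)
    fix z assume z: "z \<in> carrier G"
    let ?l = "map (\<lambda>p. (of_real (F (z \<otimes> snd p)) * fst p, snd p)) l"
    have "0 \<le> Re (quad_form \<psi> ?l)" using l by (intro pd_quad_form[OF \<psi>]) auto
    also have "Re (quad_form \<psi> ?l) = (\<Sum>p\<leftarrow>l. \<Sum>q\<leftarrow>l. ?m p q z)"
      by (simp add: quad_form_def Re_sum_list o_def algebra_simps)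
    finally show "0 \<le> (\<Sum>p\<leftarrow>l. \<Sum>q\<leftarrow>l. ?m p q z)" .
  qed simp
  then show "0 \<le> Re (quad_form (\<lambda>x. of_real (corr F x) * \<psi> x) l)" by (simp add: eq)
qed

lemma pd_one: "positive_definite (\<lambda>_. 1)"
  unfolding positive_definite_def
proof (intro conjI ballI allI impI)
  fix l :: "(complex \<times> 'a) list"
  have "quad_form (\<lambda>_. 1) l = (\<Sum>p\<leftarrow>l. fst p) * cnj (\<Sum>p\<leftarrow>l. fst p)"
    by (simp add: quad_form_def sum_list_const_mult sum_list_mult_const cnj_sum_list o_def)
  then show "0 \<le> Re (quad_form (\<lambda>_. 1) l)" by simp
qed simp

text \<open>The quadratic form of \<open>w\<close> at uniform weights on \<open>xs\<close>. Its
  infimum over lists serves as a mean for a \<open>w\<close> that may be discontinuous.\<close>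

definition pd_avg :: "'a list \<Rightarrow> ('a \<Rightarrow> complex) \<Rightarrow> real" where
  "pd_avg xs w = avg xs (\<lambda>x. avg xs (\<lambda>y. Re (w (x \<otimes> inv y))))"

text \<open>The twist with \<open>c = -1\<close> says that \<open>w\<close> dominates its
  symmetrized shift by \<open>g\<close> as a quadratic form.\<close>

lemma pd_avg_shift:
  assumes w: "positive_definite w" and xs: "xs \<in> finlists" and g: "g \<in> carrier G"
  defines "A \<equiv> \<lambda>g. avg xs (\<lambda>x. avg xs (\<lambda>y. Re (w (g \<otimes> (x \<otimes> inv y)))))"
  shows "A g + A (inv g) \<le> 2 * pd_avg xs w"
proof -
  let ?w = "\<lambda>x. 2 * w x + (-1) * w (g \<otimes> x) + cnj (-1) * w (inv g \<otimes> x)"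
  let ?l = "map (Pair 1) xs"
  have "positive_definite ?w" by (rule pd_twist) (use w g in auto)
  then have "0 \<le> Re (quad_form ?w ?l)" using xs by (intro pd_quad_form) auto
  also have "Re (quad_form ?w ?l) = (\<Sum>x\<leftarrow>xs. \<Sum>y\<leftarrow>xs. 2 * Re (w (x \<otimes> inv y)) -
      Re (w (g \<otimes> (x \<otimes> inv y))) - Re (w (inv g \<otimes> (x \<otimes> inv y))))"
    by (simp add: quad_form_def Re_sum_list o_def)
  finally have "0 \<le> avg xs (\<lambda>x. avg xs (\<lambda>y. 2 * Re (w (x \<otimes> inv y)) -
      Re (w (g \<otimes> (x \<otimes> inv y))) - Re (w (inv g \<otimes> (x \<otimes> inv y)))))"
    unfolding avg_avg by simp
  then show ?thesis by (simp add: A_def pd_avg_def avg_diff avg_cmult)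
qed

text \<open>Over the product list the average becomes an average of shifted averages at
  \<open>y \<otimes> inv y'\<close>. Pairing each shift with its inverse, by exchanging
  \<open>y\<close> and \<open>y'\<close>, brings in \<open>pd_avg_shift\<close>.\<close>

lemma pd_avg_list_mult_le:
  assumes w: "positive_definite w" and xs: "xs \<in> finlists" and ys: "ys \<in> finlists"
  shows "pd_avg (list_mult xs ys) w \<le> pd_avg xs w"
proof -
  define A where "A = (\<lambda>g. avg xs (\<lambda>x. avg xs (\<lambda>x'. Re (w (g \<otimes> (x \<otimes> inv x'))))))"
  have "pd_avg (list_mult xs ys) w =
      avg xs (\<lambda>x. avg ys (\<lambda>y. avg xs (\<lambda>x'. avg ys (\<lambda>y'. Re (w ((x \<otimes> y) \<otimes> inv (x' \<otimes> y')))))))"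
    by (simp add: pd_avg_def avg_list_mult)
  also have "\<dots> = avg xs (\<lambda>x. avg ys (\<lambda>y. avg xs (\<lambda>x'. avg ys (\<lambda>y'. Re (w ((y \<otimes> inv y') \<otimes> (x \<otimes> inv x')))))))"
  proof (intro avg_cong)
    fix x y x' y' assume "x \<in> set xs" "x' \<in> set xs" "y \<in> set ys" "y' \<in> set ys"
    then have "x \<in> carrier G" "x' \<in> carrier G" "y \<in> carrier G" "y' \<in> carrier G"
      using xs ys by auto
    then have "(x \<otimes> y) \<otimes> inv (x' \<otimes> y') = (y \<otimes> inv y') \<otimes> (x \<otimes> inv x')"
      by (simp only: inv_mult m_ac inv_closed m_closed)
    then show "Re (w ((x \<otimes> y) \<otimes> inv (x' \<otimes> y'))) = Re (w ((y \<otimes> inv y') \<otimes> (x \<otimes> inv x')))" by simp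
  qed
  also have "\<dots> = avg ys (\<lambda>y. avg xs (\<lambda>x. avg xs (\<lambda>x'. avg ys (\<lambda>y'. Re (w ((y \<otimes> inv y') \<otimes> (x \<otimes> inv x')))))))"
    by (rule avg_swap)
  also have "\<dots> = avg ys (\<lambda>y. avg xs (\<lambda>x. avg ys (\<lambda>y'. avg xs (\<lambda>x'. Re (w ((y \<otimes> inv y') \<otimes> (x \<otimes> inv x')))))))"
    by (intro avg_cong avg_swap)
  also have "\<dots> = avg ys (\<lambda>y. avg ys (\<lambda>y'. A (y \<otimes> inv y')))"
    unfolding A_def by (intro avg_cong avg_swap)
  finally have 1: "pd_avg (list_mult xs ys) w = avg ys (\<lambda>y. avg ys (\<lambda>y'. A (y \<otimes> inv y')))" .
  have "2 * pd_avg (list_mult xs ys) w =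
      avg ys (\<lambda>y. avg ys (\<lambda>y'. A (y \<otimes> inv y'))) + avg ys (\<lambda>y. avg ys (\<lambda>y'. A (y' \<otimes> inv y)))"
    using 1 avg_swap[of ys ys "\<lambda>y y'. A (y \<otimes> inv y')"] by simp
  also have "\<dots> = avg ys (\<lambda>y. avg ys (\<lambda>y'. A (y \<otimes> inv y') + A (y' \<otimes> inv y)))"
    by (simp add: avg_add)
  also have "\<dots> \<le> avg ys (\<lambda>y. avg ys (\<lambda>y'. 2 * pd_avg xs w))"
  proof (intro avg_mono)
    fix y y' assume "y \<in> set ys" "y' \<in> set ys"
    then have y: "y \<in> carrier G" "y' \<in> carrier G" using ys by auto
    then have "y' \<otimes> inv y = inv (y \<otimes> inv y')" by (simp add: inv_mult m_comm)
    then show "A (y \<otimes> inv y') + A (y' \<otimes> inv y) \<le> 2 * pd_avg xs w"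
      using pd_avg_shift[OF w xs, of "y \<otimes> inv y'"] y by (simp add: A_def)
  qed
  also have "\<dots> = 2 * pd_avg xs w" using ys by simp
  finally show ?thesis by simp
qed

lemma pd_avg_list_mult_commute:
  assumes xs: "xs \<in> finlists" and ys: "ys \<in> finlists"
  shows "pd_avg (list_mult xs ys) w = pd_avg (list_mult ys xs) w"
proof -
  have *: "avg (list_mult xs ys) h = avg (list_mult ys xs) h" for h
    unfolding avg_list_mult
    by (subst avg_swap, intro avg_cong) (use xs ys in \<open>auto intro!: avg_cong simp: m_comm subset_iff\<close>)
  show ?thesis unfolding pd_avg_def * ..
qed

end

section \<open>Extreme states are multiplicative\<close>

text \<open>In particular \<open>face_in {\<psi>} P\<close> says that \<open>\<psi>\<close> is an
  extreme point of \<open>P\<close>.\<close>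

definition face_in :: "('b \<Rightarrow> complex) set \<Rightarrow> ('b \<Rightarrow> complex) set \<Rightarrow> bool" where
  "face_in F P \<longleftrightarrow> F \<subseteq> P \<and> (\<forall>\<psi>1\<in>P. \<forall>\<psi>2\<in>P. \<forall>t. 0 < t \<longrightarrow> t < 1 \<longrightarrow>
     (\<lambda>x. of_real t * \<psi>1 x + of_real (1 - t) * \<psi>2 x) \<in> F \<longrightarrow> \<psi>1 \<in> F \<and> \<psi>2 \<in> F)"

lemma cmod_eq_one: "z * cnj z = 1 \<Longrightarrow> cmod z = 1"
  by (metis abs_norm_cancel complex_mod_cnj norm_mult norm_one real_sqrt_abs2 real_sqrt_one)

lemma continuous_on_coordinate:
  "continuous_on A (\<lambda>\<psi>::'b \<Rightarrow> 'c::topological_space. \<psi> x)"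
  by (rule continuous_on_subset[OF continuous_on_product_coordinates]) simp

text \<open>An affine functional bounded by \<open>m\<close> reaches \<open>m\<close> inside a
  segment only if it does so at both ends.\<close>

lemma face_in_maximizers:
  fixes L :: "('b \<Rightarrow> complex) \<Rightarrow> real"
  assumes F: "face_in F P"
    and lin: "\<And>\<psi>1 \<psi>2 t. L (\<lambda>x. of_real t * \<psi>1 x + of_real (1 - t) * \<psi>2 x) = t * L \<psi>1 + (1 - t) * L \<psi>2"
    and max: "\<And>\<psi>. \<psi> \<in> F \<Longrightarrow> L \<psi> \<le> m"
  shows "face_in {\<psi> \<in> F. m \<le> L \<psi>} P"
  unfolding face_in_def
proof (intro conjI ballI allI impI)
  fix \<psi>1 \<psi>2 :: "'b \<Rightarrow> complex" and t :: real
  assume P: "\<psi>1 \<in> P" "\<psi>2 \<in> P" and t: "0 < t" "t < 1"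
    and c: "(\<lambda>x. of_real t * \<psi>1 x + of_real (1 - t) * \<psi>2 x) \<in> {\<psi> \<in> F. m \<le> L \<psi>}"
  then have "(\<lambda>x. of_real t * \<psi>1 x + of_real (1 - t) * \<psi>2 x) \<in> F" by blast
  then have 1: "\<psi>1 \<in> F" "\<psi>2 \<in> F" using F P t unfolding face_in_def by blast+
  have "m \<le> t * L \<psi>1 + (1 - t) * L \<psi>2" using c lin by auto
  then have 2: "t * (m - L \<psi>1) + (1 - t) * (m - L \<psi>2) \<le> 0" by (simp add: algebra_simps)
  have 3: "0 \<le> t * (m - L \<psi>1)" "0 \<le> (1 - t) * (m - L \<psi>2)"
    using t max[OF 1(1)] max[OF 1(2)] by simp_all
  have "t * (m - L \<psi>1) \<le> 0" "(1 - t) * (m - L \<psi>2) \<le> 0" using 2 3 by linarith+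
  then show "\<psi>1 \<in> {\<psi> \<in> F. m \<le> L \<psi>}" "\<psi>2 \<in> {\<psi> \<in> F. m \<le> L \<psi>}"
    using t 1 by (auto simp: mult_le_0_iff)
qed (use F in \<open>auto simp: face_in_def\<close>)

text \<open>The Krein-Milman argument. Zorn's lemma, applied to complements because it yields
  maximal sets, gives a minimal closed face. Maximizing the real or imaginary part of a coordinate
  would cut out a smaller face unless it is constant there, so the minimal face is a point.\<close>

lemma exists_extreme_point:
  fixes K P :: "('b \<Rightarrow> complex) set"
  assumes K: "compact K" "closed K" "K \<noteq> {}" "face_in K P"
  obtains \<psi> where "\<psi> \<in> K" "face_in {\<psi>} P"
proof -
  define ok where "ok = (\<lambda>F. closed F \<and> F \<subseteq> K \<and> F \<noteq> {} \<and> face_in F P)"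
  have "\<exists>M\<in>{U. ok (- U)}. \<forall>X\<in>{U. ok (- U)}. M \<subseteq> X \<longrightarrow> X = M"
  proof (rule subset_Zorn_nonempty)
    have "ok (- (- K))" using K by (simp add: ok_def)
    then show "{U. ok (- U)} \<noteq> {}" by blast
    fix \<C> assume ne: "\<C> \<noteq> {}" and ch: "subset.chain {U. ok (- U)} \<C>"
    then have ok: "ok (- U)" if "U \<in> \<C>" for U using that unfolding subset.chain_def by auto
    have "K \<inter> \<Inter> (uminus ` \<C>) \<noteq> {}"
    proof (rule compact_imp_fip[OF K(1)])
      fix \<F> assume "finite \<F>" "\<F> \<subseteq> uminus ` \<C>"
      then obtain \<D> where D: "\<D> \<subseteq> \<C>" "finite \<D>" "\<F> = uminus ` \<D>"
        by (meson finite_subset_image)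
      show "K \<inter> \<Inter> \<F> \<noteq> {}"
      proof (cases "\<D> = {}")
        case False
        have "subset.chain {U. ok (- U)} \<D>" using ch D(1) unfolding subset.chain_def by blast
        then have "\<Union> \<D> \<in> \<D>" using Union_in_chain D(2) False by blast
        then have "ok (- \<Union> \<D>)" using ok D(1) by blast
        then show ?thesis unfolding ok_def D(3) by (auto simp: uminus_Sup)
      qed (use K D in simp)
    qed (use ok in \<open>auto simp: ok_def\<close>)
    moreover have "face_in (- \<Union> \<C>) P"
    proof -
      obtain U where "U \<in> \<C>" using ne by blast
      then have "- \<Union> \<C> \<subseteq> P" using ok[of U] unfolding ok_def face_in_def by blast
      moreover have "face_in (- U) P" if "U \<in> \<C>" for U using ok[OF that] by (simp add: ok_def)
      ultimately show ?thesis unfolding face_in_def by (simp add: Ball_def)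
    qed
    moreover have "closed (- \<Union> \<C>)" using ok by (auto simp: ok_def closed_def intro!: open_Union)
    moreover have "- \<Union> \<C> \<subseteq> K" using ok ne by (auto simp: ok_def)
    ultimately show "\<Union> \<C> \<in> {U. ok (- U)}" by (auto simp: ok_def)
  qed
  then obtain U where U: "ok (- U)" "\<And>X. ok (- X) \<Longrightarrow> U \<subseteq> X \<Longrightarrow> X = U" by blast
  define M where "M = - U"
  have M: "closed M" "M \<subseteq> K" "M \<noteq> {}" "face_in M P" using U(1) by (auto simp: ok_def M_def)
  have Mmin: "F = M" if "ok F" "F \<subseteq> M" for F using U(2)[of "- F"] that by (auto simp: M_def)
  have cM: "compact M" using compact_Int_closed[OF K(1) M(1)] M(2) by (simp add: Int_absorb1)
  have const: "L \<psi>1 = L \<psi>2"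
    if lin: "\<And>\<psi>1 \<psi>2 t. L (\<lambda>x. of_real t * \<psi>1 x + of_real (1 - t) * \<psi>2 x) = t * L \<psi>1 + (1 - t) * L \<psi>2"
      and cont: "continuous_on UNIV L" and "\<psi>1 \<in> M" "\<psi>2 \<in> M" for L :: "_ \<Rightarrow> real" and \<psi>1 \<psi>2
  proof -
    obtain \<mu> where \<mu>: "\<mu> \<in> M" "\<And>\<psi>. \<psi> \<in> M \<Longrightarrow> L \<psi> \<le> L \<mu>"
      using continuous_attains_sup[OF cM M(3) continuous_on_subset[OF cont]] by blast
    have "closed {\<psi>. L \<mu> \<le> L \<psi>}" by (intro closed_Collect_le cont continuous_on_const)
    then have "closed (M \<inter> {\<psi>. L \<mu> \<le> L \<psi>})" using M(1) by blast
    then have "ok {\<psi> \<in> M. L \<mu> \<le> L \<psi>}"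
      using face_in_maximizers[where L = L, OF M(4) lin \<mu>(2)] M \<mu> by (auto simp: ok_def Collect_conj_eq)
    then have "{\<psi> \<in> M. L \<mu> \<le> L \<psi>} = M" by (rule Mmin) auto
    then show ?thesis using \<mu>(2) that by (metis (mono_tags, lifting) mem_Collect_eq order_antisym)
  qed
  have eq: "\<psi>1 = \<psi>2" if "\<psi>1 \<in> M" "\<psi>2 \<in> M" for \<psi>1 \<psi>2
  proof
    fix x
    show "\<psi>1 x = \<psi>2 x"
    proof (rule complex_eqI)
      show "Re (\<psi>1 x) = Re (\<psi>2 x)"
        by (rule const[of "\<lambda>\<psi>. Re (\<psi> x)"]) (use that in \<open>auto intro!: continuous_on_Re continuous_on_Im continuous_on_coordinate\<close>)
      show "Im (\<psi>1 x) = Im (\<psi>2 x)"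
        by (rule const[of "\<lambda>\<psi>. Im (\<psi> x)"]) (use that in \<open>auto intro!: continuous_on_Re continuous_on_Im continuous_on_coordinate\<close>)
    qed
  qed
  obtain \<psi> where "\<psi> \<in> M" using M(3) by blast
  then have "M = {\<psi>}" using eq by blast
  then show thesis using M that by auto
qed

lemma continuous_on_sum_list:
  fixes f :: "'b \<Rightarrow> 'c::topological_space \<Rightarrow> 'd::topological_monoid_add"
  assumes "\<And>x. x \<in> set xs \<Longrightarrow> continuous_on A (f x)"
  shows "continuous_on A (\<lambda>z. \<Sum>x\<leftarrow>xs. f x z)"
  using assms by (induction xs) (auto intro!: continuous_on_add)

lemma continuous_on_avg:
  "(\<And>x. x \<in> set xs \<Longrightarrow> continuous_on A (f x)) \<Longrightarrow> continuous_on A (\<lambda>z. avg xs (\<lambda>x. f x z))"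
  unfolding avg_def divide_inverse
  by (intro continuous_on_mult continuous_on_const continuous_on_sum_list)

lemma compact_unit_box: "compact {\<psi>::'b \<Rightarrow> complex. \<forall>x. cmod (\<psi> x) \<le> 1}"
proof -
  have "compactin (product_topology (\<lambda>_. euclidean) UNIV) (PiE UNIV (\<lambda>_::'b. cball (0::complex) 1))"
    by (simp add: compactin_PiE)
  moreover have "PiE UNIV (\<lambda>_::'b. cball (0::complex) 1) = {\<psi>. \<forall>x. cmod (\<psi> x) \<le> 1}"
    by (auto simp: PiE_def)
  ultimately show ?thesis by (simp add: euclidean_product_topology)
qed

section \<open>States of the group and their extreme points\<close>

context compact_abelian_group
begin

lemma pd_cong:
  assumes "positive_definite \<psi>" "\<And>x. x \<in> carrier G \<Longrightarrow> \<psi> x = \<psi>' x"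
  shows "positive_definite \<psi>'"
  unfolding positive_definite_def
proof (intro conjI ballI allI impI)
  show "\<psi>' (inv x) = cnj (\<psi>' x)" if "x \<in> carrier G" for x
    using assms(2)[of x] assms(2)[of "inv x"] pd_inv[OF assms(1)] that by simp
  fix l :: "(complex \<times> 'a) list" assume l: "snd ` set l \<subseteq> carrier G"
  have "quad_form \<psi>' l = quad_form \<psi> l" unfolding quad_form_def
  proof (intro arg_cong[where f = sum_list] map_cong refl)
    fix p q assume "p \<in> set l" "q \<in> set l"
    then have "snd p \<otimes> inv (snd q) \<in> carrier G" using l by auto
    then show "fst p * cnj (fst q) * \<psi>' (snd p \<otimes> inv (snd q)) = fst p * cnj (fst q) * \<psi> (snd p \<otimes> inv (snd q))"
      using assms(2) by simp
  qed
  then show "0 \<le> Re (quad_form \<psi>' l)" using pd_quad_form[OF assms(1) l] by simp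
qed

text \<open>Extension by 0 keeps the set compact for pointwise convergence on the whole
  type.\<close>

definition pd_states :: "('a \<Rightarrow> complex) set" where
  "pd_states = {\<psi>. (\<forall>x. x \<notin> carrier G \<longrightarrow> \<psi> x = 0) \<and> positive_definite \<psi> \<and> \<psi> \<one> = 1}"

lemma closed_pd_states: "closed pd_states"
proof -
  have *: "pd_states = {\<psi>. (\<forall>x. x \<notin> carrier G \<longrightarrow> \<psi> x = 0) \<and>
     (\<forall>x. x \<in> carrier G \<longrightarrow> \<psi> (inv x) = cnj (\<psi> x)) \<and>
     (\<forall>l. snd ` set l \<subseteq> carrier G \<longrightarrow> 0 \<le> Re (quad_form \<psi> l)) \<and> \<psi> \<one> = 1}"
    by (auto simp: pd_states_def positive_definite_def)
  show ?thesis
    unfolding * quad_form_def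
    by (intro closed_Collect_conj closed_Collect_all closed_Collect_imp open_Collect_const closed_Collect_eq closed_Collect_le
        continuous_on_Re continuous_on_sum_list continuous_on_mult continuous_on_const
        continuous_on_cnj continuous_on_coordinate)
qed

lemma compact_pd_states: "compact pd_states"
proof -
  have "cmod (\<psi> x) \<le> 1" if "\<psi> \<in> pd_states" for \<psi> x
    using that pd_norm_le[of \<psi> x] by (cases "x \<in> carrier G") (auto simp: pd_states_def)
  then have "pd_states = {\<psi>. \<forall>x. cmod (\<psi> x) \<le> 1} \<inter> pd_states" by auto
  then show ?thesis using compact_Int_closed[OF compact_unit_box closed_pd_states] by simp
qed

text \<open>The twists of \<open>\<xi>\<close> by \<open>c\<close> and \<open>- c\<close> are
  positive definite and add up to 4 times \<open>\<xi>\<close>. Extremality makes each a multiple of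
  \<open>\<xi>\<close>, and the value at the unit shows that the multiple for \<open>c\<close> is
  \<open>4 * t\<close>.\<close>

lemma extreme_pd_twist:
  assumes ext: "face_in {\<xi>} pd_states" and g: "g \<in> carrier G" and c: "c * cnj c = 1"
    and x: "x \<in> carrier G"
  shows "c * \<xi> (g \<otimes> x) + cnj c * \<xi> (inv g \<otimes> x) = 2 * of_real (Re (c * \<xi> g)) * \<xi> x"
proof -
  have xi: "positive_definite \<xi>" "\<xi> \<one> = 1" "\<And>x. x \<notin> carrier G \<Longrightarrow> \<xi> x = 0"
    using ext by (auto simp: face_in_def pd_states_def)
  define tw where "tw = (\<lambda>c x. 2 * \<xi> x + c * \<xi> (g \<otimes> x) + cnj c * \<xi> (inv g \<otimes> x))"
  define t where "t = (1 + Re (c * \<xi> g)) / 2"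
  have pd: "positive_definite (tw c)" "positive_definite (tw (- c))"
    unfolding tw_def using c by (intro pd_twist xi g; simp)+
  have tw_one: "tw c \<one> = 2 + (c * \<xi> g + cnj (c * \<xi> g))" "tw (- c) \<one> = 2 - (c * \<xi> g + cnj (c * \<xi> g))"
    unfolding tw_def using g xi(2) pd_inv[OF xi(1) g] by simp_all
  have "2 + (u + cnj u) = of_real (4 * ((1 + Re u) / 2))" "2 - (u + cnj u) = of_real (4 * (1 - (1 + Re u) / 2))" for u
    by (simp_all add: complex_eq_iff field_simps)
  then have one: "tw c \<one> = of_real (4 * t)" "tw (- c) \<one> = of_real (4 * (1 - t))"
    unfolding t_def tw_one by blast+
  have "cmod c = 1"
    using c by (rule cmod_eq_one)
  then have "cmod (c * \<xi> g) \<le> 1" using pd_norm_le[OF xi(1) g] xi(2) by (simp add: norm_mult)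
  then have "\<bar>Re (c * \<xi> g)\<bar> \<le> 1" using abs_Re_le_cmod order_trans by blast
  then have t01: "0 \<le> t" "t \<le> 1" unfolding t_def by auto
  have sum: "tw c y + tw (- c) y = 4 * \<xi> y" for y by (simp add: tw_def)
  have "tw c x = of_real (4 * t) * \<xi> x"
  proof -
    \<comment> \<open>For t = 0 or t = 1 one twist has value 0 at the unit. It cannot be normalized,
      but it vanishes by \<open>pd_norm_le\<close>.\<close>
    consider "t = 0" | "t = 1" | "0 < t" "t < 1" using t01 by linarith
    then show ?thesis
    proof cases
      case 1
      then show ?thesis using pd_norm_le[OF pd(1) x] one by simp
    next
      case 2
      then have "tw (- c) x = 0" using pd_norm_le[OF pd(2) x] one by simp
      then show ?thesis using sum[of x] 2 by simp
    next
      case 3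
      define \<psi>1 where "\<psi>1 = (\<lambda>y. if y \<in> carrier G then of_real (1 / (4 * t)) * tw c y else 0)"
      define \<psi>2 where "\<psi>2 = (\<lambda>y. if y \<in> carrier G then of_real (1 / (4 * (1 - t))) * tw (- c) y else 0)"
      have "positive_definite \<psi>1"
        using 3 by (intro pd_cong[OF pd_scale[OF pd(1), of "1 / (4 * t)"]]) (auto simp: \<psi>1_def)
      moreover have "positive_definite \<psi>2"
        using 3 by (intro pd_cong[OF pd_scale[OF pd(2), of "1 / (4 * (1 - t))"]]) (auto simp: \<psi>2_def)
      moreover have ones: "\<psi>1 \<one> = 1" "\<psi>2 \<one> = 1"
      proof -
        have "1 / (4 * t) * (4 * t) = 1" "1 / (4 * (1 - t)) * (4 * (1 - t)) = 1" using 3 by auto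
        then show "\<psi>1 \<one> = 1" "\<psi>2 \<one> = 1"
          by (simp_all only: \<psi>1_def \<psi>2_def one one_closed if_True of_real_mult[symmetric] of_real_1)
      qed
      ultimately have "\<psi>1 \<in> pd_states" "\<psi>2 \<in> pd_states"
        using ones by (auto simp: pd_states_def \<psi>1_def \<psi>2_def)
      moreover have "(\<lambda>y. of_real t * \<psi>1 y + of_real (1 - t) * \<psi>2 y) = \<xi>"
      proof
        fix y
        have "of_real t * (of_real (1 / (4 * t)) * tw c y) + of_real (1 - t) * (of_real (1 / (4 * (1 - t))) * tw (- c) y)
            = of_real (t * (1 / (4 * t))) * tw c y + of_real ((1 - t) * (1 / (4 * (1 - t)))) * tw (- c) y"
          by (simp only: of_real_mult mult.assoc)
        also have "\<dots> = (tw c y + tw (- c) y) / 4" using 3 by (simp add: field_simps)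
        finally show "of_real t * \<psi>1 y + of_real (1 - t) * \<psi>2 y = \<xi> y"
          unfolding sum using xi(3) by (simp add: \<psi>1_def \<psi>2_def)
      qed
      ultimately have "\<psi>1 = \<xi>" using ext 3 unfolding face_in_def by blast
      then have "of_real (1 / (4 * t)) * tw c x = \<xi> x" using x by (auto simp: \<psi>1_def dest: fun_cong)
      then show ?thesis using 3 by (auto simp: field_simps)
    qed
  qed
  moreover have "of_real (4 * t) = 2 + 2 * complex_of_real r" if "r = Re (c * \<xi> g)" for r
    unfolding t_def that[symmetric] by (simp add: field_simps)
  ultimately have "2 * \<xi> x + (c * \<xi> (g \<otimes> x) + cnj c * \<xi> (inv g \<otimes> x)) = 2 * \<xi> x + 2 * of_real r * \<xi> x"
    if "r = Re (c * \<xi> g)" for r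
    using that unfolding tw_def by (simp only: distrib_right add.assoc)
  then show ?thesis by (metis add_left_cancel)
qed

text \<open>The twist identity for \<open>c = 1\<close> gives the sum of the values at
  \<open>g \<otimes> x\<close> and \<open>inv g \<otimes> x\<close>, and for \<open>c = \<i>\<close>
  it gives their difference.\<close>

lemma extreme_pd_mult:
  assumes ext: "face_in {\<xi>} pd_states" and g: "g \<in> carrier G" and x: "x \<in> carrier G"
  shows "\<xi> (g \<otimes> x) = \<xi> g * \<xi> x"
proof -
  have 1: "\<xi> (g \<otimes> x) + \<xi> (inv g \<otimes> x) = 2 * of_real (Re (\<xi> g)) * \<xi> x"
    using extreme_pd_twist[OF ext g _ x, of 1] by simp
  have "\<i> * \<xi> (g \<otimes> x) + cnj \<i> * \<xi> (inv g \<otimes> x) = 2 * of_real (Re (\<i> * \<xi> g)) * \<xi> x"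
    using extreme_pd_twist[OF ext g _ x, of \<i>] by simp
  then have "\<i> * (\<xi> (g \<otimes> x) - \<xi> (inv g \<otimes> x)) = \<i> * (2 * \<i> * of_real (Im (\<xi> g)) * \<xi> x)"
    by (simp add: algebra_simps)
  then have 2: "\<xi> (g \<otimes> x) - \<xi> (inv g \<otimes> x) = 2 * \<i> * of_real (Im (\<xi> g)) * \<xi> x"
    by (simp only: mult_left_cancel[OF complex_i_not_zero])
  have "2 * \<xi> (g \<otimes> x) = (\<xi> (g \<otimes> x) + \<xi> (inv g \<otimes> x)) + (\<xi> (g \<otimes> x) - \<xi> (inv g \<otimes> x))" by simp
  also have "\<dots> = 2 * ((of_real (Re (\<xi> g)) + \<i> * of_real (Im (\<xi> g))) * \<xi> x)"
    unfolding 1 2 by (simp add: algebra_simps)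
  finally show ?thesis by (simp flip: complex_eq)
qed

lemma extreme_pd_norm:
  assumes ext: "face_in {\<xi>} pd_states" and x: "x \<in> carrier G"
  shows "cmod (\<xi> x) = 1"
proof -
  have xi: "positive_definite \<xi>" "\<xi> \<one> = 1" using ext by (auto simp: face_in_def pd_states_def)
  show ?thesis
    using extreme_pd_mult[OF ext x, of "inv x"] x xi pd_inv[OF xi(1) x] by (intro cmod_eq_one) simp
qed

lemma extreme_pd_power:
  assumes ext: "face_in {\<xi>} pd_states" and x: "x \<in> carrier G"
  shows "\<xi> (x [^] (i::nat)) = \<xi> x ^ i"
proof (induction i)
  case 0
  then show ?case using ext by (simp add: face_in_def pd_states_def)
next
  case (Suc i)
  then show ?case using extreme_pd_mult[OF ext, of "x [^] i" x] x by (simp add: mult.commute)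
qed

end

section \<open>Continuous characters separate points\<close>

lemma interval_avg: "avg (map h [0..<n]) f = (\<Sum>i<n. f (h i)) / real n"
  by (simp add: avg_def interv_sum_list_conv_sum_set_nat o_def atLeast0LessThan)

lemma avg_avg_mult: "avg xs (\<lambda>x. avg xs (\<lambda>y. u x * u y)) = (avg xs u)\<^sup>2"
proof -
  have "avg xs (\<lambda>x. avg xs (\<lambda>y. u x * u y)) = avg xs (\<lambda>x. avg xs u * u x)"
    by (simp add: avg_cmult mult.commute)
  then show ?thesis by (simp add: avg_cmult power2_eq_square)
qed

text \<open>The double sum is the squared modulus of a geometric sum, whose numerator has modulus at
  most 2.\<close>

lemma square_avg_powers:
  fixes z :: complex
  assumes "cmod z = 1" "e > 0" "e \<le> cmod (z - 1)"
  shows "(\<Sum>i<n. \<Sum>j<n. Re (z ^ i * cnj (z ^ j))) \<le> 4 / e\<^sup>2"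
proof -
  define S where "S = (\<Sum>i<n. z ^ i)"
  have "(\<Sum>i<n. \<Sum>j<n. z ^ i * cnj (z ^ j)) = S * cnj S"
    by (simp add: S_def sum_product)
  then have "(\<Sum>i<n. \<Sum>j<n. Re (z ^ i * cnj (z ^ j))) = Re (S * cnj S)"
    by (metis (mono_tags, lifting) Re_sum sum.cong)
  also have "S * cnj S = of_real ((cmod S)\<^sup>2)" using complex_norm_square[of S] by simp
  also have "Re (of_real ((cmod S)\<^sup>2)) = (cmod S)\<^sup>2" by simp
  also have "\<dots> \<le> (2 / e)\<^sup>2"
  proof (rule power_mono)
    have "z \<noteq> 1" using assms by auto
    then have "S = (z ^ n - 1) / (z - 1)" unfolding S_def by (rule geometric_sum)
    then have "cmod S = cmod (z ^ n - 1) / cmod (z - 1)" by (simp add: norm_divide)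
    also have "\<dots> \<le> 2 / e"
    proof (rule frac_le)
      show "cmod (z ^ n - 1) \<le> 2"
        using norm_triangle_ineq4[of "z ^ n" 1] assms(1) by (simp add: norm_power)
    qed (use assms in auto)
    finally show "cmod S \<le> 2 / e" .
  qed simp
  finally show ?thesis by (simp add: power_divide)
qed

context compact_abelian_group
begin

text \<open>Pigeonhole: \<open>K\<close> translates of a neighbourhood with quotients in
  \<open>V\<close> cover the group, so one of them holds at least a share 1/K of any list. Pairs
  inside it contribute at least \<open>\<delta>\<close> and all other pairs are nonnegative, whence
  the bound \<delta>/K^2 for every list.\<close>

lemma pd_avg_const_le:
  assumes w: "\<And>x. x \<in> carrier G \<Longrightarrow> 0 \<le> Re (w x)" and V: "openin T V" "\<one> \<in> V"
    and \<delta>: "\<delta> > 0" "\<And>v. v \<in> V \<Longrightarrow> \<delta> \<le> Re (w v)"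
  obtains s where "s > 0" "\<And>xs. xs \<in> finlists \<Longrightarrow> s \<le> pd_avg xs w"
proof -
  have "continuous_map (prod_topology T T) (prod_topology T T) (\<lambda>z. (fst z, inv (snd z)))"
    using continuous_map_compose[OF continuous_map_snd continuous_inv, of T]
    by (intro continuous_map_pairedI continuous_map_fst) (simp_all add: o_def)
  from continuous_map_compose[OF this continuous_mult]
  have "continuous_map (prod_topology T T) T (\<lambda>z. fst z \<otimes> inv (snd z))" by (simp add: o_def)
  note openin_continuous_map_preimage[OF this V(1)]
  moreover define Z where "Z = {z \<in> topspace (prod_topology T T). fst z \<otimes> inv (snd z) \<in> V}"
  ultimately have Z: "openin (prod_topology T T) Z" "(\<one>, \<one>) \<in> Z"
    using V(2) by (simp_all add: topspace_eq_carrier)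
  obtain U W where UW: "openin T U" "openin T W" "\<one> \<in> U" "\<one> \<in> W" "U \<times> W \<subseteq> Z"
    using Z(1)[unfolded openin_prod_topology_alt, rule_format, OF Z(2)] by (elim exE conjE)
  have UWV: "x \<otimes> inv y \<in> V" if "x \<in> U \<inter> W" "y \<in> U \<inter> W" for x y
  proof -
    have "(x, y) \<in> U \<times> W" using that by simp
    then show ?thesis using UW(5) by (auto simp: Z_def)
  qed
  have "openin T (U \<inter> W)" "\<one> \<in> U \<inter> W" using UW by auto
  then obtain cs where cs: "cs \<in> finlists" "\<And>x. x \<in> carrier G \<Longrightarrow> \<exists>c\<in>set cs. x \<otimes> c \<in> U \<inter> W"
    by (rule finite_translates) blast
  define K where "K = real (card (set cs))"
  have K: "K > 0" using cs(1) unfolding K_def by (simp add: card_gt_0_iff)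
  have "\<delta> / K\<^sup>2 \<le> pd_avg xs w" if xs: "xs \<in> finlists" for xs
  proof -
    define u :: "'a \<Rightarrow> 'a \<Rightarrow> real" where "u = (\<lambda>c x. if x \<otimes> c \<in> U \<inter> W then 1 else 0)"
    have avg_sum: "avg xs (\<lambda>x. \<Sum>c\<in>C. u c x) = (\<Sum>c\<in>C. avg xs (u c))" if "finite C" for C
      using that xs by (induction C) (simp_all add: avg_add)
    have "1 = avg xs (\<lambda>_. 1)" using xs by simp
    also have "\<dots> \<le> avg xs (\<lambda>x. \<Sum>c\<in>set cs. u c x)"
    proof (rule avg_mono)
      fix x assume "x \<in> set xs"
      then obtain c where "c \<in> set cs" "x \<otimes> c \<in> U \<inter> W" using cs(2) xs by auto
      then have "u c x = 1" "c \<in> set cs" by (auto simp: u_def)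
      moreover have "u c x \<le> (\<Sum>c\<in>set cs. u c x)"
        using calculation by (intro member_le_sum) (auto simp: u_def)
      ultimately show "1 \<le> (\<Sum>c\<in>set cs. u c x)" by simp
    qed
    finally have "1 \<le> (\<Sum>c\<in>set cs. avg xs (u c))" by (simp add: avg_sum)
    moreover have "(\<Sum>c\<in>set cs. avg xs (u c)) < 1" if "\<And>c. c \<in> set cs \<Longrightarrow> avg xs (u c) < 1 / K"
    proof -
      have "(\<Sum>c\<in>set cs. avg xs (u c)) < (\<Sum>c\<in>set cs. 1 / K)"
        using that cs(1) by (intro sum_strict_mono) auto
      then show ?thesis using K by (simp add: K_def split: if_splits)
    qed
    ultimately obtain c where c: "c \<in> set cs" "1 / K \<le> avg xs (u c)" by (meson not_le)
    have cG: "c \<in> carrier G" using c cs by auto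
    have "\<delta> / K\<^sup>2 = \<delta> * (1 / K)\<^sup>2" by (simp add: power_divide)
    also have "\<dots> \<le> \<delta> * (avg xs (u c))\<^sup>2" using c K \<delta> by (intro mult_left_mono power_mono) auto
    also have "\<dots> = avg xs (\<lambda>x. avg xs (\<lambda>y. \<delta> * (u c x * u c y)))"
      by (simp only: avg_cmult avg_avg_mult[symmetric])
    also have "\<dots> \<le> pd_avg xs w"
      unfolding pd_avg_def
    proof (intro avg_mono)
      fix x y assume "x \<in> set xs" "y \<in> set xs"
      then have x: "x \<in> carrier G" "y \<in> carrier G" using xs by auto
      show "\<delta> * (u c x * u c y) \<le> Re (w (x \<otimes> inv y))"
      proof (cases "x \<otimes> c \<in> U \<inter> W \<and> y \<otimes> c \<in> U \<inter> W")
        case True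
        have "(x \<otimes> c) \<otimes> inv (y \<otimes> c) = (c \<otimes> inv c) \<otimes> (x \<otimes> inv y)"
          using x cG by (simp only: inv_mult m_ac inv_closed m_closed)
        then have "x \<otimes> inv y = (x \<otimes> c) \<otimes> inv (y \<otimes> c)" using x cG by simp
        also have "\<dots> \<in> V" using UWV True by blast
        finally show ?thesis using True \<delta> by (simp add: u_def)
      next
        case False
        then have z: "u c x * u c y = 0" by (auto simp: u_def)
        show ?thesis unfolding z using w[of "x \<otimes> inv y"] x by simp
      qed
    qed
    finally show ?thesis .
  qed
  moreover have "\<delta> / K\<^sup>2 > 0" using \<delta> K by simp
  ultimately show thesis by (rule that[rotated])
qed

lemma closed_pd_avg_ge: "closed {\<psi>. s \<le> pd_avg xs (\<lambda>x. of_real (corr F x) * \<psi> x)}"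
  unfolding pd_avg_def
  by (intro closed_Collect_le continuous_on_const continuous_on_avg continuous_on_Re
      continuous_on_mult continuous_on_coordinate)

text \<open>Since \<open>pd_avg\<close> decreases along products of lists, its infimum over all lists is affine in the state,
  so the states maximizing this infimum form a closed face.\<close>

lemma maximal_extreme_state:
  assumes F: "cont F" and x0: "x0 \<in> carrier G" "F x0 \<noteq> 0"
  obtains \<xi> s where "face_in {\<xi>} pd_states" "s > 0"
    "\<forall>xs\<in>finlists. s \<le> pd_avg xs (\<lambda>x. of_real (corr F x) * \<xi> x)"
proof -
  define b where "b = corr F \<one>"
  define Q where "Q = (\<lambda>xs \<psi>. pd_avg xs (\<lambda>x. of_real (corr F x) * \<psi> x))"
  have "mean (\<lambda>z. F z * F z) > 0"
    using F x0 by (intro mean_pos[of _ x0] continuous_map_real_mult) (auto simp: zero_less_mult_iff)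
  then have b: "b > 0" unfolding b_def by (simp add: corr_one[OF F])
  have pdQ: "positive_definite (\<lambda>x. of_real (corr F x) * \<psi> x)" if "\<psi> \<in> pd_states" for \<psi>
    using that pd_corr_mult[OF F] by (simp add: pd_states_def)
  define S where "S = {s. \<exists>\<psi>\<in>pd_states. \<forall>xs\<in>finlists. s \<le> Q xs \<psi>}"
  \<comment> \<open>With this state the weighted function is the square of \<open>corr F\<close>
    divided by \<open>b\<close>: nonnegative everywhere, and at least \<open>b / 4\<close> where
    \<open>corr F\<close> is at least \<open>b / 2\<close>. So the supremum of the infima is
    positive.\<close>
  define \<psi>0 where "\<psi>0 = (\<lambda>x. if x \<in> carrier G then of_real (corr F x) / of_real b else 0 :: complex)"
  have "positive_definite (\<lambda>x. of_real (1 / b) * (of_real (corr F x) * 1))"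
    using b by (intro pd_scale pd_corr_mult pd_one F) simp
  then have "positive_definite \<psi>0" by (rule pd_cong) (simp add: \<psi>0_def)
  then have \<psi>0: "\<psi>0 \<in> pd_states" using b by (simp add: pd_states_def \<psi>0_def b_def)
  obtain V where V: "openin T V" "\<one> \<in> V" "\<And>v. v \<in> V \<Longrightarrow> \<bar>corr F v - corr F \<one>\<bar> \<le> b / 2"
    using corr_near_one[OF F, of "b / 2"] b by auto
  obtain s0 where s0: "s0 > 0" "\<And>xs. xs \<in> finlists \<Longrightarrow> s0 \<le> Q xs \<psi>0"
  proof (rule pd_avg_const_le[of "\<lambda>x. of_real (corr F x) * \<psi>0 x" V "b / 4"])
    show "0 \<le> Re (of_real (corr F x) * \<psi>0 x)" for x
      using b by (simp add: \<psi>0_def Re_divide_of_real)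
    fix v assume v: "v \<in> V"
    then have "v \<in> carrier G" using V(1) openin_subset topspace_eq_carrier by auto
    moreover have "b / 2 \<le> corr F v" using V(3)[OF v] unfolding b_def by linarith
    then have "b / 2 * (b / 2) \<le> corr F v * corr F v" using b by (intro mult_mono) auto
    ultimately show "b / 4 \<le> Re (of_real (corr F v) * \<psi>0 v)"
      using b by (simp add: \<psi>0_def Re_divide_of_real field_simps)
  qed (use V b that in \<open>auto simp: Q_def\<close>)
  have "s0 \<in> S" using s0 \<psi>0 by (auto simp: S_def)
  have "s \<le> b" if "s \<in> S" for s
  proof -
    obtain \<psi> where "\<psi> \<in> pd_states" "\<forall>xs\<in>finlists. s \<le> Q xs \<psi>" using \<open>s \<in> S\<close> unfolding S_def by blast
    then have "s \<le> Q [\<one>] \<psi>" by simp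
    also have "Q [\<one>] \<psi> = b"
      using \<open>\<psi> \<in> pd_states\<close> by (simp add: Q_def pd_avg_def avg_def pd_states_def b_def)
    finally show ?thesis .
  qed
  then have bdd: "bdd_above S" by (rule bdd_aboveI)
  define m where "m = Sup S"
  have "s0 \<le> m" unfolding m_def using \<open>s0 \<in> S\<close> bdd by (rule cSup_upper)
  define K where "K = {\<psi> \<in> pd_states. \<forall>xs\<in>finlists. m \<le> Q xs \<psi>}"
  have closedQ: "closed {\<psi>. \<forall>xs\<in>finlists. s \<le> Q xs \<psi>}" for s
  proof -
    have "{\<psi>. \<forall>xs\<in>finlists. s \<le> Q xs \<psi>} = (\<Inter>xs\<in>finlists. {\<psi>. s \<le> Q xs \<psi>})" by auto
    also have "closed \<dots>" unfolding Q_def by (intro closed_INT ballI closed_pd_avg_ge)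
    finally show ?thesis .
  qed
  have K_eq: "K = pd_states \<inter> {\<psi>. \<forall>xs\<in>finlists. m \<le> Q xs \<psi>}" by (auto simp: K_def)
  have "compact K" "closed K"
    unfolding K_eq by (intro compact_Int_closed compact_pd_states closedQ closed_Int closed_pd_states)+
  moreover have "K \<noteq> {}"
  proof -
    \<comment> \<open>The sets of states with infimum at least \<open>s\<close> are nested in
      \<open>s\<close>, so the finite intersection property provides a state that attains the
      supremum \<open>m\<close>.\<close>
    have "pd_states \<inter> \<Inter> ((\<lambda>s. {\<psi>. \<forall>xs\<in>finlists. s \<le> Q xs \<psi>}) ` {..<m}) \<noteq> {}"
    proof (rule compact_imp_fip[OF compact_pd_states])
      fix \<F> assume "finite \<F>" "\<F> \<subseteq> (\<lambda>s. {\<psi>. \<forall>xs\<in>finlists. s \<le> Q xs \<psi>}) ` {..<m}"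
      then obtain A where A: "finite A" "A \<subseteq> {..<m}" "\<F> = (\<lambda>s. {\<psi>. \<forall>xs\<in>finlists. s \<le> Q xs \<psi>}) ` A"
        by (meson finite_subset_image)
      show "pd_states \<inter> \<Inter> \<F> \<noteq> {}"
      proof (cases "A = {}")
        case True
        then show ?thesis using A \<psi>0 by auto
      next
        case False
        then have "Max A < m" using A by (meson Max_in lessThan_iff subsetD)
        then obtain s where s: "s \<in> S" "Max A < s"
          unfolding m_def using less_cSupD[of S] \<open>s0 \<in> S\<close> by blast
        then obtain \<psi> where "\<psi> \<in> pd_states" "\<forall>xs\<in>finlists. s \<le> Q xs \<psi>" unfolding S_def by blast
        moreover have "a \<le> s" if "a \<in> A" for a using Max_ge[OF A(1) that] s by linarith
        ultimately have "\<psi> \<in> pd_states \<inter> \<Inter> \<F>" unfolding A(3) by (auto intro: order_trans)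
        then show ?thesis by blast
      qed
    qed (use closedQ in auto)
    then obtain \<psi> where \<psi>: "\<psi> \<in> pd_states" "\<forall>s\<in>{..<m}. \<psi> \<in> {\<psi>. \<forall>xs\<in>finlists. s \<le> Q xs \<psi>}"
      by blast
    have "m \<le> Q xs \<psi>" if "xs \<in> finlists" for xs
    proof (rule dense_le)
      show "s \<le> Q xs \<psi>" if "s < m" for s using \<psi>(2) that \<open>xs \<in> finlists\<close> by simp
    qed
    then show ?thesis using \<psi> by (auto simp: K_def)
  qed
  moreover have "face_in K pd_states"
    unfolding face_in_def
  proof (intro conjI ballI allI impI)
    fix \<psi>1 \<psi>2 :: "'a \<Rightarrow> complex" and t :: real
    have half: "\<psi>1 \<in> K" if P: "\<psi>1 \<in> pd_states" "\<psi>2 \<in> pd_states" and t: "0 < t" "t < 1"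
      and c: "(\<lambda>x. of_real t * \<psi>1 x + of_real (1 - t) * \<psi>2 x) \<in> K" for \<psi>1 \<psi>2 t
    proof (rule ccontr)
      assume "\<psi>1 \<notin> K"
      then obtain xs where xs: "xs \<in> finlists" "Q xs \<psi>1 < m" using P by (auto simp: K_def not_le)
      \<comment> \<open>The amount that \<open>\<psi>1\<close> loses against \<open>m\<close> on
        \<open>xs\<close>, weighted by \<open>t\<close>. As \<open>m\<close> is the supremum, some
        list \<open>ys\<close> keeps \<open>\<psi>2\<close> below \<open>m + e\<close>. The product
        list inherits both bounds, and the combination is below \<open>m - t * e\<close>.\<close>
      define e where "e = t * (m - Q xs \<psi>1)"
      have e: "e > 0" unfolding e_def using t xs by simp
      have "m + e \<notin> S" using cSup_upper[OF _ bdd, of "m + e"] e unfolding m_def by auto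
      then obtain ys where ys: "ys \<in> finlists" "Q ys \<psi>2 < m + e" using P by (auto simp: S_def not_le)
      let ?zs = "list_mult xs ys"
      have "m \<le> Q ?zs (\<lambda>x. of_real t * \<psi>1 x + of_real (1 - t) * \<psi>2 x)"
        using c list_mult_in[OF xs(1) ys(1)] by (auto simp: K_def)
      also have "\<dots> = Q ?zs (\<lambda>x. of_real t * \<psi>1 x) + Q ?zs (\<lambda>x. of_real (1 - t) * \<psi>2 x)"
        unfolding Q_def pd_avg_def by (simp add: distrib_left avg_add)
      also have "\<dots> = t * Q ?zs \<psi>1 + (1 - t) * Q ?zs \<psi>2"
      proof -
        have "Q zs (\<lambda>x. of_real r * \<psi> x) = r * Q zs \<psi>" for zs r \<psi>
          unfolding Q_def pd_avg_def by (simp add: avg_cmult[symmetric] mult.left_commute)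
        then show ?thesis by (simp only:)
      qed
      also have "\<dots> \<le> t * Q xs \<psi>1 + (1 - t) * Q ys \<psi>2"
      proof (intro add_mono mult_left_mono)
        show "Q ?zs \<psi>1 \<le> Q xs \<psi>1" unfolding Q_def by (rule pd_avg_list_mult_le[OF pdQ[OF P(1)] xs(1) ys(1)])
        show "Q ?zs \<psi>2 \<le> Q ys \<psi>2"
          unfolding Q_def pd_avg_list_mult_commute[OF xs(1) ys(1)]
          by (rule pd_avg_list_mult_le[OF pdQ[OF P(2)] ys(1) xs(1)])
      qed (use t in auto)
      also have "\<dots> < t * Q xs \<psi>1 + (1 - t) * (m + e)" using t ys by simp
      also have "\<dots> = m - t * e" by (simp add: e_def algebra_simps)
      finally show False using t e by (simp add: mult_less_0_iff)
    qed
    show "\<psi>1 \<in> K" "\<psi>2 \<in> K" if "\<psi>1 \<in> pd_states" "\<psi>2 \<in> pd_states" "0 < t" "t < 1"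
      "(\<lambda>x. of_real t * \<psi>1 x + of_real (1 - t) * \<psi>2 x) \<in> K"
      using half[of \<psi>1 \<psi>2 t] half[of \<psi>2 \<psi>1 "1 - t"] that by (simp_all add: add.commute)
  qed (auto simp: K_def)
  ultimately obtain \<xi> where "\<xi> \<in> K" "face_in {\<xi>} pd_states" by (rule exists_extreme_point)
  then show thesis using that[of \<xi> m] \<open>s0 \<le> m\<close> s0(1) by (auto simp: K_def Q_def)
qed

text \<open>Multiplication by a value of modulus 1 carries the estimate at the unit to every other
  point without loss.\<close>

lemma hom_imp_continuous:
  assumes \<xi>: "\<And>x y. x \<in> carrier G \<Longrightarrow> y \<in> carrier G \<Longrightarrow> \<xi> (x \<otimes> y) = \<xi> x * (\<xi> y :: complex)"
    and norm: "\<And>x. x \<in> carrier G \<Longrightarrow> cmod (\<xi> x) = 1"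
    and one: "\<And>e. e > 0 \<Longrightarrow> \<exists>V. openin T V \<and> \<one> \<in> V \<and> (\<forall>v\<in>V. cmod (\<xi> v - 1) < e)"
  shows "continuous_map T euclidean \<xi>"
  unfolding continuous_map
proof (intro conjI allI impI)
  fix U :: "complex set" assume "openin euclidean U"
  then have U: "open U" by simp
  show "openin T {x \<in> topspace T. \<xi> x \<in> U}"
  proof (subst openin_subopen, intro ballI)
    fix x assume "x \<in> {x \<in> topspace T. \<xi> x \<in> U}"
    then have x: "x \<in> carrier G" "\<xi> x \<in> U" by (auto simp: topspace_eq_carrier)
    then obtain e where e: "e > 0" "ball (\<xi> x) e \<subseteq> U" using openE[OF U] by blast
    then obtain V where V: "openin T V" "\<one> \<in> V" "\<And>v. v \<in> V \<Longrightarrow> cmod (\<xi> v - 1) < e"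
      using one[OF e(1)] by blast
    let ?W = "{y \<in> topspace T. y \<otimes> inv x \<in> V}"
    have "openin T ?W" by (rule openin_continuous_map_preimage[OF continuous_translate V(1)]) (simp add: x)
    moreover have "x \<in> ?W" using x V(2) by (simp add: topspace_eq_carrier)
    moreover have "?W \<subseteq> {x \<in> topspace T. \<xi> x \<in> U}"
    proof
      fix y assume y: "y \<in> ?W"
      then have yG: "y \<in> carrier G" by (simp add: topspace_eq_carrier)
      have "x \<otimes> (y \<otimes> inv x) = y" using m_lcomm[of x y "inv x"] x yG by simp
      then have "\<xi> y = \<xi> x * \<xi> (y \<otimes> inv x)" using \<xi>[of x "y \<otimes> inv x"] x yG by simp
      then have "\<xi> y - \<xi> x = \<xi> x * (\<xi> (y \<otimes> inv x) - 1)" by (simp add: right_diff_distrib)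
      then have "cmod (\<xi> y - \<xi> x) = cmod (\<xi> (y \<otimes> inv x) - 1)"
        using norm[OF x(1)] by (simp add: norm_mult)
      then have "dist (\<xi> x) (\<xi> y) < e"
        using V(3)[of "y \<otimes> inv x"] y by (simp add: dist_norm norm_minus_commute)
      then show "y \<in> {x \<in> topspace T. \<xi> x \<in> U}" using e yG by (auto simp: topspace_eq_carrier)
    qed
    ultimately show "\<exists>W. openin T W \<and> x \<in> W \<and> W \<subseteq> {x \<in> topspace T. \<xi> x \<in> U}" by blast
  qed
qed auto

lemma continuous_nat_pow: "continuous_map T T (\<lambda>x. x [^] (n::nat))"
proof (induction n)
  case (Suc n)
  have "continuous_map T (prod_topology T T) (\<lambda>x. (x [^] n, x))"
    by (intro continuous_map_pairedI Suc continuous_map_id[unfolded id_def])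
  from continuous_map_compose[OF this continuous_mult] show ?case by (simp add: o_def)
qed (simp add: topspace_eq_carrier)

lemma pd_avg_powers:
  assumes x: "x \<in> carrier G"
  shows "pd_avg (map (\<lambda>i. x [^] (i::nat)) [0..<n]) w =
    (\<Sum>i<n. \<Sum>j<n. Re (w (x [^] i \<otimes> inv (x [^] j)))) / (real n)\<^sup>2"
  by (simp add: pd_avg_def interval_avg sum_divide_distrib[symmetric] power2_eq_square)

text \<open>If \<open>\<xi>\<close> were discontinuous, averaging over powers of a small \<open>x\<close> with \<open>\<xi>(x)\<close> far from \<open>1\<close> would be too small.\<close>

lemma state_continuous:
  assumes F: "cont F" and ext: "face_in {\<xi>} pd_states" and s: "s > 0"
    and max: "\<And>xs. xs \<in> finlists \<Longrightarrow> s \<le> pd_avg xs (\<lambda>x. of_real (corr F x) * \<xi> x)"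
  shows "continuous_map T euclidean \<xi>"
proof (rule hom_imp_continuous)
  note mult = extreme_pd_mult[OF ext] and norm = extreme_pd_norm[OF ext] and pow = extreme_pd_power[OF ext]
  have \<xi>: "positive_definite \<xi>" "\<xi> \<one> = 1" using ext by (auto simp: face_in_def pd_states_def)
  define b where "b = corr F \<one>"
  have "mean (\<lambda>_. 0) \<le> mean (\<lambda>z. F z * F z)"
    by (intro mean_mono continuous_map_real_mult F) auto
  then have b: "b \<ge> 0" unfolding b_def corr_one[OF F] by simp
  obtain V where V: "openin T V" "\<one> \<in> V" "\<And>v. v \<in> V \<Longrightarrow> \<bar>corr F v - b\<bar> \<le> s / 4"
    using corr_near_one[OF F, of "s / 4"] s unfolding b_def by auto
  fix e :: real assume e: "e > 0"
  \<comment> \<open>Half of \<open>s\<close> is budgeted: s/4 for the geometric sums, which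
    contribute at most 4 b / (e^2 n^2), and s/4 for the deviation of \<open>corr F\<close> from
    \<open>b\<close>.\<close>
  obtain n :: nat where n: "real n > 16 * (b + 1) / (s * e\<^sup>2)" using reals_Archimedean2 by blast
  then have n0: "n > 0"
  proof -
    have "0 \<le> 16 * (b + 1) / (s * e\<^sup>2)" using b s by simp
    then show ?thesis using n by linarith
  qed
  have "4 * b / (e\<^sup>2 * (real n)\<^sup>2) < s / 4"
  proof -
    have "16 * b \<le> 16 * (b + 1)" by simp
    also have "\<dots> < real n * (s * e\<^sup>2)" using n s e by (simp add: pos_divide_less_eq)
    also have "\<dots> \<le> (real n)\<^sup>2 * (s * e\<^sup>2)"
      using n0 s e by (intro mult_right_mono) (auto simp: power2_eq_square)
    finally show ?thesis using n0 s e by (simp add: field_simps)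
  qed
  note nbound = this
  define D where "D = (\<lambda>i j x. x [^] (i::nat) \<otimes> inv (x [^] (j::nat)))"
  have contD: "continuous_map T T (D i j)" for i j
  proof -
    have "continuous_map T (prod_topology T T) (\<lambda>x. (x [^] i, inv (x [^] j)))"
      using continuous_map_compose[OF continuous_nat_pow continuous_inv, of j]
      by (intro continuous_map_pairedI continuous_nat_pow) (simp add: o_def)
    from continuous_map_compose[OF this continuous_mult] show ?thesis by (simp add: o_def D_def)
  qed
  \<comment> \<open>The quadratic average over powers of \<open>x\<close> runs over pairs, so all
    quotients of the first \<open>n\<close> powers have to lie in \<open>V\<close>.\<close>
  define W where "W = (\<Inter>(i, j)\<in>{..<n} \<times> {..<n}. {x \<in> topspace T. D i j x \<in> V})"
  have "openin T W"
    unfolding W_def using n0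
    by (intro openin_Inter) (auto intro!: openin_continuous_map_preimage[OF contD V(1)])
  moreover have "\<one> \<in> W" unfolding W_def using V(2) by (auto simp: D_def topspace_eq_carrier)
  moreover have "cmod (\<xi> x - 1) < e" if x: "x \<in> W" for x
  proof (rule ccontr)
    assume neg: "\<not> cmod (\<xi> x - 1) < e"
    have "x \<in> topspace T" using x n0 unfolding W_def by auto
    then have xG: "x \<in> carrier G" by (simp add: topspace_eq_carrier)
    have DV: "D i j x \<in> V" if "i < n" "j < n" for i j using x that unfolding W_def by auto
    let ?xs = "map (\<lambda>i. x [^] (i::nat)) [0..<n]"
    let ?z = "\<xi> x"
    have "?xs \<in> finlists" using xG n0 by auto
    then have "s \<le> pd_avg ?xs (\<lambda>x. of_real (corr F x) * \<xi> x)" by (rule max)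
    also have "\<dots> = (\<Sum>i<n. \<Sum>j<n. Re (of_real (corr F (D i j x)) * \<xi> (D i j x))) / (real n)\<^sup>2"
      unfolding D_def by (rule pd_avg_powers[OF xG])
    also have "\<dots> \<le> (\<Sum>i<n. \<Sum>j<n. b * Re (?z ^ i * cnj (?z ^ j)) + s / 4) / (real n)\<^sup>2"
    proof (intro divide_right_mono sum_mono)
      fix i j assume ij: "i \<in> {..<n}" "j \<in> {..<n}"
      have DG: "D i j x \<in> carrier G" using xG by (simp add: D_def)
      have eq: "\<xi> (D i j x) = ?z ^ i * cnj (?z ^ j)"
        unfolding D_def using xG pd_inv[OF \<xi>(1)] by (simp add: mult pow)
      have "\<bar>(corr F (D i j x) - b) * Re (\<xi> (D i j x))\<bar> \<le> s / 4 * 1"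
        unfolding abs_mult using V(3)[OF DV] ij s abs_Re_le_cmod[of "\<xi> (D i j x)"] norm[OF DG]
        by (intro mult_mono) auto
      then have "(corr F (D i j x) - b) * Re (\<xi> (D i j x)) \<le> s / 4" by linarith
      then show "Re (of_real (corr F (D i j x)) * \<xi> (D i j x)) \<le> b * Re (?z ^ i * cnj (?z ^ j)) + s / 4"
        unfolding eq[symmetric] by (simp add: left_diff_distrib)
    qed simp
    also have "\<dots> = b * (\<Sum>i<n. \<Sum>j<n. Re (?z ^ i * cnj (?z ^ j))) / (real n)\<^sup>2 + s / 4"
      using n0 by (simp add: sum.distrib sum_distrib_left add_divide_distrib power2_eq_square)
    also have "\<dots> \<le> b * (4 / e\<^sup>2) / (real n)\<^sup>2 + s / 4"
      using square_avg_powers[OF norm[OF xG] e, of n] neg b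
      by (intro add_right_mono divide_right_mono mult_left_mono) auto
    also have "b * (4 / e\<^sup>2) / (real n)\<^sup>2 = 4 * b / (e\<^sup>2 * (real n)\<^sup>2)" by simp
    also have "\<dots> + s / 4 < s / 4 + s / 4" using nbound by linarith
    finally show False using s by simp
  qed
  ultimately show "\<exists>V. openin T V \<and> \<one> \<in> V \<and> (\<forall>v\<in>V. cmod (\<xi> v - 1) < e)" by blast
qed (use extreme_pd_mult[OF ext] extreme_pd_norm[OF ext] in auto)

text \<open>Apply the maximal state to \<open>F(y) = f(ya) - f(y)\<close>: if \<open>\<xi>(a) = 1\<close>, averaging over powers of \<open>a\<close> telescopes.\<close>

lemma characters_separate:
  assumes a: "a \<in> carrier G" "a \<noteq> \<one>"
  obtains \<xi> where "\<xi> \<in> characters G T" "\<xi> a \<noteq> 1"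
proof -
  have "normal_space T" using compact_Hausdorff_or_regular_imp_normal_space[OF compact] Hausdorff by blast
  then obtain f :: "'a \<Rightarrow> real" where f: "cont f" "f \<one> = 0" "f a = 1"
    using Urysohn_lemma_alt[of T "{\<one>}" "{a}" 0 1] a closedin_Hausdorff_singleton[OF Hausdorff]
    by (auto simp: topspace_eq_carrier)
  define F where "F = (\<lambda>y. f (y \<otimes> a) - f y)"
  have F: "cont F" unfolding F_def by (intro continuous_map_diff cont_translate[OF f(1)] f a)
  have "F \<one> \<noteq> 0" using f a by (simp add: F_def)
  obtain \<xi> s where ext: "face_in {\<xi>} pd_states" and s: "s > 0"
    and max': "\<forall>xs\<in>finlists. s \<le> pd_avg xs (\<lambda>x. of_real (corr F x) * \<xi> x)"
    by (rule maximal_extreme_state[OF F one_closed \<open>F \<one> \<noteq> 0\<close>])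
  note max = max'[rule_format]
  note mult = extreme_pd_mult[OF ext] and norm = extreme_pd_norm[OF ext] and pow = extreme_pd_power[OF ext]
  have \<xi>: "positive_definite \<xi>" "\<xi> \<one> = 1" using ext by (auto simp: face_in_def pd_states_def)
  have cont: "continuous_map T euclidean \<xi>" by (rule state_continuous[OF F ext s max])
  have "\<xi> a \<noteq> 1"
  proof
    assume "\<xi> a = 1"
    obtain B where B: "B > 0" "\<And>x. x \<in> carrier G \<Longrightarrow> \<bar>f x\<bar> \<le> B"
      using continuous_bounded[OF f(1)] by blast
    \<comment> \<open>The telescoped sums are at most \<open>2 * B\<close> in modulus, so the
      average over n^2 pairs is at most 4 B^2 / n^2. This \<open>n\<close> brings it below
      \<open>s\<close>.\<close>
    obtain n :: nat where n: "real n > 4 * B\<^sup>2 / s" using reals_Archimedean2 by blast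
    have "0 \<le> 4 * B\<^sup>2 / s" using s by simp
    then have n0: "n > 0" using n by linarith
    let ?xs = "map (\<lambda>i. a [^] (i::nat)) [0..<n]"
    have "?xs \<in> finlists" using a n0 by auto
    then have "s \<le> pd_avg ?xs (\<lambda>x. of_real (corr F x) * \<xi> x)" by (rule max)
    also have "\<dots> = (\<Sum>i<n. \<Sum>j<n. Re (of_real (corr F (a [^] i \<otimes> inv (a [^] j))) * \<xi> (a [^] i \<otimes> inv (a [^] j)))) / (real n)\<^sup>2"
      by (rule pd_avg_powers[OF a(1)])
    also have "\<dots> = (\<Sum>i<n. \<Sum>j<n. mean (\<lambda>z. F (z \<otimes> a [^] i) * F (z \<otimes> a [^] j))) / (real n)\<^sup>2"
    proof (intro arg_cong[where f = "\<lambda>x. x / _"] sum.cong refl)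
      fix i j :: nat
      have "\<xi> (a [^] i \<otimes> inv (a [^] j)) = 1"
        using a pd_inv[OF \<xi>(1)] \<open>\<xi> a = 1\<close> by (simp add: mult pow)
      then show "Re (of_real (corr F (a [^] i \<otimes> inv (a [^] j))) * \<xi> (a [^] i \<otimes> inv (a [^] j))) =
          mean (\<lambda>z. F (z \<otimes> a [^] i) * F (z \<otimes> a [^] j))"
        using corr_mult_inv[OF F, of "a [^] i" "a [^] j"] a by simp
    qed
    also have "(\<Sum>i<n. \<Sum>j<n. mean (\<lambda>z. F (z \<otimes> a [^] i) * F (z \<otimes> a [^] j))) =
        mean (\<lambda>z. \<Sum>i<n. \<Sum>j<n. F (z \<otimes> a [^] i) * F (z \<otimes> a [^] j))"
    proof -
      have "cont (\<lambda>z. F (z \<otimes> a [^] i) * F (z \<otimes> a [^] j))" for i j :: nat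
        using a by (intro continuous_map_real_mult cont_translate[OF F]) auto
      then show ?thesis by (simp add: mean_sum continuous_map_sum)
    qed
    also have "\<dots> \<le> mean (\<lambda>_. (2 * B)\<^sup>2)"
    proof (rule mean_mono)
      show "cont (\<lambda>z. \<Sum>i<n. \<Sum>j<n. F (z \<otimes> a [^] i) * F (z \<otimes> a [^] j))"
        using a by (intro continuous_map_sum continuous_map_real_mult cont_translate[OF F]) auto
      fix z assume z: "z \<in> carrier G"
      have "(\<Sum>i<n. F (z \<otimes> a [^] i)) = f (z \<otimes> a [^] n) - f z"
      proof -
        have "F (z \<otimes> a [^] i) = f (z \<otimes> a [^] Suc i) - f (z \<otimes> a [^] i)" for i :: nat
          using z a by (simp add: F_def m_assoc)
        then have "(\<Sum>i<n. F (z \<otimes> a [^] i)) = (\<Sum>i<n. f (z \<otimes> a [^] Suc i) - f (z \<otimes> a [^] i))"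
          by (simp only:)
        also have "\<dots> = f (z \<otimes> a [^] n) - f (z \<otimes> a [^] (0::nat))" by (rule sum_lessThan_telescope)
        finally show ?thesis using z by simp
      qed
      moreover have "\<bar>f (z \<otimes> a [^] n)\<bar> \<le> B" "\<bar>f z\<bar> \<le> B" using B(2) z a by auto
      ultimately have "\<bar>\<Sum>i<n. F (z \<otimes> a [^] i)\<bar> \<le> 2 * B" by linarith
      then have "\<bar>\<Sum>i<n. F (z \<otimes> a [^] i)\<bar>\<^sup>2 \<le> (2 * B)\<^sup>2" by (intro power_mono) auto
      then show "(\<Sum>i<n. \<Sum>j<n. F (z \<otimes> a [^] i) * F (z \<otimes> a [^] j)) \<le> (2 * B)\<^sup>2"
        by (simp add: power2_eq_square sum_product)
    qed simp
    finally have "s \<le> (2 * B)\<^sup>2 / (real n)\<^sup>2" by (simp add: divide_right_mono)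
    then have "s * (real n)\<^sup>2 \<le> 4 * B\<^sup>2" using n0 by (simp add: field_simps)
    moreover have "4 * B\<^sup>2 < s * real n" using n s by (simp add: field_simps)
    moreover have "s * real n \<le> s * (real n)\<^sup>2" using s n0 by (auto simp: power2_eq_square)
    ultimately show False by linarith
  qed
  define \<eta> where "\<eta> = restrict \<xi> (carrier G)"
  have "continuous_map T circle_topology \<eta>"
    unfolding circle_topology_def continuous_map_in_subtopology
  proof
    show "continuous_map T euclidean \<eta>"
      by (rule continuous_map_eq[OF cont]) (simp add: \<eta>_def topspace_eq_carrier)
  qed (use norm in \<open>auto simp: \<eta>_def topspace_eq_carrier\<close>)
  then have "\<eta> \<in> characters G T"
    using norm by (auto simp: characters_def continuous_maps_def hom_def circle_group_def \<eta>_def mult topspace_eq_carrier)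
  with \<open>\<xi> a \<noteq> 1\<close> a show thesis by (intro that[of \<eta>]) (auto simp: \<eta>_def)
qed

end

section \<open>Systems of equations for characters\<close>

text \<open>With \<open>r\<close> the n-th root of \<open>\<theta>\<close>, the expression is the
  n-th power of (N + 1) r^N, which tends to 0.\<close>

lemma poly_times_power_lt_one:
  fixes \<theta> :: real
  assumes "0 \<le> \<theta>" "\<theta> < 1"
  obtains N :: nat where "(real N + 1) ^ n * \<theta> ^ N < 1"
proof (cases "n = 0")
  case True
  then show ?thesis using assms that[of 1] by simp
next
  case False
  define r where "r = root n \<theta>"
  have r: "0 \<le> r" "r < 1" "r ^ n = \<theta>"
    using assms False by (auto simp: r_def real_root_lt_1_iff)
  have "(\<lambda>N. real N * r ^ N + r ^ N) \<longlonglongrightarrow> 0 + 0"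
    using r by (intro tendsto_add powser_times_n_limit_0 LIMSEQ_power_zero) auto
  then have "\<forall>\<^sub>F N in sequentially. real N * r ^ N + r ^ N < 1"
    by (rule order_tendstoD(2)) simp
  then obtain N where N: "real N * r ^ N + r ^ N < 1" by (auto simp: eventually_sequentially)
  have "(real N + 1) ^ n * \<theta> ^ N = ((real N + 1) * r ^ N) ^ n"
    by (simp add: power_mult_distrib r(3)[symmetric] power_mult[symmetric] mult.commute)
  also have "\<dots> < 1"
    using N r False by (intro power_less_one_iff[THEN iffD2]) (auto simp: algebra_simps)
  finally show thesis by (rule that)
qed

lemma unit_powi_neg: "cmod z = 1 \<Longrightarrow> z powi (- int n) = cnj z ^ n"
proof -
  assume "cmod z = 1"
  then have "z * cnj z = 1" using complex_norm_square[of z] by simp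
  then have "inverse z = cnj z" by (rule inverse_unique)
  then show ?thesis by (simp add: power_int_minus power_inverse[symmetric])
qed

lemma continuous_map_complex_mult:
  fixes f g :: "'b \<Rightarrow> complex"
  assumes "continuous_map X euclidean f" "continuous_map X euclidean g"
  shows "continuous_map X euclidean (\<lambda>x. f x * g x)"
proof -
  have "continuous_map X (prod_topology euclidean euclidean) (\<lambda>x. (f x, g x))"
    by (intro continuous_map_pairedI assms)
  then have "continuous_map X euclidean ((\<lambda>z. fst z * snd z) \<circ> (\<lambda>x. (f x, g x)))"
    by (rule continuous_map_compose)
      (auto intro!: continuous_on_mult continuous_on_fst continuous_on_snd continuous_on_id)
  then show ?thesis by (simp add: o_def)
qed

section \<open>Orthogonality of characters and solvability of systems\<close>

context compact_abelian_group
begin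

text \<open>In contrast to \<open>characters\<close>, values off the carrier are arbitrary, so that
  products and powers can be formed pointwise.\<close>

definition unitary_character :: "('a \<Rightarrow> complex) \<Rightarrow> bool" where
  "unitary_character \<xi> \<longleftrightarrow> continuous_map T euclidean \<xi> \<and> (\<forall>x\<in>carrier G. cmod (\<xi> x) = 1) \<and>
     (\<forall>x\<in>carrier G. \<forall>y\<in>carrier G. \<xi> (x \<otimes> y) = \<xi> x * \<xi> y)"

lemma unitary_character_one: "unitary_character \<xi> \<Longrightarrow> \<xi> \<one> = 1"
proof -
  assume \<xi>: "unitary_character \<xi>"
  then have "\<xi> \<one> * \<xi> \<one> = \<xi> \<one> * 1" "\<xi> \<one> \<noteq> 0"
    using l_one[OF one_closed] unfolding unitary_character_def by (metis mult.right_neutral one_closed, force)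
  then show ?thesis by simp
qed

lemma unitary_character_const_one: "unitary_character (\<lambda>_. 1)"
  by (simp add: unitary_character_def)

lemma unitary_character_mult:
  "unitary_character \<xi> \<Longrightarrow> unitary_character \<eta> \<Longrightarrow> unitary_character (\<lambda>x. \<xi> x * \<eta> x)"
  unfolding unitary_character_def by (auto simp: norm_mult intro!: continuous_map_complex_mult)

lemma unitary_character_cnj: "unitary_character \<xi> \<Longrightarrow> unitary_character (\<lambda>x. cnj (\<xi> x))"
proof -
  assume \<xi>: "unitary_character \<xi>"
  then have "continuous_map T euclidean (cnj \<circ> \<xi>)"
    by (intro continuous_map_compose[of _ euclidean]) (auto simp: unitary_character_def intro: continuous_intros)
  then show ?thesis using \<xi> by (simp add: unitary_character_def o_def)
qed

lemma unitary_character_power: "unitary_character \<xi> \<Longrightarrow> unitary_character (\<lambda>x. \<xi> x ^ n)"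
  by (induction n) (auto intro: unitary_character_mult unitary_character_const_one)

lemma unitary_character_cong:
  assumes "unitary_character \<xi>" "\<And>x. x \<in> carrier G \<Longrightarrow> \<xi> x = \<eta> x"
  shows "unitary_character \<eta>"
  using assms continuous_map_eq[of T euclidean \<xi> \<eta>] by (auto simp: unitary_character_def topspace_eq_carrier)

lemma unitary_character_powi:
  assumes \<xi>: "unitary_character \<xi>"
  shows "unitary_character (\<lambda>x. \<xi> x powi k)"
proof (cases k rule: int_cases2)
  case (nonneg n)
  then show ?thesis using unitary_character_power[OF \<xi>, of n] by simp
next
  case (nonpos n)
  show ?thesis
    unfolding nonpos
    by (rule unitary_character_cong[OF unitary_character_power[OF unitary_character_cnj[OF \<xi>], of n]])
      (use \<xi> in \<open>simp add: unit_powi_neg unitary_character_def\<close>)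
qed

lemma unitary_character_prod:
  "(\<And>i. i \<in> F \<Longrightarrow> unitary_character (\<xi> i)) \<Longrightarrow> unitary_character (\<lambda>x. \<Prod>i\<in>F. \<xi> i x)"
proof (induction F rule: infinite_finite_induct)
  case (insert i F)
  then show ?case by (simp add: unitary_character_mult)
qed (simp_all add: unitary_character_const_one)

lemma cont_Re_unitary_character: "unitary_character \<xi> \<Longrightarrow> cont (\<lambda>x. Re (u * \<xi> x))"
proof -
  assume \<xi>: "unitary_character \<xi>"
  have "continuous_map T euclideanreal ((\<lambda>z. Re (u * z)) \<circ> \<xi>)"
    by (rule continuous_map_compose[of _ euclidean]) (use \<xi> in \<open>auto simp: unitary_character_def intro!: continuous_intros\<close>)
  then show ?thesis by (simp add: o_def)
qed

text \<open>Translation by \<open>g\<close> multiplies \<open>\<xi>\<close> by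
  \<open>\<xi> g\<close> and keeps the mean. Writing \<open>u\<close> as v (\<xi>(g) - 1) turns the
  mean into a difference of equal terms.\<close>

lemma mean_nontrivial_character:
  assumes \<xi>: "unitary_character \<xi>" and g: "g \<in> carrier G" "\<xi> g \<noteq> 1"
  shows "mean (\<lambda>x. Re (u * \<xi> x)) = 0"
proof -
  note c = cont_Re_unitary_character[OF \<xi>]
  define v where "v = u / (\<xi> g - 1)"
  have "v * \<xi> g - v = v * (\<xi> g - 1)" by (simp add: right_diff_distrib)
  then have v: "u = v * \<xi> g - v" using g by (simp add: v_def)
  have "mean (\<lambda>x. Re ((v * \<xi> g) * \<xi> x)) = mean (\<lambda>x. Re (v * \<xi> (x \<otimes> g)))"
    by (rule mean_cong[OF c cont_translate[OF c g(1)]])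
      (use \<xi> g in \<open>simp add: unitary_character_def mult.commute mult.left_commute\<close>)
  also have "\<dots> = mean (\<lambda>x. Re (v * \<xi> x))" by (rule mean_translate[OF c g(1)])
  finally have 1: "mean (\<lambda>x. Re ((v * \<xi> g) * \<xi> x)) = mean (\<lambda>x. Re (v * \<xi> x))" .
  have "mean (\<lambda>x. Re ((v * \<xi> g) * \<xi> x)) = mean (\<lambda>x. Re (u * \<xi> x) + Re (v * \<xi> x))"
    by (rule arg_cong[where f = mean]) (simp add: fun_eq_iff v left_diff_distrib del: times_complex.sel)
  also have "\<dots> = mean (\<lambda>x. Re (u * \<xi> x)) + mean (\<lambda>x. Re (v * \<xi> x))" by (rule mean_add[OF c c])
  finally show ?thesis using 1 by simp
qed

text \<open>If no \<open>h\<close> solved the system, \<open>\<bar>\<Prod>\<^sub>i (1 + \<xi>\<^sub>i(h) / f\<^sub>i) / 2\<bar>\<^sup>2\<close> would be bounded by some \<open>\<theta> < 1\<close>. Expanding the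
  \<open>N\<close>-th power, the mean of every mixed term is \<open>0\<close> or \<open>1\<close>, and the diagonal terms alone contribute
  at least \<open>(N + 1)\<^sup>-\<^sup>n\<close>, which exceeds \<open>\<theta>\<^sup>N\<close> for large \<open>N\<close>.\<close>

lemma finite_character_system:
  fixes \<xi> :: "'i \<Rightarrow> 'a \<Rightarrow> complex"
  assumes F: "finite F" and \<xi>: "\<And>i. i \<in> F \<Longrightarrow> unitary_character (\<xi> i)"
    and f: "\<And>i. i \<in> F \<Longrightarrow> cmod (f i) = 1"
    and rel: "\<And>n :: 'i \<Rightarrow> int. (\<forall>x\<in>carrier G. (\<Prod>i\<in>F. \<xi> i x powi n i) = 1) \<Longrightarrow> (\<Prod>i\<in>F. f i powi n i) = 1"
  obtains h where "h \<in> carrier G" "\<And>i. i \<in> F \<Longrightarrow> \<xi> i h = f i"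
proof (rule ccontr)
  assume "\<not> thesis"
  then have none: "\<exists>i\<in>F. \<xi> i h \<noteq> f i" if "h \<in> carrier G" for h using that \<open>\<not> thesis\<close> \<open>h \<in> carrier G\<close>
    by (metis \<open>\<And>h. \<lbrakk>h \<in> carrier G; \<And>i. i \<in> F \<Longrightarrow> \<xi> i h = f i\<rbrakk> \<Longrightarrow> thesis\<close>)
  define z where "z = (\<lambda>i h. \<xi> i h * cnj (f i))"
  have z1: "cmod (z i h) = 1" if "i \<in> F" "h \<in> carrier G" for i h
    using \<xi>[OF that(1)] f[OF that(1)] that(2) by (simp add: z_def norm_mult unitary_character_def)
  define q where "q = (\<lambda>h. (\<Prod>i\<in>F. (cmod (1 + z i h) / 2)\<^sup>2))"
  have q_ge: "0 \<le> q h" for h unfolding q_def by (intro prod_nonneg) auto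
  have q_less: "q h < 1" if h: "h \<in> carrier G" for h
  proof -
    obtain i where i: "i \<in> F" "\<xi> i h \<noteq> f i" using none[OF h] by blast
    have le: "(cmod (1 + z j h) / 2)\<^sup>2 \<le> 1" if "j \<in> F" for j
      using norm_triangle_ineq[of 1 "z j h"] z1[OF that h] by (intro power_le_one) auto
    have ff: "f i * cnj (f i) = 1" using complex_norm_square[of "f i"] f[OF i(1)] by simp
    have "z i h \<noteq> 1"
    proof
      assume "z i h = 1"
      then have "f i * (\<xi> i h * cnj (f i)) = f i" by (simp add: z_def)
      then have "\<xi> i h * (f i * cnj (f i)) = f i" by (simp add: mult_ac)
      then show False using i ff by simp
    qed
    have "(cmod (1 + z i h))\<^sup>2 = 2 + 2 * Re (z i h)"
    proof -
      have "(Re (z i h))\<^sup>2 + (Im (z i h))\<^sup>2 = 1"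
        using z1[OF i(1) h] cmod_power2[of "z i h"] by simp
      then show ?thesis unfolding cmod_power2 by (simp add: power2_eq_square algebra_simps)
    qed
    moreover have "Re (z i h) < 1"
    proof (rule ccontr)
      assume "\<not> Re (z i h) < 1"
      moreover have "Re (z i h) \<le> 1" using complex_Re_le_cmod[of "z i h"] z1[OF i(1) h] by simp
      ultimately have "Re (z i h) = 1" by simp
      moreover then have "Im (z i h) = 0"
        using z1[OF i(1) h] cmod_power2[of "z i h"] by simp
      ultimately show False using \<open>z i h \<noteq> 1\<close> by (simp add: complex_eq_iff)
    qed
    ultimately have lt: "(cmod (1 + z i h) / 2)\<^sup>2 < 1" by (simp add: power_divide)
    have "q h = (cmod (1 + z i h) / 2)\<^sup>2 * (\<Prod>j\<in>F - {i}. (cmod (1 + z j h) / 2)\<^sup>2)"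
      unfolding q_def by (rule prod.remove[OF F i(1)])
    also have "\<dots> \<le> (cmod (1 + z i h) / 2)\<^sup>2 * 1"
      using le by (intro mult_left_mono prod_le_1) auto
    finally show ?thesis using lt by simp
  qed
  have contz: "continuous_map T euclidean (z i)" if "i \<in> F" for i
    using \<xi>[OF that] unfolding z_def unitary_character_def by (auto intro!: continuous_map_complex_mult)
  have contq: "cont q"
  proof -
    have "cont (\<lambda>h. (cmod (1 + z i h) / 2)\<^sup>2)" if "i \<in> F" for i
    proof -
      have "cont ((\<lambda>w. (cmod (1 + w) / 2)\<^sup>2) \<circ> z i)"
        by (rule continuous_map_compose[OF contz[OF that]]) (auto intro!: continuous_intros)
      then show ?thesis by (simp add: o_def)
    qed
    then show ?thesis unfolding q_def using F by (intro continuous_map_prod) auto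
  qed
  have "compact (q ` carrier G)" "q ` carrier G \<noteq> {}"
    using image_compactin[OF _ contq, of "carrier G"] compact one_closed
    by (auto simp: compact_space_def topspace_eq_carrier)
  then obtain \<theta> where \<theta>: "\<theta> \<in> q ` carrier G" "\<And>h. h \<in> carrier G \<Longrightarrow> q h \<le> \<theta>"
    using compact_attains_sup[of "q ` carrier G"] by blast
  then have \<theta>01: "0 \<le> \<theta>" "\<theta> < 1" using q_ge q_less by auto
  then obtain N where N: "(real N + 1) ^ card F * \<theta> ^ N < 1" by (rule poly_times_power_lt_one)
  define P where "P = PiE F (\<lambda>_. {..N})"
  define c where "c = (\<lambda>a. \<Prod>i\<in>F. real (N choose a i))"
  define Z where "Z = (\<lambda>a h. \<Prod>i\<in>F. z i h ^ a i)"
  \<comment> \<open>The denominators 2 are left out here. They return as the factor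
    \<open>4 ^ card F\<close> for each of the \<open>N\<close> powers of the squared
    product.\<close>
  define R where "R = (\<lambda>h. \<Prod>i\<in>F. (1 + z i h) ^ N)"
  have finP: "finite P" unfolding P_def using F by (intro finite_PiE) auto
  have R_eq: "R h = (\<Sum>a\<in>P. of_real (c a) * Z a h)" for h
  proof -
    have "(1 + z i h) ^ N = (\<Sum>k\<le>N. of_nat (N choose k) * z i h ^ k)" for i
      using binomial_ring[of "z i h" 1 N] by (simp add: add.commute)
    then have "R h = (\<Prod>i\<in>F. \<Sum>k\<le>N. of_nat (N choose k) * z i h ^ k)" by (simp add: R_def)
    also have "\<dots> = (\<Sum>a\<in>P. \<Prod>i\<in>F. of_nat (N choose a i) * z i h ^ a i)"
      unfolding P_def using F by (intro prod_sum_PiE) auto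
    finally show ?thesis by (simp add: c_def Z_def prod.distrib)
  qed
  define t where "t = (\<lambda>a a' h. Re (Z a h * cnj (Z a' h)))"
  have t: "cont (t a a') \<and> mean (t a a') \<ge> (if a = a' then 1 else 0)" for a a'
  proof -
    define n where "n = (\<lambda>i. int (a i) - int (a' i))"
    define \<eta> where "\<eta> = (\<lambda>h. \<Prod>i\<in>F. \<xi> i h powi n i)"
    have \<eta>: "unitary_character \<eta>"
      unfolding \<eta>_def by (intro unitary_character_prod unitary_character_powi \<xi>)
    define u where "u = cnj (\<Prod>i\<in>F. f i powi n i)"
    have t_eq: "t a a' h = Re (u * \<eta> h)" if h: "h \<in> carrier G" for h
    proof -
      have "z i h ^ a i * cnj (z i h ^ a' i) = \<xi> i h powi n i * cnj (f i powi n i)" if i: "i \<in> F" for i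
      proof -
        have nz: "z i h \<noteq> 0" using z1[OF i h] by auto
        have "cnj (z i h ^ a' i) = z i h powi (- int (a' i))" using unit_powi_neg[OF z1[OF i h]] by simp
        then have "z i h ^ a i * cnj (z i h ^ a' i) = z i h powi n i"
          using nz by (simp add: n_def power_int_diff power_int_minus divide_inverse)
        also have "\<dots> = \<xi> i h powi n i * cnj (f i) powi n i" by (simp add: z_def power_int_mult_distrib)
        finally show ?thesis by (simp add: power_int_def)
      qed
      then have "Z a h * cnj (Z a' h) = \<eta> h * u"
        by (simp add: Z_def \<eta>_def u_def prod.distrib[symmetric])
      then show ?thesis unfolding t_def by (simp add: mult.commute)
    qed
    have cu: "cont (\<lambda>h. Re (u * \<eta> h))" by (rule cont_Re_unitary_character[OF \<eta>])
    have ct: "cont (t a a')" by (rule continuous_map_eq[OF cu]) (simp add: t_eq topspace_eq_carrier)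
    have mt: "mean (t a a') = mean (\<lambda>h. Re (u * \<eta> h))" by (rule mean_cong[OF ct cu t_eq])
    show ?thesis
    \<comment> \<open>If the mixed term belongs to the trivial character, the hypothesis on
      relations gives the targets the same relation, so \<open>u = 1\<close>. Otherwise
      orthogonality gives mean 0.\<close>
    proof (cases "\<forall>h\<in>carrier G. \<eta> h = 1")
      case True
      then have "u = 1" using rel[of n] by (simp add: u_def \<eta>_def)
      have "mean (\<lambda>h. Re (u * \<eta> h)) = mean (\<lambda>_. 1)"
        by (rule mean_cong[OF cu]) (use True \<open>u = 1\<close> in auto)
      then show ?thesis using ct mt by simp
    next
      case False
      then have "a \<noteq> a'" by (auto simp: \<eta>_def n_def)
      moreover have "mean (\<lambda>h. Re (u * \<eta> h)) = 0" using False mean_nontrivial_character[OF \<eta>] by blast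
      ultimately show ?thesis using ct mt by simp
    qed
  qed
  have R2: "(cmod (R h))\<^sup>2 = (\<Sum>a\<in>P. \<Sum>a'\<in>P. c a * c a' * t a a' h)" for h
  proof -
    have "of_real ((cmod (R h))\<^sup>2) = R h * cnj (R h)" using complex_norm_square[of "R h"] by simp
    also have "\<dots> = (\<Sum>a\<in>P. \<Sum>a'\<in>P. of_real (c a * c a') * (Z a h * cnj (Z a' h)))"
      unfolding R_eq by (simp add: sum_product mult_ac)
    finally have "Re (of_real ((cmod (R h))\<^sup>2)) = Re (\<Sum>a\<in>P. \<Sum>a'\<in>P. of_real (c a * c a') * (Z a h * cnj (Z a' h)))"
      by (rule arg_cong)
    moreover have "Re (of_real r * w) = r * Re w" for r w by simp
    ultimately show ?thesis unfolding t_def by (simp only: Re_sum Re_complex_of_real)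
  qed
  have c0: "c a \<ge> 0" for a unfolding c_def by (intro prod_nonneg) auto
  have "(\<Sum>a\<in>P. (c a)\<^sup>2) = (\<Sum>a\<in>P. \<Sum>a'\<in>P. c a * c a' * (if a = a' then 1 else 0))"
    using finP by (simp add: power2_eq_square if_distrib cong: if_cong)
  also have "\<dots> \<le> (\<Sum>a\<in>P. \<Sum>a'\<in>P. c a * c a' * mean (t a a'))"
    using t c0 by (intro sum_mono mult_left_mono) auto
  also have "\<dots> = mean (\<lambda>h. (cmod (R h))\<^sup>2)"
    unfolding R2 using t finP
    by (simp add: mean_sum mean_cmult continuous_map_sum continuous_map_real_mult)
  also have "\<dots> \<le> mean (\<lambda>_. (4 ^ card F * \<theta>) ^ N)"
  proof (rule mean_mono)
    show "cont (\<lambda>h. (cmod (R h))\<^sup>2)"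
      unfolding R2 using t finP by (intro continuous_map_sum continuous_map_real_mult) auto
    fix h assume h: "h \<in> carrier G"
    have "(cmod (R h))\<^sup>2 = (\<Prod>i\<in>F. 4 * (cmod (1 + z i h) / 2)\<^sup>2) ^ N"
      by (simp add: R_def prod_norm[symmetric] norm_power power_divide prod_power_distrib[symmetric] power_mult[symmetric] mult.commute)
    also have "\<dots> = (4 ^ card F * q h) ^ N" by (simp add: prod.distrib q_def)
    also have "\<dots> \<le> (4 ^ card F * \<theta>) ^ N" using \<theta>(2)[OF h] q_ge by (intro power_mono mult_left_mono) auto
    finally show "(cmod (R h))\<^sup>2 \<le> (4 ^ card F * \<theta>) ^ N" .
  qed simp
  finally have 1: "(\<Sum>a\<in>P. (c a)\<^sup>2) \<le> (4 ^ card F * \<theta>) ^ N" by simp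
  have "(\<Sum>a\<in>P. c a) = (\<Prod>i\<in>F. \<Sum>k\<le>N. real (N choose k))"
    unfolding P_def c_def using F by (intro prod_sum_PiE[symmetric]) auto
  also have "\<dots> = (2 ^ N) ^ card F"
  proof -
    have "(\<Sum>k\<le>N. real (N choose k)) = 2 ^ N"
      using choose_row_sum[of N] by (metis of_nat_numeral of_nat_power of_nat_sum)
    then show ?thesis by simp
  qed
  finally have sum_c: "(\<Sum>a\<in>P. c a) = (2 ^ N) ^ card F" .
  have "(4::real) = 2 ^ 2" by simp
  then have "(\<Sum>a\<in>P. c a)\<^sup>2 = (4 ^ card F) ^ N"
    unfolding sum_c by (metis power_mult mult.commute)
  \<comment> \<open>Cauchy-Schwarz against the constant 1 bounds the diagonal from below: with n =
    card F, the coefficients sum to 2^(N n) over (N + 1)^n multi-indices.\<close>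
  moreover have "(\<Sum>a\<in>P. c a)\<^sup>2 \<le> real (card P) * (\<Sum>a\<in>P. (c a)\<^sup>2)"
    using Cauchy_Schwarz_ineq_sum[of "\<lambda>_. 1" c P] by simp
  moreover have "real (card P) = (real N + 1) ^ card F"
    unfolding P_def using F by (simp add: card_PiE add.commute)
  ultimately have "(4 ^ card F) ^ N \<le> (real N + 1) ^ card F * (4 ^ card F * \<theta>) ^ N"
    using 1 by (smt (verit) mult_left_mono of_nat_0_le_iff)
  then have "(4 ^ card F) ^ N * 1 \<le> (4 ^ card F) ^ N * ((real N + 1) ^ card F * \<theta> ^ N)"
    by (simp add: power_mult_distrib mult_ac)
  then have "1 \<le> (real N + 1) ^ card F * \<theta> ^ N"
    by (subst (asm) mult_le_cancel_left_pos) auto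
  then show False using N by simp
qed

text \<open>The solution set of each equation is closed, so the finite case and compactness
  suffice.\<close>

lemma character_system:
  fixes \<xi> :: "'i \<Rightarrow> 'a \<Rightarrow> complex"
  assumes \<xi>: "\<And>i. i \<in> I \<Longrightarrow> unitary_character (\<xi> i)"
    and f: "\<And>i. i \<in> I \<Longrightarrow> cmod (f i) = 1"
    and rel: "\<And>F n. finite F \<Longrightarrow> F \<subseteq> I \<Longrightarrow> (\<forall>x\<in>carrier G. (\<Prod>i\<in>F. \<xi> i x powi n i) = 1)
      \<Longrightarrow> (\<Prod>i\<in>F. f i powi (n i :: int)) = 1"
  obtains h where "h \<in> carrier G" "\<And>i. i \<in> I \<Longrightarrow> \<xi> i h = f i"
proof (cases "I = {}")
  case True
  then show ?thesis using that[of \<one>] by auto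
next
  case False
  define A where "A = (\<lambda>i. {h \<in> topspace T. \<xi> i h \<in> {f i}})"
  have "\<Inter> (A ` I) \<noteq> {}"
  proof (rule compact_space_fip[THEN iffD1, OF compact, rule_format, of "A ` I"], intro conjI ballI allI impI)
    fix C assume "C \<in> A ` I"
    then obtain i where i: "i \<in> I" "C = A i" by blast
    have "continuous_map T euclidean (\<xi> i)" using \<xi>[OF i(1)] by (simp add: unitary_character_def)
    from closedin_continuous_map_preimage[OF this, of "{f i}"]
    show "closedin T C" unfolding i A_def by simp
  next
    fix \<F> assume "finite \<F> \<and> \<F> \<subseteq> A ` I"
    then obtain F where F: "F \<subseteq> I" "finite F" "\<F> = A ` F" by (meson finite_subset_image)
    obtain h where "h \<in> carrier G" "\<And>i. i \<in> F \<Longrightarrow> \<xi> i h = f i"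
      by (rule finite_character_system[OF F(2), of \<xi> f]) (use F \<xi> f rel[OF F(2,1)] in \<open>auto\<close>)
    then show "\<Inter> \<F> \<noteq> {}" unfolding F A_def by (auto simp: topspace_eq_carrier)
  qed
  then obtain h where h: "\<And>i. i \<in> I \<Longrightarrow> h \<in> A i" by blast
  then have "h \<in> carrier G" using False by (auto simp: A_def topspace_eq_carrier)
  then show thesis using h that by (simp add: A_def)
qed

end

section \<open>Independent characters\<close>

lemma prod_powi_union:
  fixes z :: "'i \<Rightarrow> 'c::field"
  assumes "finite F" "finite F'" "\<And>i. i \<in> F \<union> F' \<Longrightarrow> z i \<noteq> 0"
  shows "(\<Prod>i\<in>F \<union> F'. z i powi ((if i \<in> F then n i else 0) + (if i \<in> F' then n' i else 0))) =
    (\<Prod>i\<in>F. z i powi n i) * (\<Prod>i\<in>F'. z i powi n' i)"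
proof -
  have "(\<Prod>i\<in>F \<union> F'. z i powi ((if i \<in> F then n i else 0) + (if i \<in> F' then n' i else 0))) =
      (\<Prod>i\<in>F \<union> F'. z i powi (if i \<in> F then n i else 0)) * (\<Prod>i\<in>F \<union> F'. z i powi (if i \<in> F' then n' i else 0))"
    using assms(3) by (simp add: power_int_add prod.distrib)
  also have "(\<Prod>i\<in>F \<union> F'. z i powi (if i \<in> F then n i else 0)) = (\<Prod>i\<in>F. z i powi n i)"
    using assms by (intro prod.mono_neutral_cong_right) auto
  also have "(\<Prod>i\<in>F \<union> F'. z i powi (if i \<in> F' then n' i else 0)) = (\<Prod>i\<in>F'. z i powi n' i)"
    using assms by (intro prod.mono_neutral_cong_right) auto
  finally show ?thesis .
qed

lemma prod_powi_uminus:
  fixes z :: "'i \<Rightarrow> 'c::field"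
  shows "(\<Prod>i\<in>F. z i powi (- n i)) = inverse (\<Prod>i\<in>F. z i powi n i)"
  by (simp add: power_int_minus prod_inversef[symmetric])

lemma powi_eq_one_dvd:
  fixes z :: "'c::field"
  assumes "z ^ m = 1" "z \<noteq> 0" "int m dvd k"
  shows "z powi k = 1"
  using assms by (auto simp: power_int_mult)

context compact_abelian_group
begin

lemma characters_iff: "\<xi> \<in> characters G T \<longleftrightarrow> unitary_character \<xi> \<and> \<xi> \<in> extensional (carrier G)"
  by (auto simp: characters_def hom_def continuous_maps_def circle_group_def circle_topology_def
      unitary_character_def continuous_map_in_subtopology topspace_eq_carrier Pi_iff)

lemma restrict_character: "unitary_character \<xi> \<Longrightarrow> restrict \<xi> (carrier G) \<in> characters G T"
  by (auto simp: characters_iff intro: unitary_character_cong)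

lemma character_eqI:
  "\<xi> \<in> characters G T \<Longrightarrow> \<eta> \<in> characters G T \<Longrightarrow> (\<And>x. x \<in> carrier G \<Longrightarrow> \<xi> x = \<eta> x) \<Longrightarrow> \<xi> = \<eta>"
  by (auto simp: characters_iff intro: extensionalityI)

lemma character_cmod: "\<xi> \<in> characters G T \<Longrightarrow> x \<in> carrier G \<Longrightarrow> cmod (\<xi> x) = 1"
  by (simp add: characters_iff unitary_character_def)

lemma character_nz: "\<xi> \<in> characters G T \<Longrightarrow> x \<in> carrier G \<Longrightarrow> \<xi> x \<noteq> 0"
  using character_cmod[of \<xi> x] by auto

text \<open>For \<open>k = 0\<close> these are all characters, so that one parameter
  \<open>m\<close> can cover independence over the integers and over the integers modulo
  \<open>m\<close>.\<close>

definition torsion_characters :: "nat \<Rightarrow> ('a \<Rightarrow> complex) set" where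
  "torsion_characters k = {\<xi> \<in> characters G T. \<forall>x\<in>carrier G. \<xi> x ^ k = 1}"

definition combo :: "('a \<Rightarrow> complex) set \<Rightarrow> (('a \<Rightarrow> complex) \<Rightarrow> int) \<Rightarrow> 'a \<Rightarrow> complex" where
  "combo F n = (\<lambda>x\<in>carrier G. \<Prod>\<xi>\<in>F. \<xi> x powi n \<xi>)"

definition char_span :: "('a \<Rightarrow> complex) set \<Rightarrow> ('a \<Rightarrow> complex) set" where
  "char_span B = {combo F n | F n. finite F \<and> F \<subseteq> B}"

lemma countable_char_span:
  assumes "countable B"
  shows "countable (char_span B)"
proof -
  have "char_span B \<subseteq> (\<Union>F\<in>{F. finite F \<and> F \<subseteq> B}. combo F ` (PiE F (\<lambda>_. UNIV)))"
  proof
    fix y assume "y \<in> char_span B"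
    then obtain F n where F: "finite F" "F \<subseteq> B" "y = combo F n" by (auto simp: char_span_def)
    then have "y = combo F (restrict n F)" by (auto simp: combo_def intro!: prod.cong)
    then show "y \<in> (\<Union>F\<in>{F. finite F \<and> F \<subseteq> B}. combo F ` (PiE F (\<lambda>_. UNIV)))" using F by auto
  qed
  moreover have "countable (\<Union>F\<in>{F. finite F \<and> F \<subseteq> B}. combo F ` (PiE F (\<lambda>_. UNIV :: int set)))"
    using countable_Collect_finite_subset[OF assms] by (intro countable_UN countable_image countable_PiE) auto
  ultimately show ?thesis by (rule countable_subset)
qed

text \<open>For \<open>m = 0\<close> divisibility by \<open>m\<close> means that the exponent is 0,
  which is linear independence over the integers.\<close>

definition independent :: "nat \<Rightarrow> ('a \<Rightarrow> complex) set \<Rightarrow> bool" where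
  "independent m B \<longleftrightarrow> B \<subseteq> torsion_characters m \<and>
     (\<forall>F n. finite F \<longrightarrow> F \<subseteq> B \<longrightarrow> (\<forall>x\<in>carrier G. combo F n x = 1) \<longrightarrow> (\<forall>\<xi>\<in>F. int m dvd n \<xi>))"

lemma independentD:
  "independent m B \<Longrightarrow> finite F \<Longrightarrow> F \<subseteq> B \<Longrightarrow> (\<And>x. x \<in> carrier G \<Longrightarrow> combo F n x = 1) \<Longrightarrow> \<xi> \<in> F \<Longrightarrow> int m dvd n \<xi>"
  unfolding independent_def by blast

lemma independent_subset: "independent m B \<Longrightarrow> B' \<subseteq> B \<Longrightarrow> independent m B'"
  unfolding independent_def by (meson order_trans)

text \<open>Two members of the fibre differ by a character whose k-th and m-th powers are trivial.
  It is killed by the remainder of \<open>k\<close> modulo \<open>m\<close>, which is positive and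
  below \<open>m\<close>, or by the absolute value of \<open>k\<close> if \<open>m = 0\<close>. By
  assumption there are only countably many such characters.\<close>

lemma countable_power_fiber:
  assumes m: "\<And>j. 0 < j \<Longrightarrow> m = 0 \<or> j < m \<Longrightarrow> countable (torsion_characters j)" and k: "\<not> int m dvd k"
  shows "countable {\<xi> \<in> torsion_characters m. \<forall>x\<in>carrier G. \<xi> x powi k = y x}"
proof (cases "{\<xi> \<in> torsion_characters m. \<forall>x\<in>carrier G. \<xi> x powi k = y x} = {}")
  case False
  let ?S = "{\<xi> \<in> torsion_characters m. \<forall>x\<in>carrier G. \<xi> x powi k = y x}"
  obtain \<xi>0 where \<xi>0: "\<xi>0 \<in> ?S" using False by blast
  then have X0: "\<xi>0 \<in> characters G T" by (simp add: torsion_characters_def)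
  define \<Phi> where "\<Phi> = (\<lambda>\<xi>. \<lambda>x\<in>carrier G. \<xi> x * cnj (\<xi>0 x))"
  define j where "j = (if m = 0 then nat \<bar>k\<bar> else nat (k mod int m))"
  have j: "0 < j" "m = 0 \<or> j < m"
  proof -
    have "k mod int m \<noteq> 0" using k by (simp add: dvd_eq_mod_eq_0)
    then have "0 < k mod int m \<and> k mod int m < int m" if "m > 0"
      using that pos_mod_sign[of "int m" k] pos_mod_bound[of "int m" k] by linarith
    then show "0 < j" "m = 0 \<or> j < m" using k by (auto simp: j_def nat_less_iff)
  qed
  have inv0: "cnj (\<xi>0 x) = inverse (\<xi>0 x)" if "x \<in> carrier G" for x
    using character_cmod[OF X0 that] complex_norm_square[of "\<xi>0 x"] by (intro inverse_unique[symmetric]) simp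
  have "inj_on \<Phi> ?S"
  proof (rule inj_onI)
    fix \<xi> \<eta> assume S: "\<xi> \<in> ?S" "\<eta> \<in> ?S" and eq: "\<Phi> \<xi> = \<Phi> \<eta>"
    have "\<xi> x = \<eta> x" if x: "x \<in> carrier G" for x
    proof -
      have "\<xi> x * cnj (\<xi>0 x) = \<eta> x * cnj (\<xi>0 x)" using fun_cong[OF eq, of x] x by (simp add: \<Phi>_def)
      then show ?thesis using character_nz[OF X0 x] by simp
    qed
    then show "\<xi> = \<eta>" using S by (intro character_eqI) (auto simp: torsion_characters_def)
  qed
  moreover have "\<Phi> ` ?S \<subseteq> torsion_characters j"
  proof
    fix \<eta> assume "\<eta> \<in> \<Phi> ` ?S"
    then obtain \<xi> where \<xi>: "\<xi> \<in> ?S" "\<eta> = \<Phi> \<xi>" by blast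
    then have X: "\<xi> \<in> characters G T" by (simp add: torsion_characters_def)
    have "\<eta> \<in> characters G T" unfolding \<xi>(2) \<Phi>_def
      using X X0 by (intro restrict_character unitary_character_mult unitary_character_cnj) (auto simp: characters_iff)
    moreover have "\<eta> x ^ j = 1" if x: "x \<in> carrier G" for x
    proof -
      have nz: "\<xi> x \<noteq> 0" "\<xi>0 x \<noteq> 0" using X X0 x character_nz by auto
      have "\<xi> x powi k = \<xi>0 x powi k" "\<xi> x ^ m = 1" "\<xi>0 x ^ m = 1"
        using \<xi> \<xi>0 x by (auto simp: torsion_characters_def)
      note eqs = this
      define w where "w = \<eta> x"
      have w_eq: "w = \<xi> x * inverse (\<xi>0 x)" using x by (simp add: w_def \<xi>(2) \<Phi>_def inv0)
      have w: "w powi k = 1" "w ^ m = 1" "w \<noteq> 0"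
        unfolding w_eq using nz eqs by (simp_all add: power_int_mult_distrib power_int_inverse power_mult_distrib power_inverse)
      show ?thesis
      proof (cases "m = 0")
        case True
        have "w ^ nat \<bar>k\<bar> = 1"
          using w(1,3) by (cases k rule: int_cases2) (auto simp: power_int_minus)
        then show ?thesis using True by (simp add: j_def w_def)
      next
        case False
        have "w powi k = w powi (int m * (k div int m) + k mod int m)" by simp
        also have "\<dots> = w powi (int m * (k div int m)) * w powi (k mod int m)"
          using w(3) by (intro power_int_add) simp
        also have "\<dots> = w powi (k mod int m)" using powi_eq_one_dvd[OF w(2,3), of "int m * (k div int m)"] by simp
        also have "\<dots> = w ^ nat (k mod int m)" using False by (simp add: power_int_def)
        finally show ?thesis using w False by (simp add: j_def w_def)
      qed
    qed
    ultimately show "\<eta> \<in> torsion_characters j" by (simp add: torsion_characters_def)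
  qed
  ultimately show ?thesis using m[OF j] by (meson countable_image_inj_on countable_subset)
next
  case True
  then show ?thesis by (simp only: countable_empty)
qed

lemma maximal_independent:
  obtains B where "independent m B" "\<And>B'. independent m B' \<Longrightarrow> B \<subseteq> B' \<Longrightarrow> B' = B"
proof -
  have "\<exists>B\<in>{B. independent m B}. \<forall>B'\<in>{B. independent m B}. B \<subseteq> B' \<longrightarrow> B' = B"
  proof (rule subset_Zorn_nonempty)
    have "independent m {}" by (auto simp: independent_def)
    then show "{B. independent m B} \<noteq> {}" by blast
    fix \<C> assume ne: "\<C> \<noteq> {}" and ch: "subset.chain {B. independent m B} \<C>"
    then have ind: "independent m B" if "B \<in> \<C>" for B using that by (auto simp: subset.chain_def)
    show "\<Union> \<C> \<in> {B. independent m B}"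
      unfolding mem_Collect_eq independent_def
    proof (intro conjI allI impI)
      show "\<Union> \<C> \<subseteq> torsion_characters m" using ind by (auto simp: independent_def)
      fix F n assume F: "finite F" "F \<subseteq> \<Union> \<C>" "\<forall>x\<in>carrier G. combo F n x = 1"
      then obtain B where "B \<in> \<C>" "F \<subseteq> B" using finite_subset_Union_chain[OF F(1,2) ne ch] by blast
      then show "\<forall>\<xi>\<in>F. int m dvd n \<xi>" using F ind independentD by blast
    qed
  qed
  then show thesis using that by blast
qed

text \<open>If a maximal independent \<open>B\<close> were countable, every character killed by
  \<open>m\<close> would have a power in the countable span of \<open>B\<close>, with an exponent
  not divisible by \<open>m\<close>. The fibres of such powers are countable, so only countably many
  characters would be killed by \<open>m\<close>.\<close>

lemma uncountable_independent:
  assumes unc: "uncountable (characters G T)"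
  obtains m B where "independent m B" "uncountable B"
proof -
  define m where "m = (if \<exists>k>0. uncountable (torsion_characters k)
      then LEAST k. 0 < k \<and> uncountable (torsion_characters k) else 0)"
  have "torsion_characters 0 = characters G T" by (simp add: torsion_characters_def)
  then have W: "uncountable (torsion_characters m)"
    and m: "\<And>j. 0 < j \<Longrightarrow> m = 0 \<or> j < m \<Longrightarrow> countable (torsion_characters j)"
  proof -
    consider k where "0 < k" "uncountable (torsion_characters k)" | "\<forall>k>0. countable (torsion_characters k)"
      by blast
    then have "uncountable (torsion_characters m) \<and>
        (\<forall>j. 0 < j \<longrightarrow> m = 0 \<or> j < m \<longrightarrow> countable (torsion_characters j))"
    proof cases
      case 1
      then have ex: "0 < k \<and> uncountable (torsion_characters k)" by simp
      have m_eq: "m = (LEAST k. 0 < k \<and> uncountable (torsion_characters k))" unfolding m_def by (rule if_P) (use ex in blast)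
      have "0 < m \<and> uncountable (torsion_characters m)" unfolding m_eq by (rule LeastI[where P = "\<lambda>k. 0 < k \<and> uncountable (torsion_characters k)", OF ex])
      moreover have "countable (torsion_characters j)" if "0 < j" "j < m" for j
        using not_less_Least[of j "\<lambda>k. 0 < k \<and> uncountable (torsion_characters k)"] that unfolding m_eq by blast
      ultimately show ?thesis by auto
    next
      case 2
      then have "m = 0" by (auto simp: m_def)
      then show ?thesis using 2 unc \<open>torsion_characters 0 = characters G T\<close> by simp
    qed
    then show "uncountable (torsion_characters m)"
      "\<And>j. 0 < j \<Longrightarrow> m = 0 \<or> j < m \<Longrightarrow> countable (torsion_characters j)" by blast+
  qed
  \<comment> \<open>Members of \<open>B\<close> itself are reached with the exponent 1, which must
    not be divisible by \<open>m\<close>.\<close>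
  have m1: "\<not> int m dvd 1"
  proof
    assume "int m dvd 1"
    then have "m = 1" by simp
    have "torsion_characters 1 \<subseteq> {\<lambda>x\<in>carrier G. 1}"
      by (auto simp: torsion_characters_def characters_iff intro!: extensionalityI[of _ "carrier G"])
    then have "countable (torsion_characters 1)" by (rule countable_subset) simp
    then show False using W \<open>m = 1\<close> by simp
  qed
  obtain B where B: "independent m B" "\<And>B'. independent m B' \<Longrightarrow> B \<subseteq> B' \<Longrightarrow> B' = B"
    by (rule maximal_independent) blast
  have "uncountable B"
  proof
    assume cB: "countable B"
    have BW: "B \<subseteq> torsion_characters m" using B(1) by (simp add: independent_def)
    have "torsion_characters m \<subseteq> (\<Union>k\<in>{k. \<not> int m dvd k}. \<Union>y\<in>char_span B.
        {\<xi> \<in> torsion_characters m. \<forall>x\<in>carrier G. \<xi> x powi k = y x})"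
    proof
      fix \<xi> assume \<xi>: "\<xi> \<in> torsion_characters m"
      have "\<exists>k y. \<not> int m dvd k \<and> y \<in> char_span B \<and> (\<forall>x\<in>carrier G. \<xi> x powi k = y x)"
      proof (cases "\<xi> \<in> B")
        case True
        then have "combo {\<xi>} (\<lambda>_. 1) \<in> char_span B" by (auto simp: char_span_def)
        then show ?thesis using m1 by (intro exI[of _ 1] exI[of _ "combo {\<xi>} (\<lambda>_. 1)"]) (simp add: combo_def)
      next
        case False
        then have "\<not> independent m (insert \<xi> B)" using B(2)[of "insert \<xi> B"] by blast
        then obtain F n \<psi> where F: "finite F" "F \<subseteq> insert \<xi> B" "\<forall>x\<in>carrier G. combo F n x = 1"
          and \<psi>: "\<psi> \<in> F" "\<not> int m dvd n \<psi>"
          using \<xi> BW unfolding independent_def by blast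
        have nz: "\<eta> x \<noteq> 0" if "\<eta> \<in> insert \<xi> B" "x \<in> carrier G" for \<eta> x
          using that \<xi> BW by (intro character_nz) (auto simp: torsion_characters_def)
        \<comment> \<open>If \<open>\<xi>\<close> were absent or its exponent divisible by
          \<open>m\<close>, the rest would be a relation inside \<open>B\<close> with a coefficient
          not divisible by \<open>m\<close>.\<close>
        have *: "\<xi> \<in> F \<and> \<not> int m dvd n \<xi>"
        proof (rule ccontr)
          assume neg: "\<not> (\<xi> \<in> F \<and> \<not> int m dvd n \<xi>)"
          have "combo (F - {\<xi>}) n x = 1" if x: "x \<in> carrier G" for x
          proof (cases "\<xi> \<in> F")
            case True
            then have "\<xi> x powi n \<xi> = 1"
              using \<xi> x neg nz by (intro powi_eq_one_dvd[of _ m]) (auto simp: torsion_characters_def)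
            then show ?thesis using F(3) x prod.remove[OF F(1) True, of "\<lambda>\<xi>. \<xi> x powi n \<xi>"]
              by (simp add: combo_def)
          next
            case False
            then show ?thesis using F(3) x by simp
          qed
          then have "\<forall>\<eta>\<in>F - {\<xi>}. int m dvd n \<eta>"
            using independentD[OF B(1), of "F - {\<xi>}" n] F by blast
          then show False using \<psi> neg by blast
        qed
        have "\<xi> x powi n \<xi> = combo (F - {\<xi>}) (\<lambda>\<eta>. - n \<eta>) x" if x: "x \<in> carrier G" for x
        proof -
          have "\<xi> x powi n \<xi> * (\<Prod>\<eta>\<in>F - {\<xi>}. \<eta> x powi n \<eta>) = 1"
            using F(3) x prod.remove[OF F(1), of \<xi> "\<lambda>\<xi>. \<xi> x powi n \<xi>"] * by (simp add: combo_def)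
          then show ?thesis using x
            by (simp add: combo_def prod_powi_uminus) (metis inverse_unique mult.commute)
        qed
        moreover have "combo (F - {\<xi>}) (\<lambda>\<eta>. - n \<eta>) \<in> char_span B" using F by (auto simp: char_span_def)
        ultimately show ?thesis using * by blast
      qed
      then show "\<xi> \<in> (\<Union>k\<in>{k. \<not> int m dvd k}. \<Union>y\<in>char_span B.
        {\<xi> \<in> torsion_characters m. \<forall>x\<in>carrier G. \<xi> x powi k = y x})" using \<xi> by blast
    qed
    moreover have "countable (\<Union>k\<in>{k. \<not> int m dvd k}. \<Union>y\<in>char_span B.
        {\<xi> \<in> torsion_characters m. \<forall>x\<in>carrier G. \<xi> x powi k = y x})"
      using countable_char_span[OF cB] countable_power_fiber[OF m] by (intro countable_UN) auto
    ultimately show False using W countable_subset by blast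
  qed
  then show thesis using B(1) that by blast
qed

text \<open>For each element of the span of \<open>A\<close> that occurs in a relation with
  \<open>B\<close>, the support of one such relation is chosen. Any other relation for the same
  element differs by a relation inside \<open>B\<close>, so its exponents outside the chosen support
  are divisible by \<open>m\<close>.\<close>

lemma countable_essential_support:
  assumes B: "independent m B" and A: "countable A" "A \<subseteq> characters G T"
  obtains B0 where "countable B0" "B0 \<subseteq> B"
    "\<forall>F n F' n'. finite F \<longrightarrow> F \<subseteq> A \<longrightarrow> finite F' \<longrightarrow> F' \<subseteq> B \<longrightarrow>
      (\<forall>x\<in>carrier G. combo F n x * combo F' n' x = 1) \<longrightarrow> (\<forall>\<xi>\<in>F' - B0. int m dvd n' \<xi>)"
proof -
  define R where "R = (\<lambda>y F' n'. finite F' \<and> F' \<subseteq> B \<and> (\<forall>x\<in>carrier G. y x * combo F' n' x = 1))"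
  define S where "S = (\<lambda>y. if \<exists>F' n'. R y F' n' then SOME F'. \<exists>n'. R y F' n' else {})"
  have S: "\<exists>n'. R y (S y) n'" if "R y F' n'" for y F' n'
  proof -
    have ex: "\<exists>F' n'. R y F' n'" using that by blast
    then have "\<exists>n'. R y (SOME F'. \<exists>n'. R y F' n') n'" by (rule someI_ex)
    then show ?thesis using ex by (simp add: S_def)
  qed
  have finS: "finite (S y)" and SB: "S y \<subseteq> B" for y
  proof -
    have "finite (S y) \<and> S y \<subseteq> B"
    proof (cases "\<exists>F' n'. R y F' n'")
      case True
      then show ?thesis using S unfolding R_def by blast
    qed (auto simp: S_def)
    then show "finite (S y)" "S y \<subseteq> B" by auto
  qed
  define B0 where "B0 = (\<Union>y\<in>char_span A. S y)"
  have "countable B0"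
    unfolding B0_def using countable_char_span[OF A(1)] finS by (intro countable_UN) (auto intro: countable_finite)
  moreover have "B0 \<subseteq> B" using SB by (auto simp: B0_def)
  moreover have "\<forall>F n F' n'. finite F \<longrightarrow> F \<subseteq> A \<longrightarrow> finite F' \<longrightarrow> F' \<subseteq> B \<longrightarrow>
      (\<forall>x\<in>carrier G. combo F n x * combo F' n' x = 1) \<longrightarrow> (\<forall>\<xi>\<in>F' - B0. int m dvd n' \<xi>)"
  proof (intro allI impI ballI)
    fix F n F' n' \<xi>
    assume F: "finite F" "F \<subseteq> A" and F': "finite F'" "F' \<subseteq> B"
      and eq: "\<forall>x\<in>carrier G. combo F n x * combo F' n' x = 1" and "\<xi> \<in> F' - B0"
    then have \<xi>: "\<xi> \<in> F'" "\<xi> \<notin> B0" by auto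
    let ?y = "combo F n"
    have y: "?y \<in> char_span A" using F by (auto simp: char_span_def)
    have "R ?y F' n'" using F' eq by (simp add: R_def)
    then obtain n'' where n'': "R ?y (S ?y) n''" using S by blast
    define k where "k = (\<lambda>\<eta>. (if \<eta> \<in> F' then n' \<eta> else 0) + (if \<eta> \<in> S ?y then - n'' \<eta> else 0))"
    have "combo (F' \<union> S ?y) k x = 1" if x: "x \<in> carrier G" for x
    proof -
      have "\<eta> x \<noteq> 0" if "\<eta> \<in> F' \<union> S ?y" for \<eta>
        using that F' SB B x by (intro character_nz) (auto simp: independent_def torsion_characters_def)
      then have "combo (F' \<union> S ?y) k x = combo F' n' x * inverse (combo (S ?y) n'' x)"
        using x prod_powi_union[OF F'(1) finS[of ?y], where z = "\<lambda>\<eta>. \<eta> x" and n = n' and n' = "\<lambda>\<eta>. - n'' \<eta>"]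
        by (simp add: combo_def k_def prod_powi_uminus)
      moreover have "?y x * combo F' n' x = 1" "?y x * combo (S ?y) n'' x = 1"
        using eq n'' x by (auto simp: R_def)
      ultimately show ?thesis by (metis inverse_unique inverse_inverse_eq mult.commute)
    qed
    then have "int m dvd k \<xi>"
      using independentD[OF B, of "F' \<union> S ?y" k \<xi>] F' finS SB \<xi> by blast
    moreover have "\<xi> \<notin> S ?y" using \<xi>(2) y by (auto simp: B0_def)
    ultimately show "int m dvd n' \<xi>" using \<xi>(1) by (simp add: k_def)
  qed
  ultimately show thesis by (rule that)
qed

end

section \<open>A subgroup of eventually constant elements\<close>

lemma infinite_times_nat_bij:
  assumes "infinite A"
  obtains h where "bij_betw h (A \<times> (UNIV :: nat set)) A"
proof -
  have "(card_of (A \<times> (UNIV :: nat set)), card_of A) \<in> ordIso"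
    using card_of_Times_infinite[of A "UNIV :: nat set"] assms infinite_iff_card_of_nat[of A] by auto
  then show thesis using that card_of_ordIso by blast
qed

text \<open>Either \<open>B\<close> contains a copy of the continuum, which suffices, or
  \<open>B\<close> embeds into the reals; comparability of cardinals decides without the continuum
  hypothesis. As an infinite set absorbs a factor of the naturals, every index can own a
  sequence.\<close>

lemma uncountable_real_indexing:
  assumes "uncountable B"
  obtains I :: "real set" and \<xi> :: "real \<Rightarrow> nat \<Rightarrow> 'b"
  where "uncountable I" "inj_on (\<lambda>(i, k). \<xi> i k) (I \<times> UNIV)" "(\<lambda>(i, k). \<xi> i k) ` (I \<times> UNIV) \<subseteq> B"
proof (cases "\<exists>f. inj_on f (UNIV :: real set) \<and> f ` UNIV \<subseteq> B")
  case True
  then obtain f :: "real \<Rightarrow> 'b" where "inj f \<and> range f \<subseteq> B" ..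
  then have f: "inj f" "range f \<subseteq> B" by simp_all
  obtain h where h: "bij_betw h ((UNIV :: real set) \<times> (UNIV :: nat set)) (UNIV :: real set)"
    by (rule infinite_times_nat_bij[OF infinite_UNIV_char_0])
  show thesis
  proof (rule that[of UNIV "\<lambda>i k. f (h (i, k))"])
    show "uncountable (UNIV :: real set)" by (rule uncountable_UNIV_real)
    have "inj (f \<circ> h)" using f h by (intro inj_compose) (auto simp: bij_betw_def)
    then show "inj_on (\<lambda>(i, k). f (h (i, k))) (UNIV \<times> UNIV)" by (simp add: o_def case_prod_unfold)
  qed (use f in auto)
next
  case False
  then have "(card_of (UNIV :: real set), card_of B) \<notin> ordLeq" using card_of_ordLeq by blast
  then have "(card_of B, card_of (UNIV :: real set)) \<in> ordLeq" 
    using ordLeq_total[OF card_of_Well_order[of "UNIV :: real set"] card_of_Well_order[of B]] by simp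
  then obtain f :: "'b \<Rightarrow> real" where f: "inj_on f B" using card_of_ordLeq[of B "UNIV :: real set"] by auto
  have "infinite B" using assms uncountable_infinite by blast
  then obtain h where h: "bij_betw h (B \<times> (UNIV :: nat set)) B" by (rule infinite_times_nat_bij)
  define g where "g = the_inv_into B f"
  have g: "inj_on g (f ` B)" "g ` f ` B = B"
    using bij_betw_the_inv_into[OF bij_betw_imageI[OF f refl]] by (simp_all add: bij_betw_def g_def)
  have "inj_on (h \<circ> map_prod g id) (f ` B \<times> UNIV)"
    using g h by (intro comp_inj_on map_prod_inj_on) (auto simp: bij_betw_def map_prod_surj_on inj_on_subset)
  moreover have "(h \<circ> map_prod g id) ` (f ` B \<times> UNIV) = B"
    using h map_prod_surj_on[OF g(2), of id "UNIV :: nat set" UNIV] by (simp only: image_comp[symmetric] bij_betw_def) simp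
  ultimately show thesis
    using uncountable_infinite assms f countable_image_inj_eq[OF f]
    by (intro that[of "f ` B" "\<lambda>i k. h (g i, k)"]) (auto simp: o_def case_prod_unfold map_prod_def)
qed

text \<open>The index \<open>k\<close> codes a bound and a finite set, and the value records whether
  \<open>S\<close> equals that set below the bound. Sets thus become branches of the binary tree,
  observed at all its nodes.\<close>

definition set_code :: "complex \<Rightarrow> nat set \<Rightarrow> nat \<Rightarrow> complex" where
  "set_code \<zeta> S k = (if S \<inter> {..<fst (prod_decode k)} = set_decode (snd (prod_decode k)) then \<zeta> else 1)"

text \<open>A bound \<open>a\<close> beyond one separating point for each other set makes the
  coordinate that codes \<open>S0\<close> below \<open>a\<close> equal to \<open>\<zeta>\<close> for
  \<open>S0\<close> and to 1 for the others. The relation then reads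
  \<open>\<zeta> powi n S0 = 1\<close>.\<close>

lemma set_code_independent:
  assumes fin: "finite \<S>" and \<zeta>: "\<And>n :: int. \<zeta> powi n = 1 \<Longrightarrow> int m dvd n"
    and eq: "\<And>k. (\<Prod>S\<in>\<S>. set_code \<zeta> S k powi n S) = 1" and S0: "S0 \<in> \<S>"
  shows "int m dvd n S0"
proof -
  have "\<exists>b. (b \<in> S) \<noteq> (b \<in> S0)" if "S \<noteq> S0" for S using that by blast
  then obtain b where b: "\<And>S. S \<noteq> S0 \<Longrightarrow> (b S \<in> S) \<noteq> (b S \<in> S0)" by metis
  define a where "a = Suc (Max (b ` \<S>))"
  have ba: "b S < a" if "S \<in> \<S>" for S using that fin by (simp add: a_def less_Suc_eq_le)
  define k where "k = prod_encode (a, set_encode (S0 \<inter> {..<a}))"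
  have code: "set_code \<zeta> S k = (if S \<inter> {..<a} = S0 \<inter> {..<a} then \<zeta> else 1)" for S
    by (simp add: set_code_def k_def)
  have "S \<inter> {..<a} \<noteq> S0 \<inter> {..<a}" if "S \<in> \<S> - {S0}" for S
    using b[of S] ba[of S] that by blast
  then have "(\<Prod>S\<in>\<S> - {S0}. set_code \<zeta> S k powi n S) = 1" by (intro prod.neutral) (auto simp: code)
  then have "\<zeta> powi n S0 = 1"
    using eq[of k] prod.remove[OF fin S0, of "\<lambda>S. set_code \<zeta> S k powi n S"] by (simp add: code)
  then show ?thesis by (rule \<zeta>)
qed

text \<open>An irrational rotation for \<open>m = 0\<close>, a primitive m-th root of unity
  otherwise.\<close>

lemma exists_root_of_order:
  obtains \<zeta> :: complex where "cmod \<zeta> = 1" "\<zeta> ^ m = 1" "\<forall>n :: int. \<zeta> powi n = 1 \<longrightarrow> int m dvd n"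
proof -
  obtain \<theta> :: real where \<theta>: "\<theta> \<notin> \<rat>"
    using countable_rat uncountable_UNIV_real by (metis UNIV_eq_I)
  define t where "t = (if m = 0 then \<theta> else 1 / real m)"
  let ?\<zeta> = "cis (2 * pi * t)"
  have "?\<zeta> ^ m = 1"
  proof (cases "m = 0")
    case False
    then have *: "real m * (2 * pi * t) = 2 * pi" by (simp add: t_def)
    show ?thesis by (simp only: Complex.DeMoivre * cis_2pi)
  qed simp
  moreover have "int m dvd n" if "?\<zeta> powi n = 1" for n :: int
  proof -
    have "cis (of_int n * (2 * pi * t)) = 1" using that by (simp add: cis_power_int)
    then have "cos (of_int n * (2 * pi * t)) = 1" by (metis cis.sel(1) one_complex.sel(1))
    then obtain x :: int where "of_int n * (2 * pi * t) = of_int x * 2 * pi" using cos_one_2pi_int by blast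
    then have x: "of_int n * t = of_int x" by simp
    show ?thesis
    proof (cases "m = 0")
      case True
      have "n = 0"
      proof (rule ccontr)
        assume "n \<noteq> 0"
        then have "\<theta> = of_int x / of_int n" using x True by (simp add: t_def field_simps)
        then show False using \<theta> by simp
      qed
      then show ?thesis by simp
    next
      case False
      then have "of_int n = real m * of_int x" using x by (simp add: t_def field_simps)
      then have "real_of_int n = real_of_int (int m * x)" by simp
      then have "n = int m * x" by linarith
      then show ?thesis by simp
    qed
  qed
  ultimately show thesis by (intro that[of ?\<zeta>]) auto
qed

text \<open>An assignment enumerates a countable set \<open>Z\<close> of reals together with prescribed values at \<open>(i, k)\<close>
  for \<open>i \<in> Z\<close>. Outside \<open>Z\<close>, \<open>assigned\<close> continues it by values that do not depend on \<open>i\<close> and encode \<open>s\<close>.\<close>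

type_synonym assignment = "nat \<Rightarrow> real \<times> (nat \<Rightarrow> complex)"

definition real_code :: "real \<Rightarrow> nat set" where
  "real_code = (SOME e. inj e)"

lemma inj_real_code: "inj real_code"
proof -
  have "\<exists>e :: real \<Rightarrow> nat set. inj e"
    using nat_sets_eqpoll_reals unfolding eqpoll_def by (metis bij_betw_imp_inj_on bij_betw_inv_into)
  then show ?thesis unfolding real_code_def by (rule someI_ex)
qed

text \<open>The indices and the real and imaginary parts of the values are countably many reals;
  their codes are merged into one set of naturals.\<close>

definition assignment_code :: "assignment \<Rightarrow> nat set" where
  "assignment_code s = {to_nat (n, k, j :: nat, b) | n k j b. b \<in> real_code
     (if j = 0 then fst (s n) else if j = 1 then Re (snd (s n) k) else Im (snd (s n) k))}"

lemma inj_assignment_code: "inj assignment_code"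
proof (rule injI)
  fix s s' assume eq: "assignment_code s = assignment_code s'"
  let ?v = "\<lambda>s n k j. if j = (0::nat) then fst (s n) else if j = 1 then Re (snd (s n) k) else Im (snd (s n) k)"
  have "b \<in> real_code (?v s n k j) \<longleftrightarrow> to_nat (n, k, j, b) \<in> assignment_code s" for s n k j b
    by (auto simp: assignment_code_def)
  then have "real_code (?v s n k j) = real_code (?v s' n k j)" for n k j
    using eq by blast
  then have "?v s n k j = ?v s' n k j" for n k j
    by (rule injD[OF inj_real_code])
  then have v: "\<forall>n k j. ?v s n k j = ?v s' n k j" by blast
  show "s = s'"
  proof
    fix n
    have "Re (snd (s n) k) = Re (snd (s' n) k)" "Im (snd (s n) k) = Im (snd (s' n) k)" for k
      using v[THEN spec[of _ n], THEN spec[of _ k], THEN spec[of _ 1]]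
        v[THEN spec[of _ n], THEN spec[of _ k], THEN spec[of _ 2]] by simp_all
    then have "snd (s n) = snd (s' n)" by (intro ext complex_eqI)
    moreover have "fst (s n) = fst (s' n)"
      using v[THEN spec[of _ n], THEN spec[of _ 0], THEN spec[of _ 0]] by simp
    ultimately show "s n = s' n" by (simp add: prod_eq_iff)
  qed
qed

text \<open>If an index is listed more than once, its first occurrence decides.\<close>

definition assigned :: "complex \<Rightarrow> assignment \<Rightarrow> real \<Rightarrow> nat \<Rightarrow> complex" where
  "assigned \<zeta> s i k = (if i \<in> range (fst \<circ> s) then snd (s (LEAST n. fst (s n) = i)) k
     else set_code \<zeta> (assignment_code s) k)"

locale independent_characters = compact_abelian_group G T for G (structure) and T +
  fixes m :: nat and I :: "real set" and \<xi> :: "real \<Rightarrow> nat \<Rightarrow> 'a \<Rightarrow> complex" and \<zeta> :: complex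
  assumes uncountable_I: "uncountable I"
    and inj_family: "inj_on (\<lambda>(i, k). \<xi> i k) (I \<times> UNIV)"
    and independent_family: "independent m ((\<lambda>(i, k). \<xi> i k) ` (I \<times> UNIV))"
    and \<zeta>: "cmod \<zeta> = 1" "\<zeta> ^ m = 1" "\<forall>n :: int. \<zeta> powi n = 1 \<longrightarrow> int m dvd n"
begin

lemma family_torsion: "i \<in> I \<Longrightarrow> \<xi> i k \<in> torsion_characters m"
  using independent_family by (force simp: independent_def)

lemma family_character: "i \<in> I \<Longrightarrow> \<xi> i k \<in> characters G T"
  using family_torsion by (auto simp: torsion_characters_def)

definition assignments :: "assignment set" where
  "assignments = {s. \<forall>n. fst (s n) \<in> I \<and> (\<forall>k. cmod (snd (s n) k) = 1 \<and> snd (s n) k ^ m = 1)}"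

lemma assigned_root:
  assumes "s \<in> assignments"
  shows "cmod (assigned \<zeta> s i k) = 1" "assigned \<zeta> s i k ^ m = 1"
  using assms \<zeta> by (auto simp: assigned_def assignments_def set_code_def)

lemma assigned_nz: "s \<in> assignments \<Longrightarrow> assigned \<zeta> s i k \<noteq> 0"
  using assigned_root(1)[of s i k] by auto

text \<open>Finite products with integer exponents close the assigned functions under the group
  operations. Only the values under the family are recorded; other characters stay free.\<close>

definition represents :: "assignment set \<Rightarrow> (assignment \<Rightarrow> int) \<Rightarrow> 'a \<Rightarrow> bool" where
  "represents F n g \<longleftrightarrow> finite F \<and> F \<subseteq> assignments \<and>
     (\<forall>i\<in>I. \<forall>k. \<xi> i k g = (\<Prod>s\<in>F. assigned \<zeta> s i k powi n s))"

definition D :: "'a set" where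
  "D = {g \<in> carrier G. \<exists>F n. represents F n g}"

lemma subgroup_D: "subgroup D G"
proof (rule subgroupI)
  show "D \<subseteq> carrier G" by (auto simp: D_def)
  have "represents {} n \<one>" for n
    using family_character by (auto simp: represents_def characters_iff unitary_character_one)
  then show "D \<noteq> {}" by (auto simp: D_def)
next
  fix g assume "g \<in> D"
  then obtain F n where g: "g \<in> carrier G" and F: "represents F n g" by (auto simp: D_def)
  have "represents F (\<lambda>s. - n s) (inv g)"
    unfolding represents_def
  proof (intro conjI ballI allI)
    fix i k assume i: "i \<in> I"
    then have \<xi>: "unitary_character (\<xi> i k)" using family_character by (simp add: characters_iff)
    have "\<xi> i k (g \<otimes> inv g) = \<xi> i k g * \<xi> i k (inv g)"
      using \<xi> g inv_closed[OF g] unfolding unitary_character_def by blast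
    then have "\<xi> i k (inv g) = inverse (\<xi> i k g)"
      using unitary_character_one[OF \<xi>] g by (simp add: inverse_unique)
    then show "\<xi> i k (inv g) = (\<Prod>s\<in>F. assigned \<zeta> s i k powi - n s)"
      using F i by (simp add: represents_def prod_powi_uminus)
  qed (use F in \<open>auto simp: represents_def\<close>)
  then show "inv g \<in> D" using g by (auto simp: D_def)
next
  fix g g' assume "g \<in> D" "g' \<in> D"
  then obtain F n F' n' where g: "g \<in> carrier G" "g' \<in> carrier G"
    and F: "represents F n g" and F': "represents F' n' g'" by (auto simp: D_def)
  have "represents (F \<union> F') (\<lambda>s. (if s \<in> F then n s else 0) + (if s \<in> F' then n' s else 0)) (g \<otimes> g')"
    unfolding represents_def
  proof (intro conjI ballI allI)
    fix i k assume i: "i \<in> I"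
    then have "\<xi> i k (g \<otimes> g') = \<xi> i k g * \<xi> i k g'"
      using family_character g by (simp add: characters_iff unitary_character_def)
    also have "\<dots> = (\<Prod>s\<in>F. assigned \<zeta> s i k powi n s) * (\<Prod>s\<in>F'. assigned \<zeta> s i k powi n' s)"
      using F F' i by (simp add: represents_def)
    also have "\<dots> = (\<Prod>s\<in>F \<union> F'. assigned \<zeta> s i k powi ((if s \<in> F then n s else 0) + (if s \<in> F' then n' s else 0)))"
      using F F' assigned_nz by (intro prod_powi_union[symmetric]) (auto simp: represents_def)
    finally show "\<xi> i k (g \<otimes> g') = \<dots>" .
  qed (use F F' in \<open>auto simp: represents_def\<close>)
  then show "g \<otimes> g' \<in> D" using g unfolding D_def by blast
qed

text \<open>The eventual value of a represented element. It is computed from the representation, but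
  since \<open>I\<close> is uncountable, \<open>represents_tail\<close> recovers it from the
  element.\<close>

definition tail :: "assignment set \<Rightarrow> (assignment \<Rightarrow> int) \<Rightarrow> nat \<Rightarrow> complex" where
  "tail F n k = (\<Prod>s\<in>F. set_code \<zeta> (assignment_code s) k powi n s)"

lemma represents_tail:
  assumes "represents F n g" "i \<in> I - (\<Union>s\<in>F. range (fst \<circ> s))"
  shows "\<xi> i k g = tail F n k"
  using assms by (auto simp: represents_def tail_def assigned_def intro!: prod.cong)

text \<open>The difference of two representations with equal tails is a relation among codes of
  distinct sets, so all its exponents are divisible by \<open>m\<close>. The assigned values are
  killed by \<open>m\<close>, hence the two representations agree at every index, exceptional ones
  included.\<close>

lemma tail_inj:
  assumes F: "represents F n g" and F': "represents F' n' g'" and eq: "tail F n = tail F' n'"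
    and i: "i \<in> I"
  shows "\<xi> i k g = \<xi> i k g'"
proof -
  define N where "N = (\<lambda>s. (if s \<in> F then n s else 0) + (if s \<in> F' then - n' s else 0))"
  have fin: "finite F" "finite F'" and sub: "F \<union> F' \<subseteq> assignments" using F F' by (auto simp: represents_def)
  have "\<zeta> \<noteq> 0" using \<zeta>(1) by auto
  then have code_nz: "set_code \<zeta> S k \<noteq> 0" for S k by (simp add: set_code_def)
  have N: "int m dvd N s" if s: "s \<in> F \<union> F'" for s
  proof -
    have "(\<Prod>s\<in>F \<union> F'. set_code \<zeta> (assignment_code s) k powi N s) = tail F n k * inverse (tail F' n' k)" for k
      using prod_powi_union[OF fin code_nz, of assignment_code] unfolding N_def tail_def
      by (simp add: prod_powi_union[OF fin] code_nz prod_powi_uminus)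
    moreover have "tail F' n' k \<noteq> 0" for k
      unfolding tail_def using code_nz fin by simp
    ultimately have 1: "(\<Prod>s\<in>F \<union> F'. set_code \<zeta> (assignment_code s) k powi N s) = 1" for k
      using eq by simp
    have inj: "inj_on assignment_code (F \<union> F')" using inj_assignment_code inj_on_subset by blast
    have "int m dvd N (the_inv assignment_code (assignment_code s))"
    proof (rule set_code_independent[where \<S> = "assignment_code ` (F \<union> F')" and \<zeta> = \<zeta>
          and n = "\<lambda>S. N (the_inv assignment_code S)"])
      show "(\<Prod>S\<in>assignment_code ` (F \<union> F'). set_code \<zeta> S k powi N (the_inv assignment_code S)) = 1" for k
        using 1[of k] by (simp add: prod.reindex[OF inj] the_inv_f_f[OF inj_assignment_code])
    qed (use fin \<zeta>(3) s in auto)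
    then show ?thesis by (simp add: the_inv_f_f[OF inj_assignment_code])
  qed
  have "(\<Prod>s\<in>F \<union> F'. assigned \<zeta> s i k powi N s) = 1"
    using N sub assigned_root(2) assigned_nz by (intro prod.neutral ballI powi_eq_one_dvd[of _ m]) auto
  moreover have "(\<Prod>s\<in>F \<union> F'. assigned \<zeta> s i k powi N s) =
      (\<Prod>s\<in>F. assigned \<zeta> s i k powi n s) * (\<Prod>s\<in>F'. assigned \<zeta> s i k powi - n' s)"
    unfolding N_def using sub assigned_nz by (intro prod_powi_union fin) auto
  ultimately have "(\<Prod>s\<in>F. assigned \<zeta> s i k powi n s) * inverse (\<Prod>s\<in>F'. assigned \<zeta> s i k powi n' s) = 1"
    by (simp add: prod_powi_uminus)
  moreover have "a * inverse b = 1 \<Longrightarrow> a = b" for a b :: complex by (cases "b = 0") (auto simp: field_simps)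
  ultimately have "(\<Prod>s\<in>F. assigned \<zeta> s i k powi n s) = (\<Prod>s\<in>F'. assigned \<zeta> s i k powi n' s)" by blast
  then show ?thesis using F F' i by (simp add: represents_def)
qed

end

section \<open>Countable intersections of open sets, compact subsets and duality\<close>

context compact_abelian_group
begin

lemma characters_separate_points:
  assumes "x \<in> carrier G" "y \<in> carrier G" "x \<noteq> y"
  obtains \<xi> where "\<xi> \<in> characters G T" "\<xi> x \<noteq> \<xi> y"
proof -
  have "x \<otimes> inv y \<noteq> \<one>" using assms by (metis inv_closed inv_equality inv_inv)
  then obtain \<xi> where \<xi>: "\<xi> \<in> characters G T" "\<xi> (x \<otimes> inv y) \<noteq> 1"
    using characters_separate[of "x \<otimes> inv y"] assms by auto
  have u: "unitary_character \<xi>" using \<xi> by (simp add: characters_iff)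
  have "\<xi> x \<noteq> \<xi> y"
  proof
    assume "\<xi> x = \<xi> y"
    moreover have "\<xi> (x \<otimes> inv y) = \<xi> x * \<xi> (inv y)" "\<xi> (y \<otimes> inv y) = \<xi> y * \<xi> (inv y)"
      using u assms inv_closed[of y] unfolding unitary_character_def by blast+
    ultimately have "\<xi> (x \<otimes> inv y) = \<xi> (y \<otimes> inv y)" by simp
    then show False using \<xi>(2) assms unitary_character_one[OF u] by simp
  qed
  then show thesis using \<xi>(1) that by blast
qed

text \<open>An enumeration of the characters embeds the compact group into a countable product of
  complex planes.\<close>

lemma countable_characters_imp_metrizable:
  assumes "countable (characters G T)"
  shows "metrizable_space T"
proof -
  have ne: "characters G T \<noteq> {}" using restrict_character[OF unitary_character_const_one] by blast
  define e where "e = from_nat_into (characters G T)"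
  have e: "range e = characters G T" unfolding e_def by (rule range_from_nat_into[OF ne assms])
  define \<Psi> where "\<Psi> = (\<lambda>x n. e n x)"
  have "continuous_map T euclidean (e n)" for n
    using e by (auto simp: characters_iff unitary_character_def set_eq_iff)
  then have "continuous_map T (product_topology (\<lambda>_. euclidean) UNIV) \<Psi>"
    unfolding continuous_map_componentwise_UNIV \<Psi>_def by blast
  then have cont: "continuous_map T euclidean \<Psi>" by (simp add: euclidean_product_topology)
  have "Hausdorff_space (euclidean :: (nat \<Rightarrow> complex) topology)" by simp
  then have "closed_map T euclidean \<Psi>" by (rule T1_Spaces.continuous_imp_closed_map[OF cont compact])
  moreover have "inj_on \<Psi> (topspace T)"
  proof (rule inj_onI)
    fix x y assume xy: "x \<in> topspace T" "y \<in> topspace T" "\<Psi> x = \<Psi> y"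
    show "x = y"
    proof (rule ccontr)
      assume "x \<noteq> y"
      then obtain \<eta> where "\<eta> \<in> characters G T" "\<eta> x \<noteq> \<eta> y"
        using characters_separate_points[of x y] xy by (auto simp: topspace_eq_carrier)
      moreover then obtain n where "\<eta> = e n" using e by blast
      ultimately show False using fun_cong[OF xy(3), of n] by (simp add: \<Psi>_def)
    qed
  qed
  ultimately have "embedding_map T euclidean \<Psi>" by (rule injective_closed_imp_embedding_map[OF cont])
  then have "T homeomorphic_space subtopology euclidean (\<Psi> ` topspace T)"
    by (rule embedding_map_imp_homeomorphic_space)
  moreover have "metrizable_space (subtopology (euclidean :: (nat \<Rightarrow> complex) topology) (\<Psi> ` topspace T))"
    by (intro metrizable_space_subtopology metrizable_space_euclidean)
  ultimately show ?thesis using homeomorphic_metrizable_space by blast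
qed

text \<open>The set \<open>U\<close> and the open sets on which some character differs from its
  value at \<open>g\<close> cover the group; the characters of a finite subcover suffice.\<close>

lemma open_determined_by_finite_characters:
  assumes U: "openin T U" "g \<in> U"
  obtains A where "finite A" "A \<subseteq> characters G T" "\<And>h. h \<in> carrier G \<Longrightarrow> (\<forall>\<eta>\<in>A. \<eta> h = \<eta> g) \<Longrightarrow> h \<in> U"
proof -
  have g: "g \<in> carrier G" using U openin_subset topspace_eq_carrier by auto
  define N :: "('a \<Rightarrow> complex) \<Rightarrow> 'a set" where "N = (\<lambda>\<eta>. {h \<in> topspace T. \<eta> h \<in> - {\<eta> g}})"
  have "openin T (N \<eta>)" if "\<eta> \<in> characters G T" for \<eta> :: "'a \<Rightarrow> complex"
  proof -
    have "continuous_map T euclidean \<eta>" using that by (simp add: characters_iff unitary_character_def)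
    then show ?thesis unfolding N_def by (rule openin_continuous_map_preimage) (simp add: open_Compl)
  qed
  then have op: "\<And>W. W \<in> insert U (N ` characters G T) \<Longrightarrow> openin T W" using U by auto
  have "topspace T \<subseteq> \<Union> (insert U (N ` characters G T))"
  proof
    fix h assume h: "h \<in> topspace T"
    show "h \<in> \<Union> (insert U (N ` characters G T))"
    proof (cases "h = g")
      case False
      then obtain \<eta> where "\<eta> \<in> characters G T" "\<eta> h \<noteq> \<eta> g"
        using characters_separate_points[of h g] h g by (auto simp: topspace_eq_carrier)
      then show ?thesis using h by (auto simp: N_def)
    qed (use U in simp)
  qed
  with op obtain \<F> where F: "finite \<F>" "\<F> \<subseteq> insert U (N ` characters G T)" "topspace T \<subseteq> \<Union> \<F>"
    using compact unfolding compact_space_alt by (metis (no_types, lifting))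
  then have "finite (\<F> - {U})" "\<F> - {U} \<subseteq> N ` characters G T" by auto
  then obtain A where A: "A \<subseteq> characters G T" "finite A" "\<F> - {U} = N ` A" by (meson finite_subset_image)
  show thesis
  proof (rule that[OF A(2,1)])
    fix h assume h: "h \<in> carrier G" "\<forall>\<eta>\<in>A. \<eta> h = \<eta> g"
    obtain W where W: "W \<in> \<F>" "h \<in> W" using F(3) h by (auto simp: topspace_eq_carrier)
    have "W \<notin> N ` A" using W(2) h(2) by (auto simp: N_def)
    then have "W = U" using W(1) A(3) by blast
    then show "h \<in> U" using W(2) by simp
  qed
qed

lemma gdelta_determined_by_countable_characters:
  assumes B: "gdelta_in T B" "g \<in> B"
  obtains A where "countable A" "A \<subseteq> characters G T" "\<And>h. h \<in> carrier G \<Longrightarrow> (\<forall>\<eta>\<in>A. \<eta> h = \<eta> g) \<Longrightarrow> h \<in> B"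
proof -
  obtain C :: "nat \<Rightarrow> 'a set" where C: "\<And>n. openin T (C n)" "\<Inter> (range C) = B"
    using B(1) unfolding gdelta_in_descending by blast
  have "\<exists>A. finite A \<and> A \<subseteq> characters G T \<and> (\<forall>h\<in>carrier G. (\<forall>\<eta>\<in>A. \<eta> h = \<eta> g) \<longrightarrow> h \<in> C n)" for n
  proof -
    have "g \<in> C n" using C(2) B(2) by blast
    then show ?thesis by (rule open_determined_by_finite_characters[OF C(1)]) blast
  qed
  then obtain A where A: "\<And>n. finite (A n)" "\<And>n. A n \<subseteq> characters G T"
    "\<And>n. \<forall>h\<in>carrier G. (\<forall>\<eta>\<in>A n. \<eta> h = \<eta> g) \<longrightarrow> h \<in> C n" by metis
  show thesis
  proof (rule that[of "\<Union> (range A)"])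
    show "countable (\<Union> (range A))" using A(1) by (intro countable_UN) (auto intro: countable_finite)
    show "\<Union> (range A) \<subseteq> characters G T" using A(2) by blast
    fix h assume "h \<in> carrier G" "\<forall>\<eta>\<in>\<Union> (range A). \<eta> h = \<eta> g"
    then have "h \<in> C n" for n using A(3)[of n] by auto
    then show "h \<in> B" using C(2) by blast
  qed
qed

end

section \<open>Density of \<open>D\<close> and its compact subsets\<close>

context independent_characters
begin

text \<open>Agreement with \<open>g\<close> on a countable set \<open>A\<close> of characters
  guarantees membership in \<open>B\<close>. The family members related to \<open>A\<close> have
  indices in a countable \<open>I0\<close>. An assignment that lists the values of \<open>g\<close>
  on \<open>I0\<close> is compatible with the values of \<open>g\<close> on \<open>A\<close>, and a
  solution \<open>h\<close> of both lies in \<open>D\<close> and in \<open>B\<close>.\<close>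

lemma gdelta_dense_D: "gdelta_dense T D"
  unfolding gdelta_dense_def
proof (intro conjI allI impI)
  show "D \<subseteq> topspace T" by (auto simp: D_def topspace_eq_carrier)
  fix B assume "gdelta_in T B \<and> B \<noteq> {}"
  then obtain g where B: "gdelta_in T B" "g \<in> B" by blast
  then have g: "g \<in> carrier G" using gdelta_in_subset topspace_eq_carrier by blast
  obtain A where A: "countable A" "A \<subseteq> characters G T"
    and AB: "\<And>h. h \<in> carrier G \<Longrightarrow> (\<forall>\<eta>\<in>A. \<eta> h = \<eta> g) \<Longrightarrow> h \<in> B"
    using gdelta_determined_by_countable_characters[OF B] by blast
  let ?X = "\<lambda>(i, k). \<xi> i k"
  let ?fam = "?X ` (I \<times> UNIV)"
  obtain B0 where B0: "countable B0" "B0 \<subseteq> ?fam"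
    and ess: "\<forall>F n F' n'. finite F \<longrightarrow> F \<subseteq> A \<longrightarrow> finite F' \<longrightarrow> F' \<subseteq> ?fam \<longrightarrow>
      (\<forall>x\<in>carrier G. combo F n x * combo F' n' x = 1) \<longrightarrow> (\<forall>\<eta>\<in>F' - B0. int m dvd n' \<eta>)"
    by (rule countable_essential_support[OF independent_family A])
  obtain i0 where i0: "i0 \<in> I" using uncountable_I by (metis countable_empty equals0I)
  \<comment> \<open>The extra \<open>i0\<close> keeps \<open>I0\<close> nonempty, so that the
    naturals can enumerate it.\<close>
  define I0 where "I0 = insert i0 (fst ` (the_inv_into (I \<times> UNIV) ?X ` B0))"
  have inv: "the_inv_into (I \<times> UNIV) ?X (\<xi> i k) = (i, k)" if "i \<in> I" for i k
    using the_inv_into_f_f[OF inj_family, of "(i, k)"] that by simp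
  have I0: "countable I0" "I0 \<noteq> {}" "I0 \<subseteq> I"
  proof -
    have "fst (the_inv_into (I \<times> UNIV) ?X \<eta>) \<in> I" if "\<eta> \<in> B0" for \<eta>
    proof -
      obtain i k where "i \<in> I" "\<eta> = \<xi> i k" using \<open>\<eta> \<in> B0\<close> B0(2) by auto
      then show ?thesis using inv by simp
    qed
    then show "I0 \<subseteq> I" using i0 by (auto simp: I0_def)
  qed (use B0(1) in \<open>simp_all add: I0_def\<close>)
  have notI0: "\<xi> i k \<notin> B0" if "i \<in> I" "i \<notin> I0" for i k
  proof
    assume "\<xi> i k \<in> B0"
    then have "fst (the_inv_into (I \<times> UNIV) ?X (\<xi> i k)) \<in> I0" by (simp add: I0_def)
    then show False using that inv by simp
  qed
  define s :: assignment where "s = (\<lambda>n. (from_nat_into I0 n, \<lambda>k. \<xi> (from_nat_into I0 n) k g))"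
  have range_s: "range (fst \<circ> s) = I0"
    using range_from_nat_into[OF I0(2,1)] by (simp add: s_def o_def)
  have s: "s \<in> assignments"
  proof -
    have "from_nat_into I0 n \<in> I" for n using from_nat_into[OF I0(2), of n] I0(3) by blast
    then show ?thesis
      using family_torsion g by (auto simp: assignments_def s_def torsion_characters_def intro: character_cmod)
  qed
  have s_in: "assigned \<zeta> s i k = \<xi> i k g" if "i \<in> I0" for i k
  proof -
    have "i \<in> range (fst \<circ> s)" using range_s that by simp
    then obtain n where "fst (s n) = i" by auto
    then have "fst (s (LEAST n. fst (s n) = i)) = i" by (rule LeastI)
    then have "snd (s (LEAST n. fst (s n) = i)) k = \<xi> i k g" by (simp add: s_def)
    then show ?thesis using \<open>i \<in> range (fst \<circ> s)\<close> by (simp add: assigned_def)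
  qed
  \<comment> \<open>A character may lie both in \<open>A\<close> and in the family. The sum type
    keeps both of its equations, and the compatibility condition reconciles them.\<close>
  define \<phi> :: "('a \<Rightarrow> complex) + real \<times> nat \<Rightarrow> 'a \<Rightarrow> complex" where "\<phi> = case_sum id ?X"
  define f :: "('a \<Rightarrow> complex) + real \<times> nat \<Rightarrow> complex"
    where "f = case_sum (\<lambda>\<eta>. \<eta> g) (\<lambda>(i, k). assigned \<zeta> s i k)"
  define J where "J = Inl ` A \<union> Inr ` (I \<times> (UNIV :: nat set))"
  have \<phi>: "\<phi> j \<in> characters G T" if "j \<in> J" for j
    using that A(2) family_character by (auto simp: J_def \<phi>_def)
  obtain h where h: "h \<in> carrier G" "\<And>j. j \<in> J \<Longrightarrow> \<phi> j h = f j"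
  proof (rule character_system[of J \<phi> f])
    show "unitary_character (\<phi> j)" if "j \<in> J" for j using \<phi>[OF that] by (simp add: characters_iff)
    show "cmod (f j) = 1" if "j \<in> J" for j
    proof -
      have "cmod (\<eta> g) = 1" if "\<eta> \<in> A" for \<eta> using character_cmod A(2) g that by blast
      then show ?thesis using that s by (auto simp: J_def f_def assigned_root)
    qed
    fix F and n :: "('a \<Rightarrow> complex) + real \<times> nat \<Rightarrow> int"
    assume F: "finite F" "F \<subseteq> J" and rel: "\<forall>x\<in>carrier G. (\<Prod>j\<in>F. \<phi> j x powi n j) = 1"
    define F1 where "F1 = Inl -` F"
    define F2 where "F2 = Inr -` F"
    have fin: "finite F1" "finite F2" unfolding F1_def F2_def using F(1) by (auto intro: finite_vimageI)
    have F12: "F1 \<subseteq> A" "F2 \<subseteq> I \<times> UNIV" using F(2) by (auto simp: F1_def F2_def J_def)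
    have F_eq: "F = Inl ` F1 \<union> Inr ` F2"
    proof (intro equalityI subsetI)
      show "j \<in> Inl ` F1 \<union> Inr ` F2" if "j \<in> F" for j
        using that by (cases j) (auto simp: F1_def F2_def)
    qed (auto simp: F1_def F2_def)
    have split: "(\<Prod>j\<in>F. q j) = (\<Prod>\<eta>\<in>F1. q (Inl \<eta>)) * (\<Prod>p\<in>F2. q (Inr p))" for q :: "_ \<Rightarrow> complex"
      unfolding F_eq using fin by (subst prod.union_disjoint) (auto simp: prod.reindex)
    have inj2: "inj_on ?X F2" using inj_on_subset[OF inj_family F12(2)] .
    define n' where "n' = (\<lambda>\<eta>. n (Inr (the_inv_into F2 ?X \<eta>)))"
    have n': "n' (?X p) = n (Inr p)" if "p \<in> F2" for p
      unfolding n'_def using the_inv_into_f_f[OF inj2 that] by simp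
    have "combo F1 (\<lambda>\<eta>. n (Inl \<eta>)) x * combo (?X ` F2) n' x = 1" if x: "x \<in> carrier G" for x
    proof -
      have "combo (?X ` F2) n' x = (\<Prod>p\<in>F2. ?X p x powi n (Inr p))"
        using x n' by (simp add: combo_def prod.reindex[OF inj2] cong: prod.cong)
      then show ?thesis using rel x split[of "\<lambda>j. \<phi> j x powi n j"] by (simp add: combo_def \<phi>_def)
    qed
    then have dvd: "\<forall>\<eta>\<in>?X ` F2 - B0. int m dvd n' \<eta>"
      using ess[rule_format, of F1 "?X ` F2" "\<lambda>\<eta>. n (Inl \<eta>)" n'] fin F12 by blast
    \<comment> \<open>The relation holds at \<open>g\<close>, so it suffices that every factor has
      the value that it has at \<open>g\<close>. At indices outside \<open>I0\<close> the exponent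
      is divisible by \<open>m\<close>, and both factors are 1.\<close>
    have "f j powi n j = \<phi> j g powi n j" if j: "j \<in> F" for j
    proof (cases j)
      case (Inl \<eta>)
      then show ?thesis by (simp add: f_def \<phi>_def)
    next
      case (Inr p)
      obtain i k where p: "p = (i, k)" by fastforce
      have pF: "p \<in> F2" using j Inr by (simp add: F2_def)
      then have i: "i \<in> I" using F12 p by auto
      show ?thesis
      proof (cases "i \<in> I0")
        case True
        then show ?thesis using s_in Inr p by (simp add: f_def \<phi>_def)
      next
        case False
        have "\<xi> i k \<in> ?X ` F2 - B0" using pF p notI0[OF i False] by force
        then have "int m dvd n' (\<xi> i k)" using dvd by blast
        then have md: "int m dvd n j" using n'[OF pF] p Inr by simp
        have "assigned \<zeta> s i k powi n j = 1"
          by (rule powi_eq_one_dvd[OF assigned_root(2)[OF s] assigned_nz[OF s] md])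
        moreover have "\<xi> i k g powi n j = 1"
          using family_torsion[OF i, of k] family_character[OF i, of k] g
          by (intro powi_eq_one_dvd[OF _ _ md] character_nz) (auto simp: torsion_characters_def)
        ultimately show ?thesis using Inr p by (simp add: f_def \<phi>_def)
      qed
    qed
    then have "(\<Prod>j\<in>F. f j powi n j) = (\<Prod>j\<in>F. \<phi> j g powi n j)" by (intro prod.cong) auto
    then show "(\<Prod>j\<in>F. f j powi n j) = 1" using rel g by simp
  qed blast
  have "\<eta> h = \<eta> g" if "\<eta> \<in> A" for \<eta>
    using h(2)[of "Inl \<eta>"] that by (simp add: J_def \<phi>_def f_def)
  then have "h \<in> B" using AB[OF h(1)] by blast
  moreover have "represents {s} (\<lambda>_. 1) h"
    using s h(2)[of "Inr _"] by (auto simp: represents_def J_def \<phi>_def f_def)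
  then have "h \<in> D" using h(1) by (auto simp: D_def)
  ultimately show "D \<inter> B \<noteq> {}" by blast
qed

text \<open>On a compact \<open>C \<subseteq> D\<close> the eventual value \<open>r\<close> is injective modulo the family with values in a separable metric space, and
  on a suitable compact \<open>E \<subseteq> C\<close> with \<open>r(E)\<close> dense in \<open>r(C)\<close> it coincides with the continuous map
  \<open>g \<mapsto> (\<xi>\<^sub>i\<^sub>k(g))\<^sub>k\<close> for a fixed \<open>i\<close>. So \<open>r(E) = r(C)\<close>, and every point of \<open>C\<close> takes the same values
  under the family as some point of \<open>E\<close>.\<close>

lemma compact_subset_D:
  assumes C: "compactin T C" "C \<subseteq> D"
  obtains i j where "i \<in> I" "j \<in> I" "i \<noteq> j" "\<forall>x\<in>C. \<xi> i 0 x = \<xi> j 0 x"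
proof -
  have CG: "C \<subseteq> carrier G" using C(2) by (auto simp: D_def)
  have "\<exists>F n. represents F n g" if "g \<in> C" for g using that C(2) by (auto simp: D_def)
  then obtain F n where rep: "\<And>g. g \<in> C \<Longrightarrow> represents (F g) (n g) g" by metis
  define r where "r = (\<lambda>g. tail (F g) (n g))"
  define S where "S = (\<lambda>g. \<Union>s\<in>F g. range (fst \<circ> s))"
  have S: "countable (S g)" if "g \<in> C" for g
    using rep[OF that] unfolding S_def represents_def by (intro countable_UN) (auto intro: countable_finite)
  have r: "\<xi> i k g = r g k" if "g \<in> C" "i \<in> I - S g" for g i k
    using represents_tail[OF rep[OF that(1)], of i k] that by (simp add: r_def S_def)
  have r_inj: "\<xi> i k g = \<xi> i k g'" if "g \<in> C" "g' \<in> C" "r g = r g'" "i \<in> I" for g g' i k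
    by (rule tail_inj[OF rep[OF that(1)] rep[OF that(2)] that(3)[unfolded r_def] that(4)])
  \<comment> \<open>Complex sequences under pointwise convergence form a separable metrizable space,
    so the image of \<open>C\<close> has a countable dense subset although \<open>r\<close> need not
    be continuous.\<close>
  obtain Q where Q: "countable Q" "Q \<subseteq> r ` C" "r ` C \<subseteq> closure Q" by (rule separable)
  then obtain P where P: "P \<subseteq> C" "countable P" "Q = r ` P"
    by (meson countable_subset_image)
  define SP where "SP = (\<Union>g\<in>P. S g)"
  have cSP: "countable SP" unfolding SP_def using P S by (intro countable_UN) auto
  have avoid: "\<exists>i. i \<in> I - K" if "countable K" for K
    using uncountable_minus_countable[OF uncountable_I that] by (metis countable_empty equals0I)
  obtain i where i: "i \<in> I" "i \<notin> SP" using avoid[OF cSP] by blast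
  obtain j where j: "j \<in> I" "j \<notin> SP" "j \<noteq> i" using avoid[of "insert i SP"] cSP by auto
  define \<Psi> where "\<Psi> = (\<lambda>g k. \<xi> i k g)"
  have cont_family: "continuous_map T euclidean (\<xi> i' k)" if "i' \<in> I" for i' k
    using family_character[OF that] by (simp add: characters_iff unitary_character_def)
  have "continuous_map T (product_topology (\<lambda>_. euclidean) UNIV) \<Psi>"
    unfolding continuous_map_componentwise_UNIV \<Psi>_def using cont_family[OF i(1)] by blast
  then have cont: "continuous_map T euclidean \<Psi>" by (simp add: euclidean_product_topology)
  \<comment> \<open>On \<open>E\<close> all rows of the family with index outside \<open>SP\<close>
    agree with row \<open>i\<close>. This closed condition holds on \<open>P\<close>, whose points
    have their exceptional indices in \<open>SP\<close>.\<close>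
  define E where "E = C \<inter> (\<Inter>i'\<in>I - SP. \<Inter>k. {g \<in> topspace T. \<xi> i' k g - \<xi> i k g \<in> {0}})"
  have "closedin T {g \<in> topspace T. \<xi> i' k g - \<xi> i k g \<in> {0}}" if "i' \<in> I - SP" for i' k
  proof (rule closedin_continuous_map_preimage)
    show "continuous_map T euclidean (\<lambda>g. \<xi> i' k g - \<xi> i k g)"
      using cont_family that i by (intro continuous_map_diff) auto
  qed simp
  then have "closedin T (\<Inter>i'\<in>I - SP. \<Inter>k. {g \<in> topspace T. \<xi> i' k g - \<xi> i k g \<in> {0}})"
    using i by (intro closedin_Inter) (auto intro!: closedin_Inter)
  then have "compactin T E" unfolding E_def by (rule compact_Int_closedin[OF C(1)])
  then have "compact (\<Psi> ` E)" using image_compactin[OF _ cont] by simp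
  then have closed: "closed (\<Psi> ` E)" by (rule compact_imp_closed)
  have E: "E \<subseteq> C" by (auto simp: E_def)
  have rE: "r g = \<Psi> g" if g: "g \<in> E" for g
  proof -
    \<comment> \<open>An index that avoids both exceptional sets links the eventual value of
      \<open>g\<close> with row \<open>i\<close>.\<close>
    obtain i' where i': "i' \<in> I - (SP \<union> S g)" using avoid[of "SP \<union> S g"] cSP S E g by auto
    show ?thesis
    proof
      fix k
      have "\<xi> i' k g = \<xi> i k g" using g i' by (auto simp: E_def)
      then show "r g k = \<Psi> g k" using r[of g i' k] i' g E by (auto simp: \<Psi>_def)
    qed
  qed
  have PE: "P \<subseteq> E"
  proof
    fix g assume g: "g \<in> P"
    then have gC: "g \<in> C" "g \<in> carrier G" using P CG by auto
    have "\<xi> i' k g = r g k" if "i' \<in> I - SP" for i' k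
      using r[OF gC(1), of i'] that g by (auto simp: SP_def)
    then have "\<xi> i' k g = \<xi> i k g" if "i' \<in> I - SP" for i' k using that i by auto
    then show "g \<in> E" using gC by (auto simp: E_def topspace_eq_carrier)
  qed
  have "Q \<subseteq> \<Psi> ` E" using P(3) PE rE by auto
  then have rC: "r ` C \<subseteq> \<Psi> ` E" using Q(3) closed closure_minimal by blast
  have "\<xi> i 0 g = \<xi> j 0 g" if g: "g \<in> C" for g
  proof -
    obtain g' where g': "g' \<in> E" "r g = \<Psi> g'" using rC g by blast
    then have eq: "r g = r g'" using rE by simp
    have "\<xi> i 0 g = \<xi> i 0 g'" "\<xi> j 0 g = \<xi> j 0 g'"
      using r_inj[OF g _ eq] g' E i j by auto
    moreover have "\<xi> j 0 g' = \<xi> i 0 g'" using g' j by (auto simp: E_def)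
    ultimately show ?thesis by simp
  qed
  then show thesis using that[of i j] i j by blast
qed

end

text \<open>Doubling the angle at least doubles \<open>1 - Re\<close> while the real part lies in
  [0, 1], yet all powers keep \<open>1 - Re\<close> below 1.\<close>

lemma all_powers_right_half_plane:
  fixes z :: complex
  assumes "cmod z = 1" "\<And>n. Re (z ^ n) > 0"
  shows "z = 1"
proof -
  have *: "2 ^ n * (1 - Re z) \<le> 1 - Re (z ^ 2 ^ n)" for n :: nat
  proof (induction n)
    case (Suc n)
    let ?w = "z ^ 2 ^ n"
    have "cmod ?w = 1" using assms(1) by (simp add: norm_power)
    then have w: "(Re ?w)\<^sup>2 + (Im ?w)\<^sup>2 = 1" using cmod_power2[of ?w] by simp
    have "Re (z ^ 2 ^ Suc n) = Re (?w ^ 2)" by (simp add: power_mult[symmetric] mult.commute)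
    also have "\<dots> = 2 * (Re ?w)\<^sup>2 - 1" using w by (simp add: power2_eq_square)
    finally have 1: "1 - Re (z ^ 2 ^ Suc n) = 2 * (1 - Re ?w) + 2 * (Re ?w - (Re ?w)\<^sup>2)" by simp
    have "Re ?w \<le> 1" using \<open>cmod ?w = 1\<close> complex_Re_le_cmod[of ?w] by simp
    then have "(Re ?w)\<^sup>2 \<le> Re ?w"
      using assms(2)[of "2 ^ n"] by (simp add: power2_eq_square mult_left_le)
    then show ?case using Suc 1 by simp
  qed simp
  have "Re z = 1"
  proof (rule ccontr)
    assume "Re z \<noteq> 1"
    moreover have "Re z \<le> 1" using assms(1) complex_Re_le_cmod[of z] by simp
    ultimately have pos: "1 - Re z > 0" by simp
    then obtain n where "1 / (1 - Re z) < 2 ^ n" using real_arch_pow[of 2 "1 / (1 - Re z)"] by auto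
    then have "1 < 2 ^ n * (1 - Re z)" using pos by (simp add: field_simps)
    then show False using *[of n] assms(2)[of "2 ^ n"] by simp
  qed
  moreover then have "Im z = 0" using assms(1) cmod_power2[of z] by simp
  ultimately show ?thesis by (simp add: complex_eq_iff)
qed

text \<open>Membership in a subbasic set depends only on the values on one compact set. Finite
  intersections unite these compact sets, and a union keeps one of them.\<close>

lemma compact_open_neighbourhood_one:
  assumes W: "openin (compact_open_topology X circle_topology) W" "(\<lambda>x\<in>topspace X. 1) \<in> W"
  obtains C where "compactin X C"
    "\<forall>\<phi>\<in>continuous_maps X circle_topology. (\<forall>x\<in>C. \<phi> x = 1) \<longrightarrow> \<phi> \<in> W"
proof -
  define good where "good = (\<lambda>W. \<exists>C. compactin X C \<and>
    (\<forall>\<phi>\<in>continuous_maps X circle_topology. (\<forall>x\<in>C. \<phi> x = 1) \<longrightarrow> \<phi> \<in> W))"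
  let ?one = "\<lambda>x\<in>topspace X. 1 :: complex"
  have "?one \<in> W \<longrightarrow> good W"
    using openin_topology_generated_by[OF W(1)[unfolded compact_open_topology_def]]
  proof induction
    case (Int a b)
    show ?case
    proof
      assume "?one \<in> a \<inter> b"
      then obtain C C' where "compactin X C" "compactin X C'"
        "\<forall>\<phi>\<in>continuous_maps X circle_topology. (\<forall>x\<in>C. \<phi> x = 1) \<longrightarrow> \<phi> \<in> a"
        "\<forall>\<phi>\<in>continuous_maps X circle_topology. (\<forall>x\<in>C'. \<phi> x = 1) \<longrightarrow> \<phi> \<in> b"
        using Int unfolding good_def by blast
      then show "good (a \<inter> b)" unfolding good_def by (intro exI[of _ "C \<union> C'"]) (auto intro: compactin_Un)
    qed
  next
    case (UN K)
    show ?case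
    proof
      assume "?one \<in> \<Union> K"
      then obtain k where k: "k \<in> K" "?one \<in> k" by blast
      then have "good k" using UN by blast
      then show "good (\<Union> K)" using k(1) unfolding good_def by (meson UnionI)
    qed
  next
    case (Basis W)
    then obtain K U where K: "compactin X K" "W = {f \<in> continuous_maps X circle_topology. f ` K \<subseteq> U}"
      by blast
    show ?case
    proof
      assume one: "?one \<in> W"
      have "\<phi> ` K \<subseteq> U" if "\<forall>x\<in>K. \<phi> x = 1" for \<phi> :: "_ \<Rightarrow> complex"
      proof -
        have "\<phi> ` K = ?one ` K" using that compactin_subset_topspace[OF K(1)] by (intro image_cong) auto
        then show ?thesis using one K(2) by auto
      qed
      then show "good W" unfolding good_def K(2) using K(1) by blast
    qed
  qed simp
  then show thesis using W(2) that unfolding good_def by blast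
qed

context compact_abelian_group
begin

text \<open>The homeomorphism carries the isolated trivial character of \<open>G\<close> to the dual
  of \<open>D\<close>, where its neighbourhood contains all characters that are 1 on some compact
  \<open>C\<close>. Injectivity of restriction then makes a character of \<open>G\<close> that is 1
  on \<open>C\<close> trivial.\<close>

lemma determines_imp_compact_separates:
  assumes "determines D G T"
  obtains C where "compactin T C" "C \<subseteq> D"
    "\<And>\<eta> x. \<eta> \<in> characters G T \<Longrightarrow> \<forall>x\<in>C. \<eta> x = 1 \<Longrightarrow> x \<in> carrier G \<Longrightarrow> \<eta> x = 1"
proof -
  let ?GD = "G\<lparr>carrier := D\<rparr>" and ?TD = "subtopology T D"
  let ?res = "\<lambda>\<phi>. restrict \<phi> D :: 'a \<Rightarrow> complex"
  have D: "subgroup D G" and iso: "?res \<in> iso (dual_group G T) (dual_group ?GD ?TD)"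
    and hom: "homeomorphic_map (dual_topology G T) (dual_topology ?GD ?TD) ?res"
    using assms by (auto simp: determines_def topological_group_isomorphism_def)
  have DG: "D \<subseteq> carrier G" using D by (rule subgroup.subset)
  have TD: "topspace ?TD = D" using DG by (auto simp: topspace_eq_carrier)
  have inj: "inj_on ?res (characters G T)"
    and im: "\<And>\<phi>. \<phi> \<in> characters G T \<Longrightarrow> ?res \<phi> \<in> characters ?GD ?TD"
    using iso by (auto simp: iso_def bij_betw_def dual_group_def)
  define u where "u = (\<lambda>x\<in>carrier G. 1 :: complex)"
  have u: "u \<in> characters G T"
    unfolding u_def by (rule restrict_character[OF unitary_character_const_one])
  \<comment> \<open>The open right half of the circle contains no nontrivial subgroup, so the
    neighbourhood built from it isolates \<open>u\<close>.\<close>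
  let ?U = "{z \<in> sphere (0::complex) 1. 0 < Re z}"
  let ?O = "{f \<in> continuous_maps T circle_topology. f ` carrier G \<subseteq> ?U}"
  have "openin circle_topology ?U"
  proof -
    have "open {z. 0 < Re z}" by (intro open_Collect_less continuous_intros)
    moreover have "?U = sphere 0 1 \<inter> {z. 0 < Re z}" by auto
    ultimately show ?thesis unfolding circle_topology_def by (metis openin_open_Int)
  qed
  moreover have "compactin T (carrier G)" using compact by (simp add: compact_space_def topspace_eq_carrier)
  ultimately have "openin (compact_open_topology T circle_topology) ?O"
    unfolding compact_open_topology_def by (intro topology_generated_by_Basis) blast
  then have "openin (dual_topology G T) (?O \<inter> characters G T)"
    unfolding dual_topology_def by (rule openin_subtopology_Int)
  also have "?O \<inter> characters G T = {u}"
  proof (intro equalityI subsetI)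
    fix \<phi> assume \<phi>: "\<phi> \<in> ?O \<inter> characters G T"
    then have \<phi>u: "unitary_character \<phi>" by (simp add: characters_iff)
    have "\<phi> x = 1" if x: "x \<in> carrier G" for x
    proof (rule all_powers_right_half_plane)
      have "\<phi> (x [^] n) = \<phi> x ^ n" for n :: nat
        using x \<phi>u unitary_character_one[OF \<phi>u] by (induction n) (simp_all add: unitary_character_def mult.commute)
      moreover have "0 < Re (\<phi> (x [^] n))" for n :: nat using \<phi> x by auto
      ultimately show "0 < Re (\<phi> x ^ n)" for n :: nat by simp
    qed (use \<phi>u x in \<open>simp add: unitary_character_def\<close>)
    then show "\<phi> \<in> {u}" using \<phi> u by (auto intro!: character_eqI simp: u_def)
  next
    fix \<phi> assume "\<phi> \<in> {u}"
    moreover have "u \<in> continuous_maps T circle_topology" using u by (simp add: characters_def)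
    ultimately show "\<phi> \<in> ?O \<inter> characters G T" using u by (auto simp: u_def)
  qed
  finally have "openin (dual_topology ?GD ?TD) (?res ` {u})"
    using homeomorphic_imp_open_map[OF hom] unfolding open_map_def by blast
  then obtain W where W: "openin (compact_open_topology ?TD circle_topology) W"
    "?res ` {u} = W \<inter> characters ?GD ?TD"
    unfolding dual_topology_def openin_subtopology by blast
  have "(\<lambda>x\<in>topspace ?TD. 1) = ?res u" unfolding TD u_def using DG by (auto simp: fun_eq_iff)
  then have "(\<lambda>x\<in>topspace ?TD. 1) \<in> W" using W(2) by auto
  then obtain C where C: "compactin ?TD C"
    "\<forall>\<phi>\<in>continuous_maps ?TD circle_topology. (\<forall>x\<in>C. \<phi> x = 1) \<longrightarrow> \<phi> \<in> W"
    using compact_open_neighbourhood_one[OF W(1)] by blast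
  then have CT: "compactin T C" "C \<subseteq> D" by (auto simp: compactin_subtopology)
  show thesis
  proof (rule that[OF CT])
    fix \<eta> x assume \<eta>: "\<eta> \<in> characters G T" "\<forall>x\<in>C. \<eta> x = 1" and x: "x \<in> carrier G"
    have "?res \<eta> \<in> characters ?GD ?TD" using im \<eta> by blast
    moreover then have "?res \<eta> \<in> continuous_maps ?TD circle_topology" by (simp add: characters_def)
    moreover have "\<forall>x\<in>C. ?res \<eta> x = 1" using \<eta>(2) CT(2) by auto
    ultimately have "?res \<eta> \<in> W" using C(2) by blast
    with \<open>?res \<eta> \<in> characters ?GD ?TD\<close>
    have "?res \<eta> = ?res u" using W(2) by blast
    then have "\<eta> = u" using inj \<eta>(1) u by (meson inj_onD)
    then show "\<eta> x = 1" using x by (simp add: u_def)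
  qed
qed

end

section \<open>Contradiction from an uncountable dual\<close>

theorem corollary4p6:
  fixes G :: "('a, 'm) monoid_scheme" and T :: "'a topology"
  assumes "hausdorff_topological_group G T"
    and "comm_group G"
    and "compact_space T"
    and "\<And>D. subgroup D G \<Longrightarrow> gdelta_dense T D \<Longrightarrow> determines D G T"
  shows "metrizable_space T"
proof (rule ccontr)
  assume nonmetrizable: "\<not> metrizable_space T"
  interpret compact_abelian_group G T
    using assms(1-3) by (simp add: compact_abelian_group_def compact_abelian_group_axioms_def)
  have "uncountable (characters G T)"
    using nonmetrizable countable_characters_imp_metrizable by blast
  then obtain m B where B: "independent m B" "uncountable B" by (rule uncountable_independent)
  obtain I :: "real set" and \<xi> :: "real \<Rightarrow> nat \<Rightarrow> 'a \<Rightarrow> complex" where I: "uncountable I" "inj_on (\<lambda>(i, k). \<xi> i k) (I \<times> UNIV)"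
    "(\<lambda>(i, k). \<xi> i k) ` (I \<times> UNIV) \<subseteq> B" by (rule uncountable_real_indexing[OF B(2)])
  obtain \<zeta> :: complex where \<zeta>: "cmod \<zeta> = 1" "\<zeta> ^ m = 1" "\<forall>n :: int. \<zeta> powi n = 1 \<longrightarrow> int m dvd n"
    by (rule exists_root_of_order)
  interpret independent_characters G T m I \<xi> \<zeta>
    using I \<zeta> independent_subset[OF B(1)] by unfold_locales auto
  obtain C where C: "compactin T C" "C \<subseteq> D"
    and trivial: "\<And>\<eta> x. \<eta> \<in> characters G T \<Longrightarrow> \<forall>x\<in>C. \<eta> x = 1 \<Longrightarrow> x \<in> carrier G \<Longrightarrow> \<eta> x = 1"
    using determines_imp_compact_separates[OF assms(4)[OF subgroup_D gdelta_dense_D]] by blast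
  obtain i j where ij: "i \<in> I" "j \<in> I" "i \<noteq> j" and eq: "\<forall>x\<in>C. \<xi> i 0 x = \<xi> j 0 x"
    by (rule compact_subset_D[OF C])
  \<comment> \<open>The quotient of two distinct members of the family that agree on
    \<open>C\<close>: it is 1 on \<open>C\<close>, so it would be trivial on all of
    \<open>G\<close>.\<close>
  define \<eta> where "\<eta> = (\<lambda>x\<in>carrier G. \<xi> i 0 x * cnj (\<xi> j 0 x))"
  have X: "\<xi> i 0 \<in> characters G T" "\<xi> j 0 \<in> characters G T" using ij family_character by auto
  have unit: "\<xi> j 0 x * cnj (\<xi> j 0 x) = 1" if "x \<in> carrier G" for x
    using character_cmod[OF X(2) that] complex_norm_square[of "\<xi> j 0 x"] by simp
  have "\<eta> \<in> characters G T"
    unfolding \<eta>_def using X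
    by (intro restrict_character unitary_character_mult unitary_character_cnj) (auto simp: characters_iff)
  moreover have "\<forall>x\<in>C. \<eta> x = 1"
    using C eq unit by (auto simp: \<eta>_def D_def)
  ultimately have one: "\<eta> x = 1" if "x \<in> carrier G" for x using trivial that by blast
  have "\<xi> i 0 x = \<xi> j 0 x" if x: "x \<in> carrier G" for x
  proof -
    have "\<xi> i 0 x * cnj (\<xi> j 0 x) = \<xi> j 0 x * cnj (\<xi> j 0 x)" using one[OF x] unit[OF x] x by (simp add: \<eta>_def)
    then show ?thesis using character_nz[OF X(2) x] by simp
  qed
  then have "\<xi> i 0 = \<xi> j 0" by (rule character_eqI[OF X])
  then show False using inj_onD[OF I(2), of "(i, 0)" "(j, 0)"] ij by simp
qed

end
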